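(* Let $n\ge1$ be an integer and let $F,G\subseteq\mathbb{R}^n$ be nonempty rational affine subspaces. Then the following conditions are equivalent: (i) There exists $\gamma\in\mathsf{GL}(n,\mathbb{Z})$ such that $\gamma(F)=G$; (ii) $(\dim(F),\mathsf{V}_F)=(\dim(G),\mathsf{V}_G)$.
   Context: $\mathsf{GL}(n,\mathbb{Z})$ is the group of linear transformations $x\mapsto\mathcal{U}x$ of $\mathbb{R}^n$ with $\mathcal{U}$ an integer $(n\times n)$-matrix, $\det(\mathcal{U})=\pm1$. A rational affine hyperplane in $\mathbb{R}^n$ is a set $\{z\in\mathbb{R}^n\mid\langle h,z\rangle=r\}$ with $0\ne h\in\mathbb{Q}^n$ and $r\in\mathbb{Q}$; a rational affine subspace is an intersection of rational affine hyperplanes ($\mathbb{R}^n$ itself included). Equivalently, an $m$-dimensional rational affine subspace is the affine hull of $m+1$ affinely independent points of $\mathbb{Q}^n$. For a rational point $x\in\mathbb{Q}^n$, $\mathrm{den}(x)$ is the least common denominator of its coordinates, and its homogeneous correspondent is $\tilde{x}=(\mathrm{den}(x)x_1,\ldots,\mathrm{den}(x)x_n,\mathrm{den}(x))\in\mathbb{Z}^{n+1}$. A rational $m$-simplex $T=\mathrm{conv}(v_0,\ldots,v_m)\subseteq\mathbb{R}^n$ (convex hull of $m+1$ affinely independent points of $\mathbb{Q}^n$) is (Farey) regular if $\{\tilde v_0,\ldots,\tilde v_m\}$ can be extended to a basis of the free abelian group $\mathbb{Z}^{n+1}$; then $\mathrm{den}(T)=\prod_{j=0}^m\mathrm{den}(v_j)$.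 A rational polyhedron $R\subseteq\mathbb{R}^n$ is a finite union of rational simplexes. A regular triangulation of $R$ is a finite simplicial complex $\Delta$ with union $R$ all of whose simplexes are regular. Every rational polyhedron has a regular triangulation. For $i=0,1,\ldots$, the $i$-dimensional rational measure of $R$ is $\lambda_i(R)=\sum_{T\in\Delta^{\max}(i)}\frac{1}{i!\,\mathrm{den}(T)}$, where $\Delta$ is any regular triangulation of $R$ and $\Delta^{\max}(i)$ is the set of $i$-dimensional simplexes of $\Delta$ that are maximal under inclusion in $\Delta$ (the sum is $0$ if this set is empty). It is known that $\lambda_i(R)$ does not depend on $\Delta$. For $v_0,\ldots,v_e\in\mathbb{R}^n$, $\mathcal{P}(v_0,\ldots,v_e)=\{\sum_{i=0}^e\alpha_iv_i\mid\alpha_i\in[0,1]\}$. For a nonempty rational affine subspace $F$, $d_F=\min\{\mathrm{den}(v)\mid v\in F\cap\mathbb{Q}^n\}$. If $e=\dim F$, then $\mathsf{V}_F=\lambda_{e+1}(\mathcal{P}(v_0,\ldots,v_e))$, where $v_0,\ldots,v_e$ are any rational points of $F$, all of denominator $d_F$, such that $\mathrm{conv}(v_0,\ldots,v_e)$ is a regular $e$-simplex; such points exist and $\mathsf{V}_F$ does not depend on their choice. *)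

theory Defs
  imports "HOL-Analysis.Analysis"
begin

definition GL_int :: "(real^'n \<Rightarrow> real^'n) set" where
  "GL_int = {(\<lambda>x. U *v x) | U. (\<forall>i j. U $ i $ j \<in> \<int>) \<and> (det U = 1 \<or> det U = -1)}"

definition rational_points :: "(real^'n) set" where
  "rational_points = {x. \<forall>i. x $ i \<in> \<rat>}"

definition rational_hyperplane :: "(real^'n) set \<Rightarrow> bool" where
  "rational_hyperplane H \<longleftrightarrow>
    (\<exists>h r. h \<noteq> 0 \<and> h \<in> rational_points \<and> r \<in> \<rat> \<and> H = {z. h \<bullet> z = r})"

text \<open>The empty family has intersection \<^term>\<open>UNIV\<close>, so the whole space is included; so is
  the empty set, as an intersection of parallel hyperplanes.\<close>

definition rational_affine_subspace :: "(real^'n) set \<Rightarrow> bool" where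
  "rational_affine_subspace F \<longleftrightarrow> (\<exists>\<H>. (\<forall>H\<in>\<H>. rational_hyperplane H) \<and> F = \<Inter>\<H>)"

text \<open>\<open>den\<close> and \<open>homogeneous\<close> are only meaningful at rational points.\<close>

definition den :: "real^'n \<Rightarrow> nat" where
  "den x = (LEAST d. 0 < d \<and> (\<forall>i. real d * x $ i \<in> \<int>))"

text \<open>The index type \<^typ>\<open>'n option\<close> has one element more than \<^typ>\<open>'n\<close>; the extra
  coordinate \<^term>\<open>None\<close> carries the denominator. The floor is taken of an integer.\<close>

definition homogeneous :: "real^'n \<Rightarrow> int^('n option)" where
  "homogeneous x = (\<chi> j. case j of None \<Rightarrow> int (den x) | Some i \<Rightarrow> \<lfloor>real (den x) * x $ i\<rfloor>)"

global_interpretation int_vec: module "(*s) :: int \<Rightarrow> int^'m \<Rightarrow> int^'m"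
  by unfold_locales (vector algebra_simps)+

definition int_basis :: "(int^'m) set \<Rightarrow> bool" where
  "int_basis B \<longleftrightarrow> int_vec.independent B \<and> int_vec.span B = UNIV"

definition regular_simplex :: "(real^'n) set \<Rightarrow> bool" where
  "regular_simplex T \<longleftrightarrow>
    (\<exists>V. V \<subseteq> rational_points \<and> \<not> affine_dependent V \<and> T = convex hull V \<and>
         (\<exists>B. homogeneous ` V \<subseteq> B \<and> int_basis B))"

text \<open>The vertices of a simplex are its extreme points.\<close>

definition den_simplex :: "(real^'n) set \<Rightarrow> nat" where
  "den_simplex T = (\<Prod>v | v extreme_point_of T. den v)"

text \<open>A \<^const>\<open>simplicial_complex\<close> contains all faces of its members, the empty one included;
  the empty simplex is regular and does not contribute to any measure below.\<close>

definition regular_triangulation :: "(real^'n) set set \<Rightarrow> (real^'n) set \<Rightarrow> bool" where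
  "regular_triangulation \<Delta> R \<longleftrightarrow>
    simplicial_complex \<Delta> \<and> \<Union>\<Delta> = R \<and> (\<forall>T\<in>\<Delta>. regular_simplex T)"

definition max_simplexes :: "(real^'n) set set \<Rightarrow> nat \<Rightarrow> (real^'n) set set" where
  "max_simplexes \<Delta> i = {T\<in>\<Delta>. int i simplex T \<and> (\<forall>S\<in>\<Delta>. T \<subseteq> S \<longrightarrow> S = T)}"

text \<open>The common value of the sum over all regular triangulations of \<open>R\<close>; it exists and is
  unique for every rational polyhedron \<open>R\<close>.\<close>

definition rational_measure :: "nat \<Rightarrow> (real^'n) set \<Rightarrow> real" where
  "rational_measure i R =
    (THE r. \<exists>\<Delta>. regular_triangulation \<Delta> R \<and>
       r = (\<Sum>T\<in>max_simplexes \<Delta> i. 1 / (fact i * real (den_simplex T))))"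

definition parallelotope :: "nat \<Rightarrow> (nat \<Rightarrow> real^'n) \<Rightarrow> (real^'n) set" where
  "parallelotope e v = {\<Sum>i\<le>e. \<alpha> i *\<^sub>R v i | \<alpha>. \<forall>i\<le>e. \<alpha> i \<in> {0..1}}"

definition min_den :: "(real^'n) set \<Rightarrow> nat" where
  "min_den F = (LEAST d. \<exists>v \<in> F \<inter> rational_points. d = den v)"

text \<open>The common value for all admissible choices of \<open>v 0, \<dots>, v e\<close>; it exists and is unique
  for every nonempty rational affine subspace \<open>F\<close>. That the convex hull of these \<open>e + 1\<close> points
  is an \<open>e\<close>-simplex forces them to be distinct and affinely independent, hence to be its
  vertices.\<close>

definition affine_invariant :: "(real^'n) set \<Rightarrow> real" where
  "affine_invariant F =
    (let e = nat (aff_dim F) in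
      THE r. \<exists>v. (\<forall>i\<le>e. v i \<in> F \<inter> rational_points \<and> den (v i) = min_den F) \<and>
        int e simplex (convex hull (v ` {..e})) \<and>
        regular_simplex (convex hull (v ` {..e})) \<and>
        r = rational_measure (e + 1) (parallelotope e v))"

end

theory Submission
  imports Defs "HOL-Library.Multiset"
begin

text \<open>After a transformation in \<open>GL(n, \<int>)\<close>, a rational affine subspace of dimension \<open>e < n\<close> is
  \<open>{x. x k = c / d, x i = 0 for i \<notin> J \<union> {k}}\<close> with \<open>card J = e\<close> and \<open>c\<close>, \<open>d\<close> coprime: take a basis
  of the integer points of the direction space and extend it by one vector \<open>b\<close> so that a rational
  point of the subspace is \<open>(c / d) b\<close> modulo the direction space. A regular \<open>m\<close>-simplex has lattice
  volume \<open>1 / (m! den T)\<close>, so the rational measure of the parallelotope is proportional to its volume,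
  which is \<open>c / d ^ (e + 1)\<close>; the factor depends only on \<open>J\<close> and \<open>k\<close> and need not be computed. The
  fraction is in lowest terms, so it determines \<open>c\<close> and \<open>d\<close>.

  Regular triangulations of rational polytopes come from simplicial fans in \<open>\<real>\<^sup>n\<^sup>+\<^sup>1\<close>. A placing
  construction gives some fan; it is made unimodular by star subdivisions at integer points of the
  fundamental boxes of its cones, each of which replaces boxes by ones with fewer integer points.\<close>


section \<open>Unimodular sets of integer vectors\<close>

text \<open>The measure and the invariant are definite descriptions, so their values are usable only
  after existence and uniqueness are known. From (i) to (ii) this is avoided: an integer
  automorphism carries the describing predicate of \<open>F\<close> to that of its image. From (ii)
  to (i) the actual value is needed, hence a regular triangulation of the parallelotope and a reason
  why all of them give the same sum. The reason is volume: the homogeneous vertices of a regular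
  simplex of top dimension in a coordinate subspace have determinant 1 or -1, and moving them to
  height 1 divides by their denominators, so the cone over \<open>T\<close> has volume proportional
  to \<open>1 / den T\<close>. The volume of the union of these cones does not see the
  triangulation. A parallelotope of \<open>F\<close> need not be full-dimensional in the whole
  space; the normal form puts it into e + 1 coordinates, and the remaining directions are filled up
  by a cube. Dimension n is separate: no coordinate is left for k, and both subspaces are the whole
  space.\<close>

definition int_vecs :: "(real^'m) set" where
  "int_vecs = {x. \<forall>i. x $ i \<in> \<int>}"

text \<open>Allowing real coefficients builds linear independence over the reals into the definition:
  a nontrivial relation could be rescaled to have a non-integer coefficient.\<close>

definition unimodular :: "(real^'m) set \<Rightarrow> bool" where
  "unimodular S \<longleftrightarrow> finite S \<and> S \<subseteq> int_vecs \<and>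
    (\<forall>a. (\<Sum>u\<in>S. a u *\<^sub>R u) \<in> int_vecs \<longrightarrow> (\<forall>u\<in>S. a u \<in> \<int>))"

lemma int_vecs_add [intro]: "x \<in> int_vecs \<Longrightarrow> y \<in> int_vecs \<Longrightarrow> x + y \<in> int_vecs"
  and int_vecs_diff [intro]: "x \<in> int_vecs \<Longrightarrow> y \<in> int_vecs \<Longrightarrow> x - y \<in> int_vecs"
  and int_vecs_scaleR [intro]: "c \<in> \<int> \<Longrightarrow> x \<in> int_vecs \<Longrightarrow> c *\<^sub>R x \<in> int_vecs"
  and zero_int_vecs [simp]: "0 \<in> int_vecs"
  by (auto simp: int_vecs_def)

lemma axis_int_vecs [simp]: "axis i 1 \<in> int_vecs"
  by (auto simp: int_vecs_def axis_def)

lemma int_vecs_sum [intro]: "(\<And>i. i \<in> I \<Longrightarrow> f i \<in> int_vecs) \<Longrightarrow> (\<Sum>i\<in>I. f i) \<in> int_vecs"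
  by (induction I rule: infinite_finite_induct) auto

lemma finite_bounded_int_vecs:
  fixes S :: "(real^'m) set"
  assumes "S \<subseteq> int_vecs" "bounded S"
  shows "finite S"
proof -
  obtain B where B: "\<And>x. x \<in> S \<Longrightarrow> norm x \<le> B"
    using assms(2) by (auto simp: bounded_iff)
  define I :: "real set" where "I = of_int ` {-\<lceil>B\<rceil>..\<lceil>B\<rceil>}"
  have "x $ i \<in> I" if x: "x \<in> S" for x i
  proof -
    obtain k where k: "x $ i = of_int k"
      using subsetD[OF assms(1) x] by (auto simp: int_vecs_def elim!: Ints_cases)
    have "\<bar>of_int k\<bar> \<le> B"
      using component_le_norm_cart[of x i] B[OF x] k by simp
    then have "k \<in> {-\<lceil>B\<rceil>..\<lceil>B\<rceil>}" by (simp add: abs_le_iff) linarith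
    then show ?thesis by (auto simp: I_def k)
  qed
  then have "S \<subseteq> vec_lambda ` (UNIV \<rightarrow>\<^sub>E I)"
    by (auto intro!: image_eqI[where x="($) _"] simp: PiE_def extensional_def)
  moreover have "finite (UNIV \<rightarrow>\<^sub>E I :: ('m \<Rightarrow> real) set)"
    by (auto simp: I_def intro!: finite_PiE)
  ultimately show ?thesis by (meson finite_imageI finite_subset)
qed

lemma independent_sum_eq_zeroD:
  assumes "independent S" "finite S" "(\<Sum>u\<in>S. a u *\<^sub>R u) = 0" "u \<in> S"
  shows "a u = 0"
  using independentD assms by blast

lemma independent_sum_eqD:
  assumes "independent S" "finite S" "(\<Sum>u\<in>S. a u *\<^sub>R u) = (\<Sum>u\<in>S. b u *\<^sub>R u)" "u \<in> S"
  shows "a u = b u"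
  using independent_sum_eq_zeroD[OF assms(1,2), of "\<lambda>u. a u - b u" u] assms(3,4)
  by (simp add: algebra_simps sum_subtractf)

lemma unimodular_finite: "unimodular S \<Longrightarrow> finite S"
  and unimodular_int_vecs: "unimodular S \<Longrightarrow> S \<subseteq> int_vecs"
  and unimodularD: "unimodular S \<Longrightarrow> (\<Sum>u\<in>S. a u *\<^sub>R u) \<in> int_vecs \<Longrightarrow> u \<in> S \<Longrightarrow> a u \<in> \<int>"
  by (auto simp: unimodular_def)

lemma unimodular_empty [simp]: "unimodular {}"
  by (simp add: unimodular_def)

lemma unimodular_independent:
  assumes "unimodular S"
  shows "independent S"
proof
  assume "dependent S"
  with unimodular_finite[OF assms] obtain a u where a: "u \<in> S" "a u \<noteq> 0" "(\<Sum>u\<in>S. a u *\<^sub>R u) = 0"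
    by (auto simp: dependent_finite)
  have "(\<Sum>w\<in>S. (1 / (2 * a u) * a w) *\<^sub>R w) = (1 / (2 * a u)) *\<^sub>R (\<Sum>w\<in>S. a w *\<^sub>R w)"
    by (simp add: scaleR_right.sum)
  then have "(\<Sum>w\<in>S. (1 / (2 * a u) * a w) *\<^sub>R w) \<in> int_vecs"
    using a by simp
  from unimodularD[OF assms this a(1)] have "1 / 2 \<in> (\<int> :: real set)"
    using a(2) by simp
  then show False by simp
qed

lemma unimodular_subset:
  assumes "unimodular S" "T \<subseteq> S"
  shows "unimodular T"
proof -
  have fin: "finite S" using assms(1) by (rule unimodular_finite)
  have "\<forall>u\<in>T. a u \<in> \<int>" if "(\<Sum>u\<in>T. a u *\<^sub>R u) \<in> int_vecs" for a
  proof
    fix u assume u: "u \<in> T"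
    have "(\<Sum>u\<in>T. a u *\<^sub>R u) = (\<Sum>u\<in>S. (if u \<in> T then a u else 0) *\<^sub>R u)"
      using fin assms(2) by (intro sum.mono_neutral_cong_left) auto
    with that have "(\<Sum>u\<in>S. (if u \<in> T then a u else 0) *\<^sub>R u) \<in> int_vecs" by simp
    from unimodularD[OF assms(1) this, of u] u assms(2) show "a u \<in> \<int>" by auto
  qed
  then show ?thesis
    using assms fin by (auto simp: unimodular_def intro: finite_subset)
qed

lemma frac_diff_Ints: "a - frac a \<in> \<int>" for a :: real
  by (simp add: frac_def)

text \<open>Subtracting integer parts subtracts an integer combination of \<open>S\<close>. With
  this, lattice points are moved into a half-open box while the summand \<open>z\<close> stays
  fixed.\<close>

lemma sum_frac_int_vecs_iff:
  assumes "S \<subseteq> int_vecs"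
  shows "(\<Sum>u\<in>S. frac (a u) *\<^sub>R u) + z \<in> int_vecs \<longleftrightarrow> (\<Sum>u\<in>S. a u *\<^sub>R u) + z \<in> int_vecs"
proof -
  have d: "(\<Sum>u\<in>S. a u *\<^sub>R u) - (\<Sum>u\<in>S. frac (a u) *\<^sub>R u) \<in> int_vecs"
    using assms
    by (auto simp: sum_subtractf[symmetric] scaleR_diff_left[symmetric] frac_def
        intro!: int_vecs_sum int_vecs_scaleR)
  show ?thesis
    using int_vecs_add[OF d, of "(\<Sum>u\<in>S. frac (a u) *\<^sub>R u) + z"]
      int_vecs_diff[OF _ d, of "(\<Sum>u\<in>S. a u *\<^sub>R u) + z"] by (auto simp: algebra_simps)
qed

text \<open>Among the integer points of a bounded box spanned by \<open>S\<close> and \<open>x\<close>, one with the least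
  positive coefficient at \<open>x\<close> does the job.\<close>

lemma unimodular_insert:
  fixes x :: "real^'m"
  assumes S: "unimodular S" and x: "x \<in> int_vecs" "x \<notin> span S"
  obtains c where "c \<notin> S" "unimodular (insert c S)" "span (insert c S) = span (insert x S)"
proof -
  have fin: "finite S" using S by (rule unimodular_finite)
  have SI: "S \<subseteq> int_vecs" using S by (rule unimodular_int_vecs)
  define f where "f = (\<lambda>(a, t). (\<Sum>u\<in>S. a u *\<^sub>R u) + t *\<^sub>R x)"
  define A where "A = {(a, t). (\<forall>u. 0 \<le> a u \<and> a u \<le> 1) \<and> 0 \<le> t \<and> t \<le> 1 \<and> f (a, t) \<in> int_vecs}"
  have "norm (f p) \<le> (\<Sum>u\<in>S. norm u) + norm x" if "p \<in> A" for p
  proof -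
    obtain a t where p: "p = (a, t)" by (cases p)
    have a: "\<And>u. 0 \<le> a u" "\<And>u. a u \<le> 1" and t: "0 \<le> t" "t \<le> 1"
      using that by (auto simp: A_def p)
    have "norm (\<Sum>u\<in>S. a u *\<^sub>R u) \<le> (\<Sum>u\<in>S. norm u)"
      using a by (intro order.trans[OF norm_sum] sum_mono) (auto simp: mult_left_le_one_le)
    moreover have "norm (t *\<^sub>R x) \<le> norm x"
      using t by (auto simp: mult_left_le_one_le)
    ultimately show ?thesis
      unfolding p f_def using norm_triangle_ineq[of "\<Sum>u\<in>S. a u *\<^sub>R u" "t *\<^sub>R x"] by simp
  qed
  then have "bounded (f ` A)" unfolding bounded_iff by blast
  moreover have "f ` A \<subseteq> int_vecs" by (auto simp: A_def)
  ultimately have "finite (f ` A)" by (rule finite_bounded_int_vecs[rotated])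
  have sp: "(\<Sum>u\<in>S. a u *\<^sub>R u) \<in> span S" for a
    by (intro span_sum span_scale span_base)
  have teq: "t = s" if "f (a, t) = f (b, s)" for a b t s
  proof (rule ccontr)
    assume "t \<noteq> s"
    have "(t - s) *\<^sub>R x = (\<Sum>u\<in>S. b u *\<^sub>R u) - (\<Sum>u\<in>S. a u *\<^sub>R u)"
      using that by (simp add: f_def algebra_simps)
    then have "(t - s) *\<^sub>R x \<in> span S" using span_diff[OF sp sp] by simp
    with \<open>t \<noteq> s\<close> x(2) span_scale[of "(t - s) *\<^sub>R x" S "1 / (t - s)"] show False by simp
  qed
  \<comment> \<open>\<open>x\<close> lies outside \<open>span S\<close>, so a point determines its
    coefficient \<open>t\<close> (\<open>teq\<close>); finitely many points leave finitely many
    \<open>t\<close>, and a least positive one exists.\<close>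
  have "inj_on (\<lambda>t. f (SOME a. (a, t) \<in> A, t)) (snd ` A)"
    by (intro inj_onI) (rule teq)
  moreover have "(\<lambda>t. f (SOME a. (a, t) \<in> A, t)) ` snd ` A \<subseteq> f ` A"
  proof clarsimp
    fix a t assume "(a, t) \<in> A"
    then have "(SOME a. (a, t) \<in> A, t) \<in> A" by (rule someI[where P="\<lambda>a. (a, t) \<in> A"])
    then show "f (SOME a. (a, t) \<in> A, t) \<in> f ` A" by (rule imageI)
  qed
  ultimately have "finite (snd ` A)"
    using \<open>finite (f ` A)\<close> by (meson finite_imageD finite_subset)
  then have finT: "finite (snd ` A \<inter> {0<..})" by blast
  have "(\<lambda>_. 0, 1) \<in> A" using x(1) by (simp add: A_def f_def)
  then have ne: "snd ` A \<inter> {0<..} \<noteq> {}" by force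
  define t0 where "t0 = Min (snd ` A \<inter> {0<..})"
  have "t0 \<in> snd ` A \<inter> {0<..}" unfolding t0_def using finT ne by (rule Min_in)
  then obtain a0 where a0: "(a0, t0) \<in> A" and t0: "t0 > 0" by auto
  have min: "t = 0" if "(a, t) \<in> A" "t < t0" for a t
  proof (rule ccontr)
    assume "t \<noteq> 0"
    moreover have "0 \<le> t" using that(1) by (simp add: A_def)
    ultimately have "t \<in> snd ` A \<inter> {0<..}"
      using image_eqI[of t snd "(a, t)" A] that(1) by simp
    then have "t0 \<le> t" unfolding t0_def using finT by (rule Min_le[rotated])
    with that(2) show False by simp
  qed
  define c where "c = f (a0, t0)"
  have cI: "c \<in> int_vecs" using a0 by (simp add: A_def c_def)
  have c_eq: "c = (\<Sum>u\<in>S. a0 u *\<^sub>R u) + t0 *\<^sub>R x" by (simp add: c_def f_def)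
  have x_eq: "x = (1 / t0) *\<^sub>R (c - (\<Sum>u\<in>S. a0 u *\<^sub>R u))" using t0 by (simp add: c_eq)
  have cns: "c \<notin> span S"
  proof
    assume "c \<in> span S"
    then have "c - (\<Sum>u\<in>S. a0 u *\<^sub>R u) \<in> span S" using sp span_diff by blast
    then have "x \<in> span S" by (subst x_eq) (rule span_scale)
    with x(2) show False ..
  qed
  have cS: "c \<notin> S" using cns span_base by blast
  have "\<forall>u\<in>insert c S. b u \<in> \<int>" if b: "(\<Sum>u\<in>insert c S. b u *\<^sub>R u) \<in> int_vecs" for b
  proof -
    define \<beta> where "\<beta> = b c"
    have bs: "(\<Sum>u\<in>S. b u *\<^sub>R u) + \<beta> *\<^sub>R c \<in> int_vecs"
      using b fin cS by (simp add: \<beta>_def add.commute)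
    \<comment> \<open>Only \<open>frac \<beta>\<close> copies of \<open>c\<close> are kept and
      expanded in \<open>S\<close> and \<open>x\<close>. After reducing the coefficients at
      \<open>S\<close> modulo 1 the point lies in \<open>A\<close> with \<open>t\<close> below
      \<open>t0\<close>, so \<open>frac \<beta>\<close> vanishes; the other coefficients are
      integers because \<open>S\<close> is unimodular.\<close>
    have "(\<beta> - frac \<beta>) *\<^sub>R c \<in> int_vecs" using cI frac_diff_Ints by blast
    from int_vecs_diff[OF bs this] have "(\<Sum>u\<in>S. b u *\<^sub>R u) + frac \<beta> *\<^sub>R c \<in> int_vecs"
      by (simp add: algebra_simps)
    also have "(\<Sum>u\<in>S. b u *\<^sub>R u) + frac \<beta> *\<^sub>R c =
        (\<Sum>u\<in>S. (b u + frac \<beta> * a0 u) *\<^sub>R u) + (frac \<beta> * t0) *\<^sub>R x"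
      by (simp add: c_eq algebra_simps sum.distrib scaleR_right.sum)
    finally have "(\<Sum>u\<in>S. frac (b u + frac \<beta> * a0 u) *\<^sub>R u) + (frac \<beta> * t0) *\<^sub>R x \<in> int_vecs"
      by (subst sum_frac_int_vecs_iff[OF SI])
    moreover have "frac \<beta> * t0 \<le> 1" "frac \<beta> * t0 < t0"
      using a0 t0 frac_lt_1[of \<beta>] frac_ge_0[of \<beta>] by (auto simp: A_def intro: mult_le_one)
    ultimately have "(\<lambda>u. frac (b u + frac \<beta> * a0 u), frac \<beta> * t0) \<in> A"
      using t0 by (auto simp: A_def f_def less_imp_le[OF frac_lt_1])
    with \<open>frac \<beta> * t0 < t0\<close> have "frac \<beta> * t0 = 0" by (rule min[rotated])
    then have \<beta>: "\<beta> \<in> \<int>" using t0 by (simp add: frac_eq_0_iff)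
    then have "\<beta> *\<^sub>R c \<in> int_vecs" using cI by blast
    from int_vecs_diff[OF bs this] have "(\<Sum>u\<in>S. b u *\<^sub>R u) \<in> int_vecs" by simp
    with S \<beta> show ?thesis by (auto simp: \<beta>_def dest: unimodularD)
  qed
  then have "unimodular (insert c S)"
    using fin SI cI by (auto simp: unimodular_def)
  moreover have "span (insert c S) = span (insert x S)"
  proof (rule span_eq[THEN iffD2], intro conjI subsetI)
    have 1: "span S \<subseteq> span (insert y S)" for y by (intro span_mono) auto
    show "z \<in> span (insert x S)" if "z \<in> insert c S" for z
      using that
    proof
      have "(\<Sum>u\<in>S. a0 u *\<^sub>R u) + t0 *\<^sub>R x \<in> span (insert x S)"
        using 1[of x] sp by (intro span_add span_scale) (auto intro: span_base)
      then show "z = c \<Longrightarrow> z \<in> span (insert x S)" by (simp add: c_eq)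
    qed (auto intro: span_base)
    show "z \<in> span (insert c S)" if "z \<in> insert x S" for z
      using that
    proof
      have "(1 / t0) *\<^sub>R (c - (\<Sum>u\<in>S. a0 u *\<^sub>R u)) \<in> span (insert c S)"
        using 1[of c] sp by (intro span_diff span_scale) (auto intro: span_base)
      then show "z = x \<Longrightarrow> z \<in> span (insert c S)" by (simp add: x_eq[symmetric])
    qed (auto intro: span_base)
  qed
  ultimately show ?thesis using that cS by blast
qed

text \<open>Repeated use of \<open>unimodular_insert\<close> ends because independence bounds the
  cardinality by the dimension. With \<open>S = {}\<close> this yields a lattice basis of the
  integer points of a subspace spanned by integer vectors.\<close>

lemma unimodular_extend:
  fixes S :: "(real^'m) set"
  assumes "unimodular S" "S \<subseteq> span A" "A \<subseteq> int_vecs"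
  shows "\<exists>B. S \<subseteq> B \<and> unimodular B \<and> span B = span A"
  using assms
proof (induction "DIM(real^'m) - card S" arbitrary: S rule: less_induct)
  case less
  show ?case
  proof (cases "A \<subseteq> span S")
    case True
    then have "span S = span A" using less.prems by (metis span_eq)
    with less.prems(1) show ?thesis by blast
  next
    case False
    then obtain x where x: "x \<in> A" "x \<notin> span S" by blast
    obtain c where c: "c \<notin> S" "unimodular (insert c S)" "span (insert c S) = span (insert x S)"
      using unimodular_insert[OF less.prems(1) subsetD[OF less.prems(3) x(1)] x(2)] .
    have "span (insert x S) \<subseteq> span A"
      using x less.prems by (intro span_minimal) (auto intro: span_base)
    then have cA: "insert c S \<subseteq> span A"
      using c(3) span_superset by blast
    have "card (insert c S) \<le> DIM(real^'m)"
      using independent_card_le[OF unimodular_independent[OF c(2)]] .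
    moreover have "card (insert c S) = Suc (card S)"
      using c(1) unimodular_finite[OF less.prems(1)] by simp
    ultimately have "DIM(real^'m) - card (insert c S) < DIM(real^'m) - card S" by simp
    from less.hyps[OF this c(2) cA less.prems(3)] obtain B
      where "insert c S \<subseteq> B" "unimodular B" "span B = span A" by blast
    then show ?thesis by (intro exI[of _ B]) simp
  qed
qed

lemma span_int_vecs: "span (int_vecs :: (real^'m) set) = UNIV"
proof -
  have "(Basis :: (real^'m) set) \<subseteq> int_vecs"
    by (auto simp: Basis_vec_def)
  then show ?thesis using span_mono span_Basis by blast
qed

lemma unimodular_extend_UNIV:
  fixes S :: "(real^'m) set"
  assumes "unimodular S"
  shows "\<exists>B. S \<subseteq> B \<and> unimodular B \<and> span B = UNIV"
  using unimodular_extend[OF assms _ order.refl] unfolding span_int_vecs by simp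

section \<open>Unimodular sets and bases of the integer lattice\<close>

definition real_vec :: "int^'m \<Rightarrow> real^'m" where
  "real_vec x = (\<chi> i. real_of_int (x $ i))"

lemma real_vec_nth [simp]: "real_vec x $ i = real_of_int (x $ i)"
  by (simp add: real_vec_def)

lemma real_vec_inject [simp]: "real_vec x = real_vec y \<longleftrightarrow> x = y"
  by (auto simp: vec_eq_iff)

lemma real_vec_sum: "real_vec (\<Sum>i\<in>I. f i) = (\<Sum>i\<in>I. real_vec (f i))"
  by (simp add: vec_eq_iff)

lemma real_vec_scale: "real_vec (c *s x) = of_int c *\<^sub>R real_vec x"
  by (simp add: vec_eq_iff)

lemma range_real_vec: "range real_vec = int_vecs"
proof -
  have "x \<in> range real_vec" if "x \<in> int_vecs" for x :: "real^'m"
    using that by (intro image_eqI[of _ _ "\<chi> i. \<lfloor>x $ i\<rfloor>"]) (auto simp: vec_eq_iff int_vecs_def)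
  then show ?thesis by (auto simp: int_vecs_def)
qed

lemma sum_real_vec_image:
  "(\<Sum>u\<in>real_vec ` S. a u *\<^sub>R u) = (\<Sum>u\<in>S. a (real_vec u) *\<^sub>R real_vec u)"
  by (subst sum.reindex) (auto intro: inj_onI)

text \<open>The coordinate functionals of a basis of the integer lattice extend to real functionals.\<close>

lemma int_basis_unimodular:
  fixes B S :: "(int^'m) set"
  assumes B: "int_basis B" "S \<subseteq> B" "finite S"
  shows "unimodular (real_vec ` S)"
proof -
  have ind: "int_vec.independent B" and sp: "int_vec.span B = UNIV"
    using B by (auto simp: int_basis_def)
  define \<phi> where "\<phi> b x = (\<Sum>j\<in>UNIV. x $ j * of_int (int_vec.representation B (axis j 1) b))"
    for b and x :: "real^'m"
  have lin: "linear (\<phi> b)" for b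
    unfolding \<phi>_def by (rule linearI) (auto simp: algebra_simps sum.distrib sum_distrib_left)
  have \<phi>_int: "\<phi> b (real_vec z) = of_int (int_vec.representation B z b)" for b z
  proof -
    have "z = (\<Sum>j\<in>UNIV. (z $ j) *s axis j 1)"
      by (simp add: vec_eq_iff axis_def if_distrib cong: if_cong)
    then have "int_vec.representation B z b = (\<Sum>j\<in>UNIV. z $ j * int_vec.representation B (axis j 1) b)"
      using int_vec.representation_sum[OF ind, of UNIV "\<lambda>j. (z $ j) *s axis j 1"]
      by (simp add: sp int_vec.representation_scale[OF ind])
    then show ?thesis by (simp add: \<phi>_def)
  qed
  have "a u \<in> \<int>" if a: "(\<Sum>u\<in>S. a u *\<^sub>R real_vec u) \<in> int_vecs" and u: "u \<in> S" for a u
  proof -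
    obtain z where z: "(\<Sum>u\<in>S. a u *\<^sub>R real_vec u) = real_vec z"
      using a range_real_vec by blast
    have "\<phi> u (\<Sum>w\<in>S. a w *\<^sub>R real_vec w) = (\<Sum>w\<in>S. a w * \<phi> u (real_vec w))"
      by (simp add: linear_sum[OF lin] linear_cmul[OF lin])
    also have "\<dots> = (\<Sum>w\<in>S. a w * (if w = u then 1 else 0))"
      using B(2) int_vec.representation_basis[OF ind] by (intro sum.cong) (auto simp: \<phi>_int)
    also have "\<dots> = a u" using u B(3) by (simp add: if_distrib cong: if_cong)
    finally show ?thesis by (metis z \<phi>_int Ints_of_int)
  qed
  then have "\<forall>a. (\<Sum>u\<in>real_vec ` S. a u *\<^sub>R u) \<in> int_vecs \<longrightarrow> (\<forall>u\<in>real_vec ` S. a u \<in> \<int>)"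
    unfolding sum_real_vec_image by fast
  then show ?thesis
    unfolding unimodular_def using B(3) image_mono[OF subset_UNIV, of real_vec S]
    by (simp add: range_real_vec)
qed

lemma unimodular_int_basis:
  assumes B: "unimodular (real_vec ` B)" "span (real_vec ` B) = UNIV"
  shows "int_basis (B :: (int^'m) set)"
proof -
  have fin: "finite B"
    using unimodular_finite[OF B(1)] by (rule finite_imageD) (auto intro: inj_onI)
  have ind: "independent (real_vec ` B)" using B(1) by (rule unimodular_independent)
  have "int_vec.independent B"
  proof -
    have "f x = 0" if f: "(\<Sum>x\<in>B. f x *s x) = 0" and x: "x \<in> B" for f x
    proof -
    define a where "a u = real_of_int (f (the_inv real_vec u))" for u
    have a: "a (real_vec u) = of_int (f u)" for u
      by (simp add: a_def the_inv_f_f inj_def)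
    have "(\<Sum>u\<in>real_vec ` B. a u *\<^sub>R u) = real_vec (\<Sum>x\<in>B. f x *s x)"
      by (simp add: sum_real_vec_image a real_vec_sum real_vec_scale)
    also have "\<dots> = 0" by (simp add: f vec_eq_iff)
    finally have "a (real_vec x) = 0"
      using independent_sum_eq_zeroD[OF ind] fin x by blast
    then show ?thesis by (simp add: a)
    qed
    then show ?thesis using int_vec.dependent_finite[OF fin] by blast
  qed
  moreover have "z \<in> int_vec.span B" for z
  proof -
    have "real_vec z \<in> span (real_vec ` B)" using B(2) by simp
    then obtain a where a: "real_vec z = (\<Sum>u\<in>real_vec ` B. a u *\<^sub>R u)"
      using fin by (auto simp: span_finite)
    then have "(\<Sum>u\<in>real_vec ` B. a u *\<^sub>R u) \<in> int_vecs" using range_real_vec by (metis rangeI)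
    then have aI: "a (real_vec u) \<in> \<int>" if "u \<in> B" for u
      using that unimodularD[OF B(1)] by blast
    have "real_vec z = (\<Sum>u\<in>B. a (real_vec u) *\<^sub>R real_vec u)"
      unfolding a by (rule sum_real_vec_image)
    also have "\<dots> = real_vec (\<Sum>u\<in>B. \<lfloor>a (real_vec u)\<rfloor> *s u)"
      using aI by (simp add: real_vec_sum real_vec_scale)
    finally have "z = (\<Sum>u\<in>B. \<lfloor>a (real_vec u)\<rfloor> *s u)" by simp
    also have "\<dots> \<in> int_vec.span B"
      by (intro int_vec.span_sum int_vec.span_scale int_vec.span_base)
    finally show ?thesis .
  qed
  ultimately show ?thesis by (auto simp: int_basis_def)
qed

text \<open>This turns the extension condition in \<open>regular_simplex\<close> into one on real
  coefficients, which linear algebra over the reals can handle.\<close>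

lemma ex_int_basis_iff:
  fixes S :: "(int^'m) set"
  assumes "finite S"
  shows "(\<exists>B. S \<subseteq> B \<and> int_basis B) \<longleftrightarrow> unimodular (real_vec ` S)"
proof
  assume "unimodular (real_vec ` S)"
  then obtain B where B: "real_vec ` S \<subseteq> B" "unimodular B" "span B = UNIV"
    using unimodular_extend_UNIV by metis
  have "B = real_vec ` (real_vec -` B)"
    using unimodular_int_vecs[OF B(2)] by (simp add: image_vimage_eq range_real_vec Int_absorb2)
  with B unimodular_int_basis[of "real_vec -` B"] show "\<exists>B. S \<subseteq> B \<and> int_basis B"
    by (metis image_subset_iff_subset_vimage)
qed (use assms int_basis_unimodular in blast)

section \<open>Simplicial fans\<close>

definition combo :: "('a::real_vector \<Rightarrow> real) \<Rightarrow> 'a" where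
  "combo a = (\<Sum>u | a u \<noteq> 0. a u *\<^sub>R u)"

text \<open>A weight is tied to its exact support, so for a fan a point of the union of the cones,
  which is the image of \<open>weights K\<close> under \<open>combo\<close>, is attributed to the
  cone that contains it in its relative interior.\<close>

definition weights :: "'a set set \<Rightarrow> ('a \<Rightarrow> real) set" where
  "weights K = {a. (\<forall>u. 0 \<le> a u) \<and> {u. a u \<noteq> 0} \<in> K}"

text \<open>Injectivity of \<^const>\<open>combo\<close> packs together the linear independence of the members of \<open>K\<close>
  and the fact that the cones they generate meet only in common faces.\<close>

definition fan :: "'a::real_vector set set \<Rightarrow> bool" where
  "fan K \<longleftrightarrow> finite K \<and> (\<forall>\<sigma>\<in>K. finite \<sigma>) \<and> (\<forall>\<sigma>\<in>K. \<forall>\<tau>\<subseteq>\<sigma>. \<tau> \<in> K) \<and> inj_on combo (weights K)"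

lemma combo_eq_sum:
  assumes "finite S" "\<And>u. u \<notin> S \<Longrightarrow> a u = 0"
  shows "combo a = (\<Sum>u\<in>S. a u *\<^sub>R u)"
  unfolding combo_def using assms by (intro sum.mono_neutral_left) auto

lemma fan_finite: "fan K \<Longrightarrow> finite K"
  and fan_member_finite: "fan K \<Longrightarrow> \<sigma> \<in> K \<Longrightarrow> finite \<sigma>"
  and fan_subset: "fan K \<Longrightarrow> \<sigma> \<in> K \<Longrightarrow> \<tau> \<subseteq> \<sigma> \<Longrightarrow> \<tau> \<in> K"
  and fan_inj: "fan K \<Longrightarrow> inj_on combo (weights K)"
  by (auto simp: fan_def)

text \<open>The positive and negative parts of a linear relation are two weights with the same
  \<open>combo\<close>. Injectivity makes them equal, and \<open>max r 0 = max (- r) 0\<close> only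
  for \<open>r = 0\<close>.\<close>

lemma fan_independent:
  fixes \<sigma> :: "'a::real_vector set"
  assumes K: "fan K" and \<sigma>: "\<sigma> \<in> K"
  shows "independent \<sigma>"
proof
  have fin: "finite \<sigma>" using K \<sigma> by (rule fan_member_finite)
  assume "dependent \<sigma>"
  then obtain c u where c: "u \<in> \<sigma>" "c u \<noteq> 0" "(\<Sum>u\<in>\<sigma>. c u *\<^sub>R u) = 0"
    using fin by (auto simp: dependent_finite)
  define p where "p u = (if u \<in> \<sigma> then max (c u) 0 else 0)" for u
  define n where "n u = (if u \<in> \<sigma> then max (- c u) 0 else 0)" for u
  have "{u. p u \<noteq> 0} \<subseteq> \<sigma>" "{u. n u \<noteq> 0} \<subseteq> \<sigma>" by (auto simp: p_def n_def split: if_splits)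
  then have "p \<in> weights K" "n \<in> weights K"
    using fan_subset[OF K \<sigma>] by (auto simp: weights_def p_def n_def)
  moreover have "combo p = combo n"
  proof -
    have "(\<Sum>u\<in>\<sigma>. p u *\<^sub>R u) - (\<Sum>u\<in>\<sigma>. n u *\<^sub>R u) = (\<Sum>u\<in>\<sigma>. c u *\<^sub>R u)"
      by (auto simp: p_def n_def sum_subtractf[symmetric] scaleR_diff_left[symmetric] intro!: sum.cong)
    moreover have "combo p = (\<Sum>u\<in>\<sigma>. p u *\<^sub>R u)" "combo n = (\<Sum>u\<in>\<sigma>. n u *\<^sub>R u)"
      by (rule combo_eq_sum[OF fin], simp add: p_def n_def)+
    ultimately show ?thesis using c(3) by simp
  qed
  ultimately have "p = n" using fan_inj[OF K] by (auto dest: inj_onD)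
  then have "p u = n u" by simp
  with c show False by (auto simp: p_def n_def max_def split: if_splits)
qed

section \<open>Fans covering finitely generated cones\<close>

lemma combo_in_convex_cone_hull:
  assumes "\<And>u. 0 \<le> a u" "{u. a u \<noteq> 0} \<subseteq> V" "finite V"
  shows "combo a \<in> convex_cone hull V"
proof -
  have "(\<Sum>u\<in>S. a u *\<^sub>R u) \<in> convex_cone hull V" if "S \<subseteq> V" "finite S" for S
    using that(2,1)
  proof (induction S rule: finite_induct)
    case (insert x S)
    then show ?case
      using assms(1)
      by (simp add: convex_cone_hull_add convex_cone_hull_mul hull_inc)
  qed (simp add: convex_cone_hull_contains_0)
  then show ?thesis
    unfolding combo_def using assms(2,3) finite_subset by blast
qed

lemma convex_cone_hull_insert_cases:
  assumes "z \<in> convex_cone hull (insert v V)"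
  obtains y t where "y \<in> convex_cone hull V" "0 \<le> t" "z = y + t *\<^sub>R v"
proof -
  define D where "D = {y + t *\<^sub>R v | y t. y \<in> convex_cone hull V \<and> 0 \<le> t}"
  have "convex_cone D"
    unfolding convex_cone_iff
  proof (intro conjI ballI allI impI)
    show "0 \<in> D" using convex_cone_hull_contains_0[of V] unfolding D_def by force
  next
    fix x y assume "x \<in> D" "y \<in> D"
    then obtain p s q t where "p \<in> convex_cone hull V" "0 \<le> s" "x = p + s *\<^sub>R v"
      "q \<in> convex_cone hull V" "0 \<le> t" "y = q + t *\<^sub>R v" unfolding D_def by blast
    then have "p + q \<in> convex_cone hull V \<and> 0 \<le> s + t \<and> x + y = (p + q) + (s + t) *\<^sub>R v"
      by (auto simp: convex_cone_hull_add algebra_simps)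
    then show "x + y \<in> D" unfolding D_def by blast
  next
    fix x c assume "x \<in> D" "0 \<le> (c::real)"
    then obtain p s where "p \<in> convex_cone hull V" "0 \<le> s" "x = p + s *\<^sub>R v" unfolding D_def by blast
    with \<open>0 \<le> c\<close> have "c *\<^sub>R p \<in> convex_cone hull V \<and> 0 \<le> c * s \<and> c *\<^sub>R x = c *\<^sub>R p + (c * s) *\<^sub>R v"
      by (auto simp: convex_cone_hull_mul algebra_simps)
    then show "c *\<^sub>R x \<in> D" unfolding D_def by blast
  qed
  moreover have "insert v V \<subseteq> D"
  proof
    fix x assume "x \<in> insert v V"
    then show "x \<in> D"
    proof
      assume "x = v"
      then have "0 \<in> convex_cone hull V \<and> 0 \<le> (1::real) \<and> x = 0 + 1 *\<^sub>R v"
        by (simp add: convex_cone_hull_contains_0)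
      then show ?thesis unfolding D_def by blast
    next
      assume "x \<in> V"
      then have "x \<in> convex_cone hull V \<and> 0 \<le> (0::real) \<and> x = x + 0 *\<^sub>R v"
        by (simp add: hull_inc)
      then show ?thesis unfolding D_def by blast
    qed
  qed
  ultimately have "convex_cone hull (insert v V) \<subseteq> D" by (rule hull_minimal[rotated])
  with assms that show ?thesis unfolding D_def by blast
qed

text \<open>For splitting a point \<open>a\<close> in the relative interior of a cone into a
  positive multiple of another point \<open>b\<close> of that cone and a remainder with nonnegative
  coefficients.\<close>

lemma positive_scale_below:
  fixes a b :: "'a \<Rightarrow> real"
  assumes "finite S" "\<And>u. u \<in> S \<Longrightarrow> 0 < a u"
  obtains e where "0 < e" "\<And>u. u \<in> S \<Longrightarrow> e * b u \<le> a u"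
proof -
  have "\<exists>e>0. \<forall>u\<in>S. e * b u \<le> a u"
    using assms
  proof induction
    case (insert x S)
    then obtain e where e: "0 < e" "\<forall>u\<in>S. e * b u \<le> a u" by auto
    define d where "d = min e (a x / (1 + \<bar>b x\<bar>))"
    have ax: "0 < a x" using insert.prems by simp
    have d: "0 < d" "d \<le> e" "d \<le> a x / (1 + \<bar>b x\<bar>)"
      using e(1) ax by (auto simp: d_def)
    have bound: "d * y \<le> r" if "0 < r" "e * y \<le> r" for y r
    proof (cases "y \<le> 0")
      case True
      then show ?thesis using d that(1) mult_nonneg_nonpos[of d y] by linarith
    next
      case False
      then show ?thesis using mult_right_mono[OF d(2), of y] that(2) by linarith
    qed
    have "d * b x \<le> d * (1 + \<bar>b x\<bar>)" using d(1) by (intro mult_left_mono) auto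
    also have "\<dots> \<le> a x" using d(3) by (simp add: pos_le_divide_eq)
    finally show ?case using d(1) e(2) bound insert.prems by (intro exI[of _ d]) auto
  qed (auto intro: exI[of _ 1])
  with that show ?thesis by blast
qed

text \<open>The placing construction: \<open>v\<close> is joined to those simplicial cones of a fan for \<open>V\<close> that are
  visible from \<open>v\<close>, so that a point of the new cone is written with the least possible weight
  at \<open>v\<close>.\<close>

lemma fan_convex_cone_hull:
  fixes V :: "'a::euclidean_space set"
  assumes "finite V"
  shows "\<exists>K. fan K \<and> \<Union>K \<subseteq> V \<and> combo ` weights K = convex_cone hull V"
  using assms
proof induction
  case empty
  have "weights {{}} = {\<lambda>_ :: 'a. 0}"
    by (auto simp: weights_def)
  then show ?case
    by (intro exI[of _ "{{}}"]) (auto simp: fan_def combo_def)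
next
  case (insert v V)
  define C where "C = convex_cone hull V"
  from insert obtain K where K: "fan K" "\<Union>K \<subseteq> V" and KC: "combo ` weights K = C"
    unfolding C_def by blast
  have Cadd: "x \<in> C \<Longrightarrow> y \<in> C \<Longrightarrow> x + y \<in> C" and Cmul: "x \<in> C \<Longrightarrow> 0 \<le> c \<Longrightarrow> c *\<^sub>R x \<in> C" for x y c
    by (auto simp: C_def convex_cone_hull_add convex_cone_hull_mul)
  have vK: "v \<notin> \<sigma>" if "\<sigma> \<in> K" for \<sigma> using insert.hyps(2) K(2) that by blast
  \<comment> \<open>From \<open>x\<close>, every positive step in direction \<open>v\<close> leaves
    \<open>C\<close>. A cone counts as visible if this holds at one point of full support;
    \<open>vis_face\<close> extends it to all its points.\<close>
  define vis where "vis x \<longleftrightarrow> (\<forall>s>0. x + s *\<^sub>R v \<notin> C)" for x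
  define visible where
    "visible \<sigma> \<longleftrightarrow> (\<exists>a. (\<forall>u. 0 \<le> a u) \<and> {u. a u \<noteq> 0} = \<sigma> \<and> vis (combo a))" for \<sigma>
  define K' where "K' = K \<union> insert v ` {\<sigma> \<in> K. visible \<sigma>}"
  \<comment> \<open>A point \<open>a\<close> of full support is \<open>d + e b\<close> with
    \<open>d\<close> in the cone. If \<open>b\<close> could be moved along \<open>v\<close> inside
    \<open>C\<close>, then so could \<open>a\<close>, since \<open>C\<close> is closed under
    addition and scaling.\<close>
  have vis_face: "vis (combo b)"
    if \<sigma>: "visible \<sigma>" "\<sigma> \<in> K" and b: "\<And>u. 0 \<le> b u" "{u. b u \<noteq> 0} \<subseteq> \<sigma>" for \<sigma> b
    unfolding vis_def
  proof (intro allI impI notI)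
    fix s :: real assume s: "0 < s" "combo b + s *\<^sub>R v \<in> C"
    have fin: "finite \<sigma>" using K(1) \<sigma>(2) by (rule fan_member_finite)
    obtain a where a: "\<And>u. 0 \<le> a u" "{u. a u \<noteq> 0} = \<sigma>" "vis (combo a)"
      using \<sigma>(1) by (auto simp: visible_def)
    have "0 < a u" if "u \<in> \<sigma>" for u using a(1)[of u] a(2) that by force
    then obtain e where e: "0 < e" "\<And>u. u \<in> \<sigma> \<Longrightarrow> e * b u \<le> a u"
      using positive_scale_below[OF fin, of a b] by blast
    define d where "d u = a u - e * b u" for u
    have z: "a u = 0" "b u = 0" if "u \<notin> \<sigma>" for u using that a(2) b(2) by auto
    have d: "0 \<le> d u" "u \<notin> \<sigma> \<Longrightarrow> d u = 0" for u
      using e(2)[of u] z[of u] by (cases "u \<in> \<sigma>"; simp add: d_def)+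
    have "{u. d u \<noteq> 0} \<subseteq> \<sigma>" using d(2) by blast
    then have "d \<in> weights K" using fan_subset[OF K(1) \<sigma>(2)] d(1) by (auto simp: weights_def)
    then have "combo d \<in> C" using KC by blast
    moreover have "e *\<^sub>R (combo b + s *\<^sub>R v) \<in> C" using s(2) e(1) Cmul by simp
    ultimately have "combo d + e *\<^sub>R (combo b + s *\<^sub>R v) \<in> C" by (rule Cadd)
    moreover have "combo a = combo d + e *\<^sub>R combo b"
      using z d(2) by (simp add: combo_eq_sum[OF fin] d_def scaleR_right.sum sum.distrib[symmetric] algebra_simps)
    ultimately have "combo a + (e * s) *\<^sub>R v \<in> C" by (simp add: algebra_simps)
    with a(3) e(1) s(1) show False by (simp add: vis_def)
  qed
  \<comment> \<open>A weight of \<open>K'\<close> is an old weight plus a coefficient at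
    \<open>v\<close>, which can be positive only over a visible point; \<open>join\<close> is the
    converse.\<close>
  have split: "a(v := 0) \<in> weights K \<and> (0 < a v \<longrightarrow> vis (combo (a(v := 0)))) \<and>
      combo a = combo (a(v := 0)) + a v *\<^sub>R v \<and> 0 \<le> a v" if a: "a \<in> weights K'" for a
  proof -
    have a0: "0 \<le> a u" for u using a by (auto simp: weights_def)
    have supp: "{u. (a(v := 0)) u \<noteq> 0} = {u. a u \<noteq> 0} - {v}" by auto
    have "{u. a u \<noteq> 0} \<in> K'" using a by (auto simp: weights_def)
    then consider "{u. a u \<noteq> 0} \<in> K"
      | \<sigma> where "\<sigma> \<in> K" "visible \<sigma>" "{u. a u \<noteq> 0} = insert v \<sigma>" by (auto simp: K'_def)
    then have 1: "{u. (a(v := 0)) u \<noteq> 0} \<in> K \<and> (0 < a v \<longrightarrow> vis (combo (a(v := 0)))) \<and> finite {u. a u \<noteq> 0}"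
    proof cases
      case 1
      then have "a v = 0" using vK by blast
      with 1 fan_member_finite[OF K(1)] show ?thesis by (simp add: fun_upd_idem)
    next
      case 2
      then have "{u. (a(v := 0)) u \<noteq> 0} = \<sigma>" using vK supp by auto
      with 2 vis_face[of \<sigma> "a(v := 0)"] a0 fan_member_finite[OF K(1)] show ?thesis by simp
    qed
    then have fin: "finite (insert v {u. a u \<noteq> 0})" by simp
    have "combo a = (\<Sum>u\<in>insert v {u. a u \<noteq> 0}. a u *\<^sub>R u)"
      by (rule combo_eq_sum[OF fin]) auto
    also have "\<dots> = a v *\<^sub>R v + (\<Sum>u\<in>{u. a u \<noteq> 0} - {v}. a u *\<^sub>R u)"
      using 1 by (simp add: sum.insert_remove)
    also have "(\<Sum>u\<in>{u. a u \<noteq> 0} - {v}. a u *\<^sub>R u) = combo (a(v := 0))"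
      unfolding combo_def supp by (intro sum.cong) auto
    finally show ?thesis using 1 a0 by (auto simp: weights_def add.commute)
  qed
  have join: "b(v := t) \<in> weights K' \<and> combo (b(v := t)) = combo b + t *\<^sub>R v"
    if b: "b \<in> weights K" and t: "0 \<le> t" "0 < t \<Longrightarrow> vis (combo b)" for b t
  proof -
    have bv: "b v = 0" using b vK by (auto simp: weights_def)
    have mem: "b(v := t) \<in> weights K'"
    proof (cases "t = 0")
      case True
      with b bv show ?thesis by (simp add: weights_def K'_def fun_upd_idem)
    next
      case False
      with t b have "visible {u. b u \<noteq> 0}" by (auto simp: visible_def weights_def)
      moreover have "{u. (b(v := t)) u \<noteq> 0} = insert v {u. b u \<noteq> 0}" using False by auto
      ultimately show ?thesis using b t(1) by (auto simp: weights_def K'_def)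
    qed
    with split[OF mem] bv show ?thesis by (simp add: fun_upd_idem)
  qed
  have "fan K'"
    unfolding fan_def
  proof (intro conjI ballI allI impI)
    show "finite K'" using fan_finite[OF K(1)] by (simp add: K'_def)
    show "finite \<sigma>" if "\<sigma> \<in> K'" for \<sigma>
      using that fan_member_finite[OF K(1)] by (auto simp: K'_def)
    show "\<tau> \<in> K'" if \<sigma>: "\<sigma> \<in> K'" and \<tau>: "\<tau> \<subseteq> \<sigma>" for \<sigma> \<tau>
    proof (cases "\<sigma> \<in> K \<or> v \<notin> \<tau>")
      case True
      with \<sigma> \<tau> have "\<exists>\<sigma>\<in>K. \<tau> \<subseteq> \<sigma>" by (auto simp: K'_def)
      then show ?thesis using fan_subset[OF K(1)] by (auto simp: K'_def)
    next
      case False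
      with \<sigma> obtain \<sigma>' where \<sigma>': "\<sigma>' \<in> K" "visible \<sigma>'" "\<sigma> = insert v \<sigma>'" by (auto simp: K'_def)
      have sub: "\<tau> - {v} \<subseteq> \<sigma>'" using \<tau> \<sigma>'(3) by auto
      have "vis (combo (indicator (\<tau> - {v})))"
        using sub by (intro vis_face[OF \<sigma>'(2,1)]) (auto simp: indicator_def)
      then have "visible (\<tau> - {v})"
        unfolding visible_def by (intro exI[of _ "indicator (\<tau> - {v})"]) (auto simp: indicator_def)
      moreover have "\<tau> - {v} \<in> K" using fan_subset[OF K(1) \<sigma>'(1) sub] .
      moreover have "\<tau> = insert v (\<tau> - {v})" using False by auto
      ultimately show ?thesis unfolding K'_def by blast
    qed
    show "inj_on combo (weights K')"
    proof (rule inj_onI)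
      fix a b assume ab: "a \<in> weights K'" "b \<in> weights K'" "combo a = combo b"
      \<comment> \<open>The difference of the two coefficients at \<open>v\<close> is a step along
        \<open>v\<close> from the base point of \<open>a\<close> to that of \<open>b\<close>, which
        lies in \<open>C\<close>; this contradicts \<open>vis\<close>.\<close>
      have noless: False
        if "a \<in> weights K'" "b \<in> weights K'" "combo a = combo b" "b v < a v" for a b
      proof -
        have "vis (combo (a(v := 0)))" using split[OF that(1)] split[OF that(2)] that(4) by auto
        moreover have "combo (a(v := 0)) + (a v - b v) *\<^sub>R v = combo (b(v := 0))"
          using split[OF that(1)] split[OF that(2)] that(3) by (simp add: algebra_simps)
        moreover have "combo (b(v := 0)) \<in> C" using split[OF that(2)] KC by blast
        ultimately show False using that(4) unfolding vis_def by (metis diff_gt_0_iff_gt)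
      qed
      then have eq: "a v = b v" using ab by (metis linorder_neqE)
      then have "combo (a(v := 0)) = combo (b(v := 0))"
        using split[OF ab(1)] split[OF ab(2)] ab(3) by simp
      then have "a(v := 0) = b(v := 0)"
        using inj_onD[OF fan_inj[OF K(1)]] split[OF ab(1)] split[OF ab(2)] by blast
      then have "(a(v := 0))(v := a v) = (b(v := 0))(v := b v)" using eq by simp
      then show "a = b" by simp
    qed
  qed
  moreover have "\<Union>K' \<subseteq> insert v V" using K(2) by (auto simp: K'_def)
  moreover have "combo ` weights K' = convex_cone hull (insert v V)"
  proof (intro equalityI subsetI)
    fix z assume "z \<in> combo ` weights K'"
    then obtain a where a: "a \<in> weights K'" "z = combo a" by blast
    have "{u. a u \<noteq> 0} \<subseteq> insert v V"
      using a(1) \<open>\<Union>K' \<subseteq> insert v V\<close> by (auto simp: weights_def)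
    then show "z \<in> convex_cone hull (insert v V)"
      using combo_in_convex_cone_hull[of a "insert v V"] a insert.hyps(1) by (auto simp: weights_def)
  next
    fix z assume "z \<in> convex_cone hull (insert v V)"
    then obtain y t where y: "y \<in> C" and t: "0 \<le> t" and z: "z = y + t *\<^sub>R v"
      unfolding C_def by (rule convex_cone_hull_insert_cases)
    \<comment> \<open>The candidate coefficients at \<open>v\<close> for the point \<open>z\<close>.
      \<open>C\<close> is closed, so the least one is attained; if it is positive, its base point is
      visible, since otherwise a smaller coefficient would exist.\<close>
    define T where "T = {t. 0 \<le> t \<and> z - t *\<^sub>R v \<in> C}"
    have "closed C" unfolding C_def using insert.hyps(1) by (rule closed_convex_cone_hull)
    then have "closed ((\<lambda>t. z - t *\<^sub>R v) -` C)"
      by (intro continuous_closed_vimage) (auto intro!: continuous_intros)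
    then have "closed ({0..} \<inter> (\<lambda>t. z - t *\<^sub>R v) -` C)" by (intro closed_Int closed_atLeast)
    also have "{0..} \<inter> (\<lambda>t. z - t *\<^sub>R v) -` C = T" by (auto simp: T_def)
    finally have clT: "closed T" .
    have neT: "T \<noteq> {}" using y t z by (auto simp: T_def)
    have bdd: "bdd_below T" by (auto simp: T_def intro!: bdd_belowI[of _ 0])
    define t0 where "t0 = Inf T"
    have t0: "t0 \<in> T" unfolding t0_def using clT neT bdd by (intro closed_contains_Inf)
    have least: "t0 \<le> t" if "t \<in> T" for t
      unfolding t0_def using that bdd by (rule cInf_lower)
    obtain b where b: "b \<in> weights K" "combo b = z - t0 *\<^sub>R v"
      using t0 KC by (auto simp: T_def image_iff)
    have "vis (combo b)" if "0 < t0"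
      unfolding vis_def
    proof (intro allI impI notI)
      fix s :: real assume s: "0 < s" "combo b + s *\<^sub>R v \<in> C"
      \<comment> \<open>Truncating at \<open>t0\<close> keeps \<open>t0 - r\<close> nonnegative; the
        shorter step stays in \<open>C\<close> by convexity.\<close>
      define r where "r = min s t0"
      have r: "0 < r" "r \<le> s" "r \<le> t0" using s that by (auto simp: r_def)
      have "(1 - r / s) *\<^sub>R combo b + (r / s) *\<^sub>R (combo b + s *\<^sub>R v) \<in> C"
        using s(1) r t0 b(2) by (intro Cadd[OF Cmul Cmul[OF s(2)]]) (auto simp: T_def)
      also have "(1 - r / s) *\<^sub>R combo b + (r / s) *\<^sub>R (combo b + s *\<^sub>R v) = z - (t0 - r) *\<^sub>R v"
        using s b(2) by (simp add: algebra_simps)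
      finally have "t0 - r \<in> T" using r by (simp add: T_def)
      with least[of "t0 - r"] r(1) show False by simp
    qed
    with join[OF b(1), of t0] t0 b(2) show "z \<in> combo ` weights K'"
      by (auto simp: T_def intro!: image_eqI[of _ _ "b(v := t0)"])
  qed
  ultimately show ?case by blast
qed

section \<open>Star subdivision and unimodular refinement\<close>

lemma frac_shift_cancel:
  fixes x y c :: real
  assumes "frac (x + c) = frac (y + c)" "0 \<le> x" "x < 1" "0 \<le> y" "y < 1"
  shows "x = y"
proof -
  have "x - y = of_int (\<lfloor>x + c\<rfloor> - \<lfloor>y + c\<rfloor>)" using assms(1) by (simp add: frac_def)
  moreover have "-1 < x - y" "x - y < 1" using assms by linarith+
  ultimately show ?thesis by (smt (verit) of_int_0 of_int_le_iff of_int_1 of_int_minus)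
qed

text \<open>Star subdivision at a point \<open>w\<close> in the relative interior of
  \<open>\<rho>\<close>. Spreading the weight at \<open>w\<close> over \<open>\<rho>\<close> in
  proportion to \<open>q\<close> is a bijection from the new weights to the old ones that preserves
  \<open>combo\<close>; injectivity and the covered set are carried over by it.\<close>

lemma star_fan:
  fixes K :: "'a::real_vector set set"
  assumes K: "fan K" and \<rho>: "\<rho> \<in> K" "\<rho> \<noteq> {}"
    and q: "\<And>u. u \<in> \<rho> \<Longrightarrow> 0 < q u" "\<And>u. u \<notin> \<rho> \<Longrightarrow> q u = 0"
    and w: "w = combo q" "w \<notin> \<Union>K"
  defines "K' \<equiv> {\<sigma> \<in> K. \<not> \<rho> \<subseteq> \<sigma>} \<union> insert w ` {\<sigma> \<in> K. \<not> \<rho> \<subseteq> \<sigma> \<and> \<sigma> \<union> \<rho> \<in> K}"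
  shows "fan K'" "combo ` weights K' = combo ` weights K"
proof -
  have wK: "w \<notin> \<sigma>" if "\<sigma> \<in> K" for \<sigma> using w(2) that by blast
  have fin: "finite \<sigma>" if "\<sigma> \<in> K" for \<sigma> using K that by (rule fan_member_finite)
  have qw: "q w = 0" using q(2) wK[OF \<rho>(1)] by blast
  define \<Phi> where "\<Phi> a u = (if u = w then 0 else a u) + a w * q u" for a u
  have supp: "(a w = 0 \<and> {u. a u \<noteq> 0} \<in> K \<and> \<not> \<rho> \<subseteq> {u. a u \<noteq> 0}) \<or>
      (\<exists>\<sigma>\<in>K. \<not> \<rho> \<subseteq> \<sigma> \<and> \<sigma> \<union> \<rho> \<in> K \<and> {u. a u \<noteq> 0} = insert w \<sigma>)" if a: "a \<in> weights K'" for a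
    using a wK by (auto simp: weights_def K'_def)
  have \<Phi>: "\<Phi> a \<in> weights K \<and> combo (\<Phi> a) = combo a \<and> (\<exists>u\<in>\<rho>. a u = 0)"
    if a: "a \<in> weights K'" for a
  proof -
    have a0: "0 \<le> a u" for u using a by (auto simp: weights_def)
    have q0: "0 \<le> q u" for u using q[of u] by (cases "u \<in> \<rho>") auto
    from supp[OF a] show ?thesis
    proof
      assume *: "a w = 0 \<and> {u. a u \<noteq> 0} \<in> K \<and> \<not> \<rho> \<subseteq> {u. a u \<noteq> 0}"
      then have "\<Phi> a = a" by (auto simp: \<Phi>_def)
      with * a0 show ?thesis by (auto simp: weights_def)
    next
      assume "\<exists>\<sigma>\<in>K. \<not> \<rho> \<subseteq> \<sigma> \<and> \<sigma> \<union> \<rho> \<in> K \<and> {u. a u \<noteq> 0} = insert w \<sigma>"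
      then obtain \<sigma> where \<sigma>: "\<sigma> \<in> K" "\<not> \<rho> \<subseteq> \<sigma>" "\<sigma> \<union> \<rho> \<in> K" and s: "{u. a u \<noteq> 0} = insert w \<sigma>"
        by blast
      have ne: "a u \<noteq> 0 \<longleftrightarrow> u = w \<or> u \<in> \<sigma>" for u using s by auto
      have aw: "0 < a w" using a0[of w] ne[of w] by simp
      have "\<Phi> a u \<noteq> 0 \<longleftrightarrow> u \<in> \<sigma> \<union> \<rho>" for u
      proof (cases "u = w")
        case True
        then show ?thesis using wK[OF \<sigma>(3)] qw by (simp add: \<Phi>_def)
      next
        case False
        then have "\<Phi> a u = a u + a w * q u" by (simp add: \<Phi>_def)
        then have "\<Phi> a u \<noteq> 0 \<longleftrightarrow> a u \<noteq> 0 \<or> q u \<noteq> 0"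
          using a0[of u] q0[of u] aw by (simp add: add_nonneg_eq_0_iff)
        then show ?thesis using False ne[of u] q[of u] by force
      qed
      then have s': "{u. \<Phi> a u \<noteq> 0} = \<sigma> \<union> \<rho>" by blast
      have "\<Phi> a \<in> weights K"
        using \<sigma>(3) s' a0 q0 by (simp add: weights_def \<Phi>_def)
      moreover have "combo (\<Phi> a) = combo a"
      proof -
        have f: "finite (insert w (\<sigma> \<union> \<rho>))" using fin[OF \<sigma>(3)] by simp
        have "combo (\<Phi> a) = (\<Sum>u\<in>insert w (\<sigma> \<union> \<rho>). \<Phi> a u *\<^sub>R u)"
          using s' by (intro combo_eq_sum[OF f]) blast
        also have "\<dots> = (\<Sum>u\<in>insert w (\<sigma> \<union> \<rho>). (if u = w then 0 else a u) *\<^sub>R u) +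
            a w *\<^sub>R (\<Sum>u\<in>insert w (\<sigma> \<union> \<rho>). q u *\<^sub>R u)"
          by (simp only: \<Phi>_def scaleR_add_left sum.distrib scaleR_right.sum scaleR_scaleR)
        also have "(\<Sum>u\<in>insert w (\<sigma> \<union> \<rho>). q u *\<^sub>R u) = w"
          unfolding w(1) using q(2) by (intro combo_eq_sum[OF f[unfolded w(1)], symmetric]) auto
        also have "(\<Sum>u\<in>insert w (\<sigma> \<union> \<rho>). (if u = w then 0 else a u) *\<^sub>R u) = (\<Sum>u\<in>\<sigma> \<union> \<rho>. a u *\<^sub>R u)"
          using fin[OF \<sigma>(3)] wK[OF \<sigma>(3)] by (subst sum.insert) (auto intro!: sum.cong)
        also have "\<dots> + a w *\<^sub>R w = (\<Sum>u\<in>insert w (\<sigma> \<union> \<rho>). a u *\<^sub>R u)"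
          using fin[OF \<sigma>(3)] wK[OF \<sigma>(3)] by (subst sum.insert) auto
        also have "\<dots> = combo a"
          using ne by (intro combo_eq_sum[OF f, symmetric]) auto
        finally show ?thesis .
      qed
      moreover have "\<exists>u\<in>\<rho>. a u = 0"
      proof -
        obtain u where "u \<in> \<rho>" "u \<notin> \<sigma>" using \<sigma>(2) by blast
        with ne[of u] wK[OF \<rho>(1)] show ?thesis by (intro bexI[of _ u]) auto
      qed
      ultimately show ?thesis by blast
    qed
  qed
  have inj: "a = b" if a: "a \<in> weights K'" and b: "b \<in> weights K'" and eq: "\<Phi> a = \<Phi> b" for a b
  proof -
    \<comment> \<open>Compare at a generator \<open>u\<close> of \<open>\<rho>\<close> missing from
      \<open>a\<close>: there the weight at \<open>w\<close> alone accounts for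
      \<open>\<Phi> a u\<close>, so \<open>b\<close> cannot use more of \<open>w\<close>.\<close>
    have le: "b w \<le> a w" if a: "a \<in> weights K'" and b: "b \<in> weights K'" and eq: "\<Phi> a = \<Phi> b" for a b
    proof -
      obtain u where u: "u \<in> \<rho>" "a u = 0" using \<Phi>[OF a] by blast
      have "u \<noteq> w" using wK[OF \<rho>(1)] u by blast
      then have "a w * q u = b u + b w * q u"
        using fun_cong[OF eq, of u] u(2) by (simp add: \<Phi>_def)
      moreover have "0 \<le> b u" using b by (auto simp: weights_def)
      ultimately have "b w * q u \<le> a w * q u" by linarith
      then show ?thesis using q(1)[OF u(1)] by simp
    qed
    have weq: "a w = b w" using le[OF a b eq] le[OF b a eq[symmetric]] by simp
    show ?thesis
    proof
      fix u show "a u = b u"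
        using fun_cong[OF eq, of u] weq by (cases "u = w") (auto simp: \<Phi>_def)
    qed
  qed
  have surj: "\<exists>a\<in>weights K'. \<Phi> a = c" if c: "c \<in> weights K" for c
  proof -
    have c0: "0 \<le> c u" for u using c by (auto simp: weights_def)
    have cK: "{u. c u \<noteq> 0} \<in> K" using c by (auto simp: weights_def)
    have cw: "c w = 0" using wK[OF cK] by blast
    \<comment> \<open>The largest multiple of \<open>q\<close> that can be taken out of
      \<open>c\<close>. The coefficient at the minimising \<open>m\<close> becomes 0, so the
      remaining support no longer contains \<open>\<rho>\<close>.\<close>
    define t where "t = Min ((\<lambda>u. c u / q u) ` \<rho>)"
    have "t \<in> (\<lambda>u. c u / q u) ` \<rho>"
      unfolding t_def using fin[OF \<rho>(1)] \<rho>(2) by (intro Min_in) auto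
    then obtain m where m: "m \<in> \<rho>" "t = c m / q m" by blast
    have t0: "0 \<le> t" using m c0[of m] q(1)[OF m(1)] by simp
    have tle: "t * q u \<le> c u" for u
    proof (cases "u \<in> \<rho>")
      case True
      then have "t \<le> c u / q u" unfolding t_def using fin[OF \<rho>(1)] by (intro Min_le) auto
      then show ?thesis using q(1)[OF True] by (simp add: field_simps)
    next
      case False
      then show ?thesis using q(2) c0 by simp
    qed
    define a where "a u = (if u = w then t else c u - t * q u)" for u
    define \<sigma> where "\<sigma> = {u. c u - t * q u \<noteq> 0}"
    have "\<sigma> \<subseteq> {u. c u \<noteq> 0}"
    proof
      fix u assume u: "u \<in> \<sigma>"
      show "u \<in> {u. c u \<noteq> 0}"
        using u tle[of u] t0 q[of u]
        by (cases "u \<in> \<rho>") (auto simp: \<sigma>_def mult_le_0_iff)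
    qed
    then have \<sigma>K: "\<sigma> \<in> K" using fan_subset[OF K cK] by blast
    have m\<sigma>: "m \<notin> \<sigma>" using m q(1)[OF m(1)] by (simp add: \<sigma>_def)
    have "{u. a u \<noteq> 0} \<in> K'"
    proof (cases "t = 0")
      case True
      then have "{u. a u \<noteq> 0} = \<sigma>" using cw by (auto simp: a_def \<sigma>_def)
      then show ?thesis using \<sigma>K m\<sigma> m(1) by (auto simp: K'_def)
    next
      case False
      then have tpos: "0 < t" using t0 by simp
      have "\<rho> \<subseteq> {u. c u \<noteq> 0}"
      proof
        fix u assume u: "u \<in> \<rho>"
        then have "0 < t * q u" using tpos q(1) by simp
        with tle[of u] show "u \<in> {u. c u \<noteq> 0}" by simp
      qed
      with \<open>\<sigma> \<subseteq> {u. c u \<noteq> 0}\<close> have "\<sigma> \<union> \<rho> \<in> K" using fan_subset[OF K cK] by blast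
      moreover have "{u. a u \<noteq> 0} = insert w \<sigma>"
        using False cw qw by (auto simp: a_def \<sigma>_def)
      moreover have "\<not> \<rho> \<subseteq> \<sigma>" using m\<sigma> m(1) by blast
      ultimately show ?thesis using \<sigma>K by (auto simp: K'_def)
    qed
    moreover have "0 \<le> a u" for u using t0 tle[of u] by (simp add: a_def)
    ultimately have "a \<in> weights K'" by (simp add: weights_def)
    moreover have "\<Phi> a = c" using cw qw by (auto simp: \<Phi>_def a_def)
    ultimately show ?thesis by blast
  qed
  show "fan K'"
    unfolding fan_def
  proof (intro conjI ballI allI impI)
    show "finite K'" using fan_finite[OF K] by (simp add: K'_def)
    show "finite \<sigma>" if "\<sigma> \<in> K'" for \<sigma> using that fin by (auto simp: K'_def)
    show "\<tau> \<in> K'" if \<sigma>: "\<sigma> \<in> K'" and \<tau>: "\<tau> \<subseteq> \<sigma>" for \<sigma> \<tau>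
    proof (cases "w \<in> \<tau>")
      case False
      with \<sigma> \<tau> obtain \<sigma>' where "\<sigma>' \<in> K" "\<not> \<rho> \<subseteq> \<sigma>'" "\<tau> \<subseteq> \<sigma>'" by (auto simp: K'_def)
      then show ?thesis using fan_subset[OF K] by (auto simp: K'_def)
    next
      case True
      then obtain \<sigma>' where \<sigma>': "\<sigma>' \<in> K" "\<not> \<rho> \<subseteq> \<sigma>'" "\<sigma>' \<union> \<rho> \<in> K" "\<sigma> = insert w \<sigma>'"
        using \<sigma> \<tau> wK by (auto simp: K'_def)
      have sub: "\<tau> - {w} \<subseteq> \<sigma>'" using \<tau> \<sigma>'(4) by auto
      have "\<tau> - {w} \<in> K" "(\<tau> - {w}) \<union> \<rho> \<in> K"
        using fan_subset[OF K \<sigma>'(1) sub] fan_subset[OF K \<sigma>'(3), of "(\<tau> - {w}) \<union> \<rho>"] sub by auto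
      moreover have "\<not> \<rho> \<subseteq> \<tau> - {w}" using sub \<sigma>'(2) by blast
      moreover have "\<tau> = insert w (\<tau> - {w})" using True by auto
      ultimately show ?thesis unfolding K'_def by blast
    qed
    show "inj_on combo (weights K')"
    proof (rule inj_onI)
      fix a b assume a: "a \<in> weights K'" and b: "b \<in> weights K'" and "combo a = combo b"
      then have "combo (\<Phi> a) = combo (\<Phi> b)" using \<Phi> by metis
      then have "\<Phi> a = \<Phi> b" using inj_onD[OF fan_inj[OF K]] \<Phi>[OF a] \<Phi>[OF b] by blast
      then show "a = b" by (rule inj[OF a b])
    qed
  qed
  show "combo ` weights K' = combo ` weights K"
  proof (intro equalityI subsetI)
    fix z assume "z \<in> combo ` weights K'"
    then obtain a where "a \<in> weights K'" "z = combo a" by blast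
    with \<Phi>[of a] show "z \<in> combo ` weights K" by (intro image_eqI[of _ _ "\<Phi> a"]) auto
  next
    fix z assume "z \<in> combo ` weights K"
    then obtain c where c: "c \<in> weights K" "z = combo c" by blast
    then obtain a where "a \<in> weights K'" "\<Phi> a = c" using surj by blast
    with \<Phi>[of a] c(2) show "z \<in> combo ` weights K'" by (intro image_eqI[of _ _ a]) auto
  qed
qed

text \<open>For independent \<open>S\<close> in the lattice, the number of these is the index of the
  lattice generated by \<open>S\<close> in the integer points of its span. Coefficients off
  \<open>S\<close> are set to 0 so that each point of the half-open box corresponds to a single
  function.\<close>

definition box_points :: "(real^'m) set \<Rightarrow> (real^'m \<Rightarrow> real) set" where
  "box_points S = {a. (\<forall>u\<in>S. 0 \<le> a u \<and> a u < 1) \<and> (\<forall>u. u \<notin> S \<longrightarrow> a u = 0) \<and>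
    (\<Sum>u\<in>S. a u *\<^sub>R u) \<in> int_vecs}"

lemma finite_box_points:
  assumes "finite S" "independent S"
  shows "finite (box_points S)"
proof -
  let ?f = "\<lambda>a. \<Sum>u\<in>S. a u *\<^sub>R u"
  have "norm x \<le> (\<Sum>u\<in>S. norm u)" if x: "x \<in> ?f ` box_points S" for x
  proof -
    obtain a where a: "a \<in> box_points S" "x = ?f a" using x by blast
    then show ?thesis
      by (auto simp: box_points_def mult_left_le_one_le intro!: order.trans[OF norm_sum] sum_mono)
  qed
  then have "bounded (?f ` box_points S)" unfolding bounded_iff by blast
  moreover have "?f ` box_points S \<subseteq> int_vecs" by (auto simp: box_points_def)
  ultimately have "finite (?f ` box_points S)" by (intro finite_bounded_int_vecs)
  moreover have "inj_on ?f (box_points S)"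
  proof (intro inj_onI ext)
    fix a b u assume "a \<in> box_points S" "b \<in> box_points S" "?f a = ?f b"
    then show "a u = b u"
      using independent_sum_eqD[OF assms(2,1), of a b u] by (cases "u \<in> S") (auto simp: box_points_def)
  qed
  ultimately show ?thesis by (rule finite_imageD)
qed

text \<open>Replacing \<open>v\<close> by a box point \<open>w\<close> rescales the coefficient at \<open>v\<close> by \<open>q v < 1\<close>, so box points
  of the new set inject into those of the old one with first coefficient below \<open>q v\<close>.\<close>

lemma card_box_points_less:
  assumes S: "finite S" "independent S" "S \<subseteq> int_vecs"
    and q: "q \<in> box_points S" "0 < q v" and v: "v \<in> S" "v \<notin> T" and T: "T \<subseteq> S"
    and w: "w = (\<Sum>u\<in>S. q u *\<^sub>R u)" "w \<notin> S"
  shows "card (box_points (insert w T)) < card (box_points S)"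
proof -
  \<comment> \<open>Expand \<open>w\<close> in \<open>S\<close> and reduce modulo 1. At
    \<open>v\<close>, which is not in \<open>T\<close>, the coefficient is already in the unit
    interval (\<open>atv\<close>), so the coefficient at \<open>w\<close> can be recovered.\<close>
  define \<Psi> where "\<Psi> y u = (if u \<in> S then frac ((if u \<in> T then y u else 0) + y w * q u) else 0)" for y u
  have q1: "0 \<le> q u \<and> q u < 1" if "u \<in> S" for u using q(1) that by (auto simp: box_points_def)
  have finT: "finite T" using S(1) T finite_subset by blast
  have wT: "w \<notin> T" using w(2) T by blast
  have yw: "0 \<le> y w" "y w < 1" if "y \<in> box_points (insert w T)" for y
    using that by (auto simp: box_points_def)
  have atv: "\<Psi> y v = y w * q v" if y: "y \<in> box_points (insert w T)" for y
  proof -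
    have "y w * q v < 1" "0 \<le> y w * q v"
      using yw[OF y] q1[OF v(1)] by (auto intro: mult_strict_mono[of "y w" 1 "q v" 1, simplified])
    then show ?thesis using v by (simp add: \<Psi>_def frac_eq)
  qed
  have "\<Psi> y \<in> box_points S" if y: "y \<in> box_points (insert w T)" for y
  proof -
    have "(\<Sum>u\<in>S. ((if u \<in> T then y u else 0) + y w * q u) *\<^sub>R u)
        = (\<Sum>u\<in>S. (if u \<in> T then y u else 0) *\<^sub>R u) + y w *\<^sub>R w"
      by (simp add: w(1) scaleR_add_left sum.distrib scaleR_right.sum)
    also have "(\<Sum>u\<in>S. (if u \<in> T then y u else 0) *\<^sub>R u) = (\<Sum>u\<in>T. y u *\<^sub>R u)"
      using S(1) T by (intro sum.mono_neutral_cong_right) auto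
    also have "\<dots> + y w *\<^sub>R w = (\<Sum>u\<in>insert w T. y u *\<^sub>R u)" using finT wT by simp
    also have "\<dots> \<in> int_vecs" using y by (simp add: box_points_def)
    finally have "(\<Sum>u\<in>S. frac ((if u \<in> T then y u else 0) + y w * q u) *\<^sub>R u) \<in> int_vecs"
      using sum_frac_int_vecs_iff[OF S(3), of _ 0] by simp
    then show ?thesis
      by (auto simp: box_points_def \<Psi>_def frac_lt_1 cong: sum.cong)
  qed
  then have "\<Psi> ` box_points (insert w T) \<subseteq> box_points S" by blast
  \<comment> \<open>The point \<open>q\<close> would need coefficient 1 at \<open>w\<close>; missing
    it makes the inequality strict.\<close>
  moreover have "q \<notin> \<Psi> ` box_points (insert w T)"
  proof
    assume "q \<in> \<Psi> ` box_points (insert w T)"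
    then obtain y where y: "y \<in> box_points (insert w T)" "q = \<Psi> y" by blast
    then have "q v = y w * q v" using atv[OF y(1)] by metis
    with yw[OF y(1)] q(2) show False by simp
  qed
  ultimately have "\<Psi> ` box_points (insert w T) \<subset> box_points S" using q(1) by blast
  then have "card (\<Psi> ` box_points (insert w T)) < card (box_points S)"
    using finite_box_points[OF S(1,2)] by (rule psubset_card_mono[rotated])
  moreover have "inj_on \<Psi> (box_points (insert w T))"
  proof (intro inj_onI ext)
    fix y z u assume y: "y \<in> box_points (insert w T)" and z: "z \<in> box_points (insert w T)"
      and eq: "\<Psi> y = \<Psi> z"
    have weq: "y w = z w" using atv[OF y] atv[OF z] eq q(2) by simp
    consider "u = w" | "u \<in> T" | "u \<notin> insert w T" by blast
    then show "y u = z u"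
    proof cases
      case 2
      then have "frac (y u + y w * q u) = frac (z u + y w * q u)"
        using fun_cong[OF eq, of u] T weq by (auto simp: \<Psi>_def)
      then show ?thesis
        by (rule frac_shift_cancel) (use y z 2 in \<open>auto simp: box_points_def\<close>)
    qed (use weq y z in \<open>auto simp: box_points_def\<close>)
  qed
  ultimately show ?thesis by (simp add: card_image)
qed

lemma sum_positive_coord:
  fixes q :: "real^'m \<Rightarrow> real"
  assumes "finite S" "\<And>u. u \<in> S \<Longrightarrow> 0 < u $ k" "\<And>u. u \<in> S \<Longrightarrow> 0 \<le> q u" "v \<in> S" "0 < q v"
  shows "0 < (\<Sum>u\<in>S. q u *\<^sub>R u) $ k"
proof -
  have "0 < (\<Sum>u\<in>S. q u * u $ k)"
    using assms by (intro sum_pos2[of S v]) (auto simp: less_imp_le)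
  then show ?thesis by simp
qed

text \<open>Termination is measured by the multiset of box counts, since one subdivision may create
  more cones than it removes. Every new cone \<open>insert w \<sigma>\<close> has fewer box points
  than the removed cone \<open>\<sigma> \<union> \<rho>\<close>. Positivity of coordinate
  \<open>k\<close> persists because \<open>w\<close> is a nonnegative, nontrivial combination of old
  generators; it later allows projecting to height 1.\<close>

lemma unimodular_refinement:
  fixes K :: "(real^'m) set set"
  assumes "fan K" "\<Union>K \<subseteq> {u \<in> int_vecs. 0 < u $ k}"
  shows "\<exists>K'. fan K' \<and> \<Union>K' \<subseteq> {u \<in> int_vecs. 0 < u $ k} \<and>
    combo ` weights K' = combo ` weights K \<and> (\<forall>\<sigma>\<in>K'. unimodular \<sigma>)"
  using assms
proof (induction "image_mset (\<lambda>\<sigma>. card (box_points \<sigma>)) (mset_set K)" arbitrary: K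
    rule: wf_induct_rule[OF wf_mult[OF wf_less_than]])
  case (1 K)
  note K = 1(2) and KI = 1(3)
  show ?case
  proof (cases "\<forall>\<sigma>\<in>K. unimodular \<sigma>")
    case True
    with K KI show ?thesis by (intro exI[of _ K]) simp
  next
    case False
    then obtain \<sigma>0 where \<sigma>0: "\<sigma>0 \<in> K" "\<not> unimodular \<sigma>0" by blast
    have fin: "finite \<sigma>" if "\<sigma> \<in> K" for \<sigma> using K that by (rule fan_member_finite)
    have ind: "independent \<sigma>" if "\<sigma> \<in> K" for \<sigma> using K that by (rule fan_independent)
    have int: "\<sigma> \<subseteq> int_vecs" if "\<sigma> \<in> K" for \<sigma> using KI that by auto
    obtain a u0 where a: "(\<Sum>u\<in>\<sigma>0. a u *\<^sub>R u) \<in> int_vecs" and u0: "u0 \<in> \<sigma>0" "a u0 \<notin> \<int>"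
      using \<sigma>0 fin[OF \<sigma>0(1)] int[OF \<sigma>0(1)] unfolding unimodular_def by blast
    \<comment> \<open>A failure of unimodularity leaves a noninteger coefficient; the fractional
      parts give a nonzero integer point \<open>w\<close> in the box of \<open>\<sigma>0\<close>,
      and \<open>\<rho>\<close> is the smallest face containing it.\<close>
    define q where "q u = (if u \<in> \<sigma>0 then frac (a u) else 0)" for u
    define \<rho> where "\<rho> = {u. q u \<noteq> 0}"
    have q01: "0 \<le> q u" "q u < 1" for u by (auto simp: q_def frac_lt_1)
    have \<rho>\<sigma>0: "\<rho> \<subseteq> \<sigma>0" by (auto simp: \<rho>_def q_def split: if_splits)
    have \<rho>K: "\<rho> \<in> K" using fan_subset[OF K \<sigma>0(1) \<rho>\<sigma>0] .
    have u0\<rho>: "u0 \<in> \<rho>" using u0 by (simp add: \<rho>_def q_def)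
    have q\<rho>: "0 < q u" if "u \<in> \<rho>" for u using that q01(1)[of u] by (simp add: \<rho>_def)
    have qn: "q u = 0" if "u \<notin> \<rho>" for u using that by (simp add: \<rho>_def)
    define w where "w = combo q"
    have w_sum: "w = (\<Sum>u\<in>S. q u *\<^sub>R u)" if "finite S" "\<rho> \<subseteq> S" for S
      unfolding w_def using that qn by (intro combo_eq_sum) auto
    have wI: "w \<in> int_vecs"
      using sum_frac_int_vecs_iff[OF int[OF \<sigma>0(1)], of a 0] a
      unfolding w_sum[OF fin[OF \<sigma>0(1)] \<rho>\<sigma>0] by (simp add: q_def)
    have qW: "q \<in> weights K" using q01 \<rho>K by (simp add: weights_def \<rho>_def)
    \<comment> \<open>Were \<open>w\<close> an old generator, the weight concentrated on
      \<open>w\<close> and the weight \<open>q\<close> would represent the same point, but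
      \<open>q\<close> only has values below 1.\<close>
    have wK: "w \<notin> \<Union>K"
    proof
      assume "w \<in> \<Union>K"
      then have "{w} \<in> K" using fan_subset[OF K] by blast
      define d where "d u = (if u = w then 1 else 0 :: real)" for u
      have "d \<in> weights K" using \<open>{w} \<in> K\<close> by (simp add: weights_def d_def)
      moreover have "combo d = combo q"
        using combo_eq_sum[of "{w}" d] by (simp add: d_def w_def)
      ultimately have "q = d" using inj_onD[OF fan_inj[OF K]] qW by metis
      then have "q w = 1" by (simp add: d_def)
      with q01(2)[of w] show False by simp
    qed
    have wk: "0 < w $ k"
      unfolding w_sum[OF fin[OF \<rho>K] order.refl]
      by (rule sum_positive_coord[where v=u0]) (use fin[OF \<rho>K] KI \<rho>K q01 u0\<rho> q\<rho> in auto)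
    define I where "I = {\<sigma> \<in> K. \<not> \<rho> \<subseteq> \<sigma>}"
    define N where "N = insert w ` {\<sigma> \<in> K. \<not> \<rho> \<subseteq> \<sigma> \<and> \<sigma> \<union> \<rho> \<in> K}"
    define R where "R = {\<sigma> \<in> K. \<rho> \<subseteq> \<sigma>}"
    have ne: "\<rho> \<noteq> {}" using u0\<rho> by blast
    note star = star_fan[OF K \<rho>K ne q\<rho> qn w_def wK, folded I_def N_def]
    have finK: "finite K" using K by (rule fan_finite)
    have finIN: "finite I" "finite N" "finite R" using finK by (auto simp: I_def N_def R_def)
    have disj: "I \<inter> N = {}" "I \<inter> R = {}" using wK by (auto simp: I_def N_def R_def)
    have KIR: "K = I \<union> R" by (auto simp: I_def R_def)
    let ?c = "\<lambda>\<sigma>. card (box_points \<sigma>)"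
    have less: "\<exists>\<sigma>'\<in>R. ?c \<tau> < ?c \<sigma>'" if \<tau>: "\<tau> \<in> N" for \<tau>
    proof -
      obtain \<sigma> where \<sigma>: "\<sigma> \<in> K" "\<not> \<rho> \<subseteq> \<sigma>" "\<sigma> \<union> \<rho> \<in> K" "\<tau> = insert w \<sigma>"
        using \<tau> by (auto simp: N_def)
      then obtain v where v: "v \<in> \<rho>" "v \<notin> \<sigma>" by blast
      have f: "finite (\<sigma> \<union> \<rho>)" using fin \<sigma>(3) by blast
      have "q \<in> box_points (\<sigma> \<union> \<rho>)"
        using q01 qn wI w_sum[OF f] by (auto simp: box_points_def)
      then have "?c (insert w \<sigma>) < ?c (\<sigma> \<union> \<rho>)"
        by (rule card_box_points_less[OF f ind[OF \<sigma>(3)] int[OF \<sigma>(3)]])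
          (use v q\<rho> w_sum[OF f] wK \<sigma>(3) in auto)
      moreover have "\<sigma> \<union> \<rho> \<in> R" using \<sigma>(3) by (simp add: R_def)
      ultimately show ?thesis using \<sigma>(4) by blast
    qed
    have "(image_mset ?c (mset_set I) + image_mset ?c (mset_set N),
        image_mset ?c (mset_set I) + image_mset ?c (mset_set R)) \<in> mult less_than"
    proof (rule one_step_implies_mult)
      have "\<rho> \<in> R" using \<rho>K by (simp add: R_def)
      then show "image_mset ?c (mset_set R) \<noteq> {#}" using finIN(3) by (auto simp: mset_set_empty_iff)
      show "\<forall>k\<in>#image_mset ?c (mset_set N). \<exists>j\<in>#image_mset ?c (mset_set R). (k, j) \<in> less_than"
        using less finIN by auto
    qed
    then have dec: "(image_mset ?c (mset_set (I \<union> N)), image_mset ?c (mset_set K)) \<in> mult less_than"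
      unfolding KIR using finIN disj by (simp add: mset_set_Union)
    have "\<Union>(I \<union> N) \<subseteq> {u \<in> int_vecs. 0 < u $ k}"
      using KI wI wk unfolding I_def N_def by auto
    from 1(1)[OF dec star(1) this] star(2) show ?thesis by simp
  qed
qed

section \<open>Regular triangulations of rational polytopes\<close>

definition hp :: "real^'n \<Rightarrow> real^('n option)" where
  "hp x = (\<chi> j. case j of None \<Rightarrow> 1 | Some i \<Rightarrow> x $ i)"

definition dehom :: "real^('n option) \<Rightarrow> real^'n" where
  "dehom u = (\<chi> i. u $ Some i / u $ None)"

text \<open>The homogeneous correspondent as a real vector (\<open>real_vec_homogeneous\<close>),
  whereas \<open>hp\<close> puts the point at height 1 and \<open>dehom\<close> projects back from
  the origin.\<close>

definition rhom :: "real^'n \<Rightarrow> real^('n option)" where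
  "rhom x = real (den x) *\<^sub>R hp x"

lemma hp_nth [simp]: "hp x $ None = 1" "hp x $ Some i = x $ i"
  by (simp_all add: hp_def)

lemma dehom_nth [simp]: "dehom u $ i = u $ Some i / u $ None"
  by (simp add: dehom_def)

lemma rhom_nth [simp]: "rhom x $ None = real (den x)" "rhom x $ Some i = real (den x) * x $ i"
  by (simp_all add: rhom_def)

lemma vec_option_eq_iff: "x = y \<longleftrightarrow> x $ None = y $ None \<and> (\<forall>i. x $ Some i = y $ Some i)"
  for x y :: "'a^('n::finite option)"
  by (auto simp: vec_eq_iff split: option.split) (metis option.exhaust)

lemma hp_dehom: "u $ None \<noteq> 0 \<Longrightarrow> hp (dehom u) = (1 / u $ None) *\<^sub>R u"
  by (simp add: vec_option_eq_iff)

lemma rational_common_denominator: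
  assumes "x \<in> rational_points"
  shows "\<exists>d>0. real d *\<^sub>R x \<in> int_vecs"
proof -
  have "\<exists>d>0. real d * x $ i \<in> \<int>" for i
  proof -
    have "x $ i \<in> \<rat>" using assms by (simp add: rational_points_def)
    then obtain p q where q: "q > 0" "x $ i = of_int p / of_int q"
      by (metis Rats_cases' )
    then have "real (nat q) * x $ i \<in> \<int>" by simp
    with q(1) show ?thesis by (intro exI[of _ "nat q"]) auto
  qed
  then obtain d where d: "\<And>i. d i > 0" "\<And>i. real (d i) * x $ i \<in> \<int>" by metis
  define D where "D = (\<Prod>i\<in>UNIV. d i)"
  have "real D * x $ i \<in> \<int>" for i
  proof -
    have "D = (\<Prod>j\<in>UNIV - {i}. d j) * d i"
      unfolding D_def by (simp add: prod.remove[of UNIV i] mult.commute)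
    then have "real D * x $ i = real (\<Prod>j\<in>UNIV - {i}. d j) * (real (d i) * x $ i)" by simp
    also have "\<dots> \<in> \<int>" using d(2)[of i] by (rule Ints_mult[OF Ints_of_nat])
    finally show ?thesis .
  qed
  moreover have "D > 0" using d(1) by (auto simp: D_def intro: prod_pos)
  ultimately show ?thesis by (intro exI[of _ D]) (auto simp: int_vecs_def)
qed

lemma den_scaleR:
  assumes "x \<in> rational_points"
  shows "den x > 0" "real (den x) *\<^sub>R x \<in> int_vecs"
proof -
  have "\<exists>d. 0 < d \<and> (\<forall>i. real d * x $ i \<in> \<int>)"
    using rational_common_denominator[OF assms] by (auto simp: int_vecs_def)
  from LeastI_ex[OF this] show "den x > 0" "real (den x) *\<^sub>R x \<in> int_vecs"
    by (auto simp: den_def int_vecs_def)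
qed

lemma den_le: "0 < d \<Longrightarrow> real d *\<^sub>R x \<in> int_vecs \<Longrightarrow> den x \<le> d"
  unfolding den_def by (rule Least_le) (simp add: int_vecs_def)

lemma scaled_int_vec_rational:
  assumes "d \<in> \<rat>" "d \<noteq> 0" "d *\<^sub>R x \<in> int_vecs"
  shows "x \<in> rational_points"
proof -
  have "x $ i \<in> \<rat>" for i
  proof -
    have "d * x $ i \<in> \<rat>" using assms(3) Ints_subset_Rats by (auto simp: int_vecs_def)
    then have "(d * x $ i) / d \<in> \<rat>" using assms(1) by (rule Rats_divide)
    then show ?thesis using assms(2) by simp
  qed
  then show ?thesis by (simp add: rational_points_def)
qed

lemma dehom_rational:
  assumes "u \<in> int_vecs" "u $ None \<noteq> 0"
  shows "dehom u \<in> rational_points"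
  using assms Ints_subset_Rats by (auto simp: rational_points_def int_vecs_def intro!: Rats_divide)

lemma real_vec_homogeneous:
  assumes "x \<in> rational_points"
  shows "real_vec (homogeneous x) = rhom x"
  using den_scaleR(2)[OF assms] by (simp add: vec_option_eq_iff homogeneous_def int_vecs_def)

lemma rhom_int_vecs: "x \<in> rational_points \<Longrightarrow> rhom x \<in> int_vecs"
  using range_real_vec real_vec_homogeneous by (metis rangeI)

lemma dehom_rhom: "x \<in> rational_points \<Longrightarrow> dehom (rhom x) = x"
  using den_scaleR(1)[of x] by (simp add: vec_eq_iff)

text \<open>Unimodularity of \<open>{u}\<close> means that \<open>u\<close> is primitive. The height
  of \<open>u\<close> clears the denominators of \<open>dehom u\<close>, so \<open>den\<close> is at
  most that height; conversely \<open>rhom (dehom u)\<close> is an integer multiple of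
  \<open>u\<close>, so \<open>den\<close> is at least that height.\<close>

lemma rhom_dehom:
  assumes "unimodular {u}" "0 < u $ None"
  shows "rhom (dehom u) = u"
proof -
  have uI: "u \<in> int_vecs" using unimodular_int_vecs[OF assms(1)] by simp
  then have "u $ None \<in> \<int>" by (simp add: int_vecs_def)
  then obtain D where D: "u $ None = real D" "0 < D"
    using assms(2) by (metis Ints_cases of_int_0_less_iff of_int_of_nat_eq of_nat_0_less_iff pos_int_cases)
  have rat: "dehom u \<in> rational_points" using uI assms(2) by (intro dehom_rational) auto
  have *: "real d *\<^sub>R hp (dehom u) = (real d / real D) *\<^sub>R u" for d
    using assms(2) D(1) by (simp add: hp_dehom)
  have "real D *\<^sub>R dehom u \<in> int_vecs"
    using uI D assms(2) by (auto simp: int_vecs_def)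
  then have "den (dehom u) \<le> D" using D(2) by (rule den_le[rotated])
  moreover have "(real (den (dehom u)) / real D) *\<^sub>R u \<in> int_vecs"
    using rhom_int_vecs[OF rat] * by (simp add: rhom_def)
  then have "real (den (dehom u)) / real D \<in> \<int>"
    using unimodularD[OF assms(1), of "\<lambda>_. real (den (dehom u)) / real D" u] by simp
  then obtain m where m: "real (den (dehom u)) / real D = of_int m" by (auto elim: Ints_cases)
  have "0 < real (den (dehom u)) / real D" using den_scaleR(1)[OF rat] D(2) by simp
  then have "1 \<le> (of_int m :: real)" unfolding m by simp
  then have "D \<le> den (dehom u)" using D(2) unfolding m[symmetric] by (simp add: pos_le_divide_eq)
  ultimately have "den (dehom u) = D" by simp
  then show ?thesis unfolding rhom_def * using D(2) by simp
qed

lemma regular_simplex_iff: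
  "regular_simplex T \<longleftrightarrow> (\<exists>V. V \<subseteq> rational_points \<and> \<not> affine_dependent V \<and> T = convex hull V \<and>
     unimodular (rhom ` V))"
proof -
  have "(\<exists>B. homogeneous ` V \<subseteq> B \<and> int_basis B) \<longleftrightarrow> unimodular (rhom ` V)"
    if "V \<subseteq> rational_points" "\<not> affine_dependent V" for V :: "(real^'n) set"
  proof -
    have "real_vec ` homogeneous ` V = rhom ` V"
      using that(1) real_vec_homogeneous by (auto simp: image_image intro!: image_cong)
    then show ?thesis
      using ex_int_basis_iff[of "homogeneous ` V"] aff_independent_finite[OF that(2)] by simp
  qed
  then show ?thesis unfolding regular_simplex_def by metis
qed

section \<open>Slicing cones at height one\<close>

lemma hp_convex: "hp ((1 - t) *\<^sub>R x + t *\<^sub>R y) = (1 - t) *\<^sub>R hp x + t *\<^sub>R hp y"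
  by (simp add: vec_option_eq_iff)

text \<open>Cone coefficients \<open>a u\<close> correspond to convex coefficients
  \<open>a u * u $ None\<close>: the coordinate \<open>None\<close> of \<open>combo a = hp x\<close>
  says that these sum to 1.\<close>

lemma in_convex_hull_dehom_iff:
  fixes x :: "real^'n"
  assumes fin: "finite \<sigma>" and pos: "\<And>u. u \<in> \<sigma> \<Longrightarrow> 0 < u $ None"
  shows "x \<in> convex hull (dehom ` \<sigma>) \<longleftrightarrow> (\<exists>a. (\<forall>u. 0 \<le> a u) \<and> {u. a u \<noteq> 0} \<subseteq> \<sigma> \<and> combo a = hp x)"
proof
  define D where "D = {x. \<exists>a. (\<forall>u. 0 \<le> a u) \<and> {u. a u \<noteq> 0} \<subseteq> \<sigma> \<and> combo a = hp x}"
  have "convex D"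
  proof (rule convexI)
    fix x y :: "real^'n" and r t :: real
    assume "x \<in> D" "y \<in> D" and t: "0 \<le> r" "0 \<le> t" "r + t = 1"
    have r: "r = 1 - t" using t by simp
    obtain a b where a: "\<And>u. 0 \<le> a u" "{u. a u \<noteq> 0} \<subseteq> \<sigma>" "combo a = hp x"
      and b: "\<And>u. 0 \<le> b u" "{u. b u \<noteq> 0} \<subseteq> \<sigma>" "combo b = hp y"
      using \<open>x \<in> D\<close> \<open>y \<in> D\<close> unfolding D_def by blast
    define c where "c u = (1 - t) * a u + t * b u" for u
    have "combo f = (\<Sum>u\<in>\<sigma>. f u *\<^sub>R u)" if "{u. f u \<noteq> 0} \<subseteq> \<sigma>" for f
      using that by (intro combo_eq_sum[OF fin]) auto
    moreover have c\<sigma>: "{u. c u \<noteq> 0} \<subseteq> \<sigma>"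
    proof -
      have "c u = 0" if "u \<notin> \<sigma>" for u
      proof -
        have "a u = 0" "b u = 0" using that a(2) b(2) by auto
        then show ?thesis by (simp add: c_def)
      qed
      then show ?thesis by blast
    qed
    ultimately have "combo c = (1 - t) *\<^sub>R combo a + t *\<^sub>R combo b"
      using a(2) b(2) by (simp add: c_def scaleR_add_left sum.distrib scaleR_right.sum)
    then have "combo c = hp ((1 - t) *\<^sub>R x + t *\<^sub>R y)" using a(3) b(3) by (simp add: hp_convex)
    moreover have "0 \<le> c u" for u using a(1) b(1) t by (simp add: c_def flip: r)
    ultimately show "r *\<^sub>R x + t *\<^sub>R y \<in> D" using c\<sigma> unfolding D_def r by blast
  qed
  moreover have "dehom ` \<sigma> \<subseteq> D"
  proof
    fix x assume "x \<in> dehom ` \<sigma>"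
    then obtain u where u: "u \<in> \<sigma>" "x = dehom u" by blast
    define a where "a w = (if w = u then 1 / u $ None else 0)" for w
    have "combo a = hp x"
      using combo_eq_sum[of "{u}" a] pos[OF u(1)] by (simp add: a_def u(2) hp_dehom)
    then show "x \<in> D" using u(1) pos[OF u(1)] unfolding D_def by (auto simp: a_def split: if_splits intro!: exI[of _ a])
  qed
  ultimately have "convex hull (dehom ` \<sigma>) \<subseteq> D" by (rule hull_minimal[rotated])
  then show "x \<in> convex hull (dehom ` \<sigma>) \<Longrightarrow> \<exists>a. (\<forall>u. 0 \<le> a u) \<and> {u. a u \<noteq> 0} \<subseteq> \<sigma> \<and> combo a = hp x"
    unfolding D_def by blast
next
  assume "\<exists>a. (\<forall>u. 0 \<le> a u) \<and> {u. a u \<noteq> 0} \<subseteq> \<sigma> \<and> combo a = hp x"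
  then obtain a where a: "\<And>u. 0 \<le> a u" "{u. a u \<noteq> 0} \<subseteq> \<sigma>" "combo a = hp x" by blast
  have sum: "hp x = (\<Sum>u\<in>\<sigma>. a u *\<^sub>R u)"
    using a(2) unfolding a(3)[symmetric] by (intro combo_eq_sum[OF fin]) auto
  have "(\<Sum>u\<in>\<sigma>. a u * u $ None) = 1"
    using arg_cong[OF sum, of "\<lambda>z. z $ None"] by simp
  then have "(\<Sum>u\<in>\<sigma>. (a u * u $ None) *\<^sub>R dehom u) \<in> convex hull (dehom ` \<sigma>)"
    using fin a(1) pos by (intro convex_sum) (auto intro: hull_inc simp: less_imp_le)
  moreover have "(\<Sum>u\<in>\<sigma>. (a u * u $ None) *\<^sub>R dehom u) = x"
  proof (rule vec_eq_iff[THEN iffD2], intro allI)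
    fix i
    have "(\<Sum>u\<in>\<sigma>. (a u * u $ None) *\<^sub>R dehom u) $ i = (\<Sum>u\<in>\<sigma>. a u * u $ Some i)"
      by (auto intro!: sum.cong dest!: pos)
    then show "(\<Sum>u\<in>\<sigma>. (a u * u $ None) *\<^sub>R dehom u) $ i = x $ i"
      using arg_cong[OF sum, of "\<lambda>z. z $ Some i"] by simp
  qed
  ultimately show "x \<in> convex hull (dehom ` \<sigma>)" by simp
qed

lemma inj_on_dehom:
  assumes "independent \<sigma>" "\<And>u. u \<in> \<sigma> \<Longrightarrow> 0 < u $ None"
  shows "inj_on dehom \<sigma>"
proof (intro inj_onI, rule ccontr)
  fix u v assume uv: "u \<in> \<sigma>" "v \<in> \<sigma>" "dehom u = dehom v" "u \<noteq> v"
  have "(1 / u $ None) *\<^sub>R u = (1 / v $ None) *\<^sub>R v"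
    using uv(3) hp_dehom[of u] hp_dehom[of v] assms(2)[OF uv(1)] assms(2)[OF uv(2)] by simp
  then have "(\<Sum>w\<in>{u, v}. (if w = u then 1 / u $ None else - 1 / v $ None) *\<^sub>R w) = 0"
    using uv(4) by simp
  moreover have "independent {u, v}" using uv(1,2) by (intro independent_mono[OF assms(1)]) auto
  ultimately have "1 / u $ None = 0"
    using independent_sum_eq_zeroD[of "{u, v}" _ u] by fastforce
  with assms(2)[OF uv(1)] show False by simp
qed

lemma affine_independent_dehom:
  assumes "independent \<sigma>" "finite \<sigma>" "\<And>u. u \<in> \<sigma> \<Longrightarrow> 0 < u $ None"
  shows "\<not> affine_dependent (dehom ` \<sigma>)"
proof
  have inj: "inj_on dehom \<sigma>" using assms(1,3) by (rule inj_on_dehom)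
  assume "affine_dependent (dehom ` \<sigma>)"
  then obtain U where U: "sum U (dehom ` \<sigma>) = 0" "\<exists>v\<in>dehom ` \<sigma>. U v \<noteq> 0"
    "(\<Sum>v\<in>dehom ` \<sigma>. U v *\<^sub>R v) = 0"
    using affine_dependent_explicit_finite[of "dehom ` \<sigma>"] assms(2) by auto
  have "(\<Sum>u\<in>\<sigma>. (U (dehom u) / u $ None) *\<^sub>R u) = (\<Sum>u\<in>\<sigma>. U (dehom u) *\<^sub>R hp (dehom u))"
    using assms(3) by (intro sum.cong) (auto simp: hp_dehom less_imp_neq[symmetric])
  also have "\<dots> = (\<Sum>v\<in>dehom ` \<sigma>. U v *\<^sub>R hp v)" by (simp add: sum.reindex[OF inj])
  also have "\<dots> = 0"
    using U(1) arg_cong[OF U(3), of "\<lambda>z. z $ i" for i] by (simp add: vec_option_eq_iff)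
  finally have "U (dehom u) / u $ None = 0" if "u \<in> \<sigma>" for u
    using independent_sum_eq_zeroD[OF assms(1,2), of "\<lambda>u. U (dehom u) / u $ None"] that by simp
  with U(2) assms(3) show False by force
qed

text \<open>A point common to two simplexes has only one weight, by injectivity of
  \<open>combo\<close>, and its support lies in both cones; so the simplexes meet in the face over
  \<open>\<sigma> \<inter> \<tau>\<close>. Regularity comes from \<open>rhom_dehom\<close>, applied
  to single generators.\<close>

lemma fan_regular_triangulation:
  fixes K :: "(real^('n::finite option)) set set"
  assumes K: "fan K" and uni: "\<And>\<sigma>. \<sigma> \<in> K \<Longrightarrow> unimodular \<sigma>"
    and pos: "\<And>u. u \<in> \<Union>K \<Longrightarrow> 0 < u $ None"
  shows "regular_triangulation ((\<lambda>\<sigma>. convex hull (dehom ` \<sigma>)) ` K) {x. hp x \<in> combo ` weights K}"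
proof -
  have fin: "finite \<sigma>" if "\<sigma> \<in> K" for \<sigma> using K that by (rule fan_member_finite)
  have pos': "0 < u $ None" if "\<sigma> \<in> K" "u \<in> \<sigma>" for \<sigma> u using pos that by blast
  have ai: "\<not> affine_dependent (dehom ` \<sigma>)" if "\<sigma> \<in> K" for \<sigma>
    using affine_independent_dehom[OF fan_independent[OF K that] fin[OF that] pos'[OF that]] .
  have inj: "inj_on dehom \<sigma>" if "\<sigma> \<in> K" for \<sigma>
    using inj_on_dehom[OF fan_independent[OF K that] pos'[OF that]] .
  note mem = in_convex_hull_dehom_iff[OF fin pos']
  have wt: "a \<in> weights K" if "\<And>u. 0 \<le> a u" "{u. a u \<noteq> 0} \<subseteq> \<sigma>" "\<sigma> \<in> K" for a \<sigma>
    using that fan_subset[OF K] by (auto simp: weights_def)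
  have inter: "(convex hull (dehom ` \<sigma>)) \<inter> (convex hull (dehom ` \<tau>)) = convex hull (dehom ` (\<sigma> \<inter> \<tau>))"
    if \<sigma>: "\<sigma> \<in> K" and \<tau>: "\<tau> \<in> K" for \<sigma> \<tau>
  proof (intro equalityI subsetI)
    fix x assume x: "x \<in> (convex hull (dehom ` \<sigma>)) \<inter> (convex hull (dehom ` \<tau>))"
    obtain a where a: "\<And>u. 0 \<le> a u" "{u. a u \<noteq> 0} \<subseteq> \<sigma>" "combo a = hp x"
      using x mem[OF \<sigma> \<sigma>] by blast
    obtain b where b: "\<And>u. 0 \<le> b u" "{u. b u \<noteq> 0} \<subseteq> \<tau>" "combo b = hp x"
      using x mem[OF \<tau> \<tau>] by blast
    have "a = b"
      using inj_onD[OF fan_inj[OF K]] wt[OF a(1,2) \<sigma>] wt[OF b(1,2) \<tau>] a(3) b(3) by simp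
    then have s: "{u. a u \<noteq> 0} \<subseteq> \<sigma> \<inter> \<tau>" using a(2) b(2) by blast
    have st: "\<sigma> \<inter> \<tau> \<in> K" using fan_subset[OF K \<sigma>] by blast
    show "x \<in> convex hull (dehom ` (\<sigma> \<inter> \<tau>))"
      using mem[OF st st] a(1,3) s by blast
  next
    fix x assume "x \<in> convex hull (dehom ` (\<sigma> \<inter> \<tau>))"
    then show "x \<in> (convex hull (dehom ` \<sigma>)) \<inter> (convex hull (dehom ` \<tau>))"
      using hull_mono[of "dehom ` (\<sigma> \<inter> \<tau>)" "dehom ` \<sigma>"] hull_mono[of "dehom ` (\<sigma> \<inter> \<tau>)" "dehom ` \<tau>"]
      by blast
  qed
  define \<Delta> where "\<Delta> = (\<lambda>\<sigma>. convex hull (dehom ` \<sigma>)) ` K"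
  have "simplicial_complex \<Delta>"
    unfolding simplicial_complex_def
  proof (intro conjI ballI allI impI)
    show "finite \<Delta>" using fan_finite[OF K] by (simp add: \<Delta>_def)
  next
    fix S assume "S \<in> \<Delta>"
    then obtain \<sigma> where \<sigma>: "\<sigma> \<in> K" "S = convex hull (dehom ` \<sigma>)" by (auto simp: \<Delta>_def)
    then have "(int (card (dehom ` \<sigma>)) - 1) simplex S"
      using ai by (auto intro!: simplex_convex_hull)
    then show "\<exists>n. n simplex S" by blast
  next
    fix F S assume "S \<in> \<Delta> \<and> F face_of S"
    then obtain \<sigma> where \<sigma>: "\<sigma> \<in> K" "F face_of convex hull (dehom ` \<sigma>)" by (auto simp: \<Delta>_def)
    then obtain c where "c \<subseteq> dehom ` \<sigma>" "F = convex hull c"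
      using face_of_convex_hull_affine_independent[OF ai[OF \<sigma>(1)]] by blast
    then obtain \<tau> where "\<tau> \<subseteq> \<sigma>" "F = convex hull (dehom ` \<tau>)" by (auto simp: subset_image_iff)
    then show "F \<in> \<Delta>" using fan_subset[OF K \<sigma>(1)] by (auto simp: \<Delta>_def)
  next
    fix S S' assume "S \<in> \<Delta> \<and> S' \<in> \<Delta>"
    then obtain \<sigma> \<tau> where \<sigma>: "\<sigma> \<in> K" "S = convex hull (dehom ` \<sigma>)"
      and \<tau>: "\<tau> \<in> K" "S' = convex hull (dehom ` \<tau>)" by (auto simp: \<Delta>_def)
    have "dehom ` (\<sigma> \<inter> \<tau>) \<subseteq> dehom ` \<sigma>" by (rule image_mono) simp
    then show "S \<inter> S' face_of S"
      using face_of_convex_hull_affine_independent[OF ai[OF \<sigma>(1)], of "S \<inter> S'"]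
        inter[OF \<sigma>(1) \<tau>(1)] \<sigma>(2) \<tau>(2) by metis
  qed
  moreover have "\<Union>\<Delta> = {x. hp x \<in> combo ` weights K}"
  proof (intro equalityI subsetI)
    fix x assume "x \<in> \<Union>\<Delta>"
    then obtain \<sigma> where \<sigma>: "\<sigma> \<in> K" "x \<in> convex hull (dehom ` \<sigma>)" by (auto simp: \<Delta>_def)
    then obtain a where "\<And>u. 0 \<le> a u" "{u. a u \<noteq> 0} \<subseteq> \<sigma>" "combo a = hp x"
      using mem[OF \<sigma>(1) \<sigma>(1)] by blast
    with wt \<sigma>(1) show "x \<in> {x. hp x \<in> combo ` weights K}" by (metis (mono_tags) imageI mem_Collect_eq)
  next
    fix x assume "x \<in> {x. hp x \<in> combo ` weights K}"
    then obtain a where a: "a \<in> weights K" "combo a = hp x" by (auto simp: image_iff)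
    then have s: "{u. a u \<noteq> 0} \<in> K" by (auto simp: weights_def)
    then have "x \<in> convex hull (dehom ` {u. a u \<noteq> 0})"
      using mem[OF s s] a by (auto simp: weights_def)
    with s show "x \<in> \<Union>\<Delta>" by (auto simp: \<Delta>_def)
  qed
  moreover have "regular_simplex T" if T: "T \<in> \<Delta>" for T
  proof -
    obtain \<sigma> where \<sigma>: "\<sigma> \<in> K" "T = convex hull (dehom ` \<sigma>)" using T by (auto simp: \<Delta>_def)
    have "rhom (dehom u) = u" if u: "u \<in> \<sigma>" for u
      using u by (intro rhom_dehom pos'[OF \<sigma>(1)] unimodular_subset[OF uni[OF \<sigma>(1)]]) auto
    then have "rhom ` dehom ` \<sigma> = \<sigma>" by (simp add: image_image)
    moreover have "dehom ` \<sigma> \<subseteq> rational_points"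
    proof
      fix x assume "x \<in> dehom ` \<sigma>"
      then obtain u where u: "u \<in> \<sigma>" "x = dehom u" by blast
      show "x \<in> rational_points"
        unfolding u(2) using unimodular_int_vecs[OF uni[OF \<sigma>(1)]] pos'[OF \<sigma>(1) u(1)] u(1)
        by (intro dehom_rational) auto
    qed
    ultimately show ?thesis
      unfolding regular_simplex_iff using \<sigma>(2) ai[OF \<sigma>(1)] uni[OF \<sigma>(1)] by (intro exI[of _ "dehom ` \<sigma>"]) simp
  qed
  ultimately show ?thesis unfolding regular_triangulation_def \<Delta>_def by blast
qed

text \<open>\<open>rational_measure\<close> is a definite description, so at least one regular
  triangulation must be exhibited before its value can be used.\<close>

theorem regular_triangulation_exists:
  assumes "finite P" "P \<subseteq> rational_points"
  shows "\<exists>\<Delta>. regular_triangulation \<Delta> (convex hull P)"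
proof -
  define V where "V = rhom ` P"
  have finV: "finite V" using assms(1) by (simp add: V_def)
  have Vp: "V \<subseteq> {u \<in> int_vecs. 0 < u $ None}"
    using assms(2) rhom_int_vecs den_scaleR(1) unfolding V_def by fastforce
  have PV: "P = dehom ` V" using assms(2) dehom_rhom by (force simp: V_def image_image)
  obtain K where K: "fan K" "\<Union>K \<subseteq> V" "combo ` weights K = convex_cone hull V"
    using fan_convex_cone_hull[OF finV] by blast
  obtain L where L: "fan L" "\<Union>L \<subseteq> {u \<in> int_vecs. 0 < u $ None}"
    "combo ` weights L = combo ` weights K" "\<And>\<sigma>. \<sigma> \<in> L \<Longrightarrow> unimodular \<sigma>"
    using unimodular_refinement[OF K(1) order.trans[OF K(2) Vp]] by (elim exE conjE) simp
  have "hp x \<in> combo ` weights K \<longleftrightarrow> x \<in> convex hull P" for x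
  proof -
    have "x \<in> convex hull P \<longleftrightarrow> (\<exists>a. (\<forall>u. 0 \<le> a u) \<and> {u. a u \<noteq> 0} \<subseteq> V \<and> combo a = hp x)"
      unfolding PV using Vp by (intro in_convex_hull_dehom_iff finV) blast
    also have "\<dots> \<longleftrightarrow> hp x \<in> combo ` weights K"
    proof
      assume "\<exists>a. (\<forall>u. 0 \<le> a u) \<and> {u. a u \<noteq> 0} \<subseteq> V \<and> combo a = hp x"
      then show "hp x \<in> combo ` weights K"
        unfolding K(3) by (elim exE conjE) (metis combo_in_convex_cone_hull finV)
    next
      assume "hp x \<in> combo ` weights K"
      then obtain a where "a \<in> weights K" "combo a = hp x" by (auto simp: image_iff)
      with K(2) show "\<exists>a. (\<forall>u. 0 \<le> a u) \<and> {u. a u \<noteq> 0} \<subseteq> V \<and> combo a = hp x"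
        by (intro exI[of _ a]) (auto simp: weights_def)
    qed
    finally show ?thesis by simp
  qed
  then have "{x. hp x \<in> combo ` weights L} = convex hull P" unfolding L(3) by simp
  moreover have "0 < u $ None" if "u \<in> \<Union>L" for u using L(2) that by blast
  ultimately show ?thesis using fan_regular_triangulation[OF L(1,4)] by metis
qed

text \<open>A parallelotope is a Minkowski sum of segments from 0, and convex hulls commute with
  Minkowski sums. For rational \<open>v i\<close> this presents it as the hull of finitely many
  rational points.\<close>

lemma parallelotope_convex_hull:
  "parallelotope e v = convex hull {\<Sum>i\<le>e. s i | s. \<forall>i\<le>e. s i \<in> {0, v i}}"
proof -
  have "parallelotope e v = (\<Sum>i\<le>e. closed_segment 0 (v i))"
    unfolding set_sum_alt[OF finite_atMost] parallelotope_def
  proof (intro equalityI subsetI)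
    fix x assume "x \<in> {\<Sum>i\<le>e. \<alpha> i *\<^sub>R v i |\<alpha>. \<forall>i\<le>e. \<alpha> i \<in> {0..1}}"
    then obtain \<alpha> where \<alpha>: "x = (\<Sum>i\<le>e. \<alpha> i *\<^sub>R v i)" "\<forall>i\<le>e. \<alpha> i \<in> {0..1}" by blast
    then have "\<forall>i\<in>{..e}. \<alpha> i *\<^sub>R v i \<in> closed_segment 0 (v i)" by (auto simp: in_segment)
    with \<alpha>(1) show "x \<in> {sum s {..e} |s. \<forall>i\<in>{..e}. s i \<in> closed_segment 0 (v i)}"
      by (intro CollectI exI[of _ "\<lambda>i. \<alpha> i *\<^sub>R v i"]) simp
  next
    fix x assume "x \<in> {sum s {..e} |s. \<forall>i\<in>{..e}. s i \<in> closed_segment 0 (v i)}"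
    then obtain s where s: "x = sum s {..e}" "\<forall>i\<in>{..e}. s i \<in> closed_segment 0 (v i)" by blast
    then have "\<forall>i\<in>{..e}. \<exists>u. u \<in> {0..1} \<and> s i = u *\<^sub>R v i" by (auto simp: in_segment)
    then obtain \<alpha> where "\<forall>i\<in>{..e}. \<alpha> i \<in> {0..1} \<and> s i = \<alpha> i *\<^sub>R v i" by metis
    with s(1) show "x \<in> {\<Sum>i\<le>e. \<alpha> i *\<^sub>R v i |\<alpha>. \<forall>i\<le>e. \<alpha> i \<in> {0..1}}"
      by (intro CollectI exI[of _ \<alpha>]) (auto intro!: sum.cong)
  qed
  also have "\<dots> = convex hull (\<Sum>i\<le>e. {0, v i})"
    by (simp only: convex_hull_set_sum segment_convex_hull)
  also have "(\<Sum>i\<le>e. {0, v i}) = {\<Sum>i\<le>e. s i | s. \<forall>i\<le>e. s i \<in> {0, v i}}"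
    unfolding set_sum_alt[OF finite_atMost] by (simp add: Ball_def)
  finally show ?thesis .
qed

lemma rational_points_sum: "(\<And>i. i \<in> I \<Longrightarrow> f i \<in> rational_points) \<Longrightarrow> (\<Sum>i\<in>I. f i) \<in> rational_points"
  by (auto simp: rational_points_def intro!: Rats_sum)

lemma parallelotope_regular_triangulation:
  assumes "\<And>i. i \<le> e \<Longrightarrow> v i \<in> rational_points"
  shows "\<exists>\<Delta>. regular_triangulation \<Delta> (parallelotope e v)"
  unfolding parallelotope_convex_hull
proof (rule regular_triangulation_exists)
  have "{\<Sum>i\<le>e. s i | s. \<forall>i\<le>e. s i \<in> {0, v i}} \<subseteq> (\<lambda>s. \<Sum>i\<le>e. s i) ` (\<Pi>\<^sub>E i\<in>{..e}. {0, v i})"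
  proof safe
    fix s assume "\<forall>i\<le>e. s i \<in> {0, v i}"
    then show "(\<Sum>i\<le>e. s i) \<in> (\<lambda>s. \<Sum>i\<le>e. s i) ` (\<Pi>\<^sub>E i\<in>{..e}. {0, v i})"
      by (intro image_eqI[of _ _ "restrict s {..e}"]) auto
  qed
  then show "finite {\<Sum>i\<le>e. s i | s. \<forall>i\<le>e. s i \<in> {0, v i}}"
    by (rule finite_subset) (intro finite_imageI finite_PiE; simp)
  have "0 \<in> rational_points" by (simp add: rational_points_def)
  then show "{\<Sum>i\<le>e. s i | s. \<forall>i\<le>e. s i \<in> {0, v i}} \<subseteq> rational_points"
    using assms by (auto intro!: rational_points_sum)
qed

section \<open>Invariance under the integer general linear group\<close>

lemma det_Ints:
  fixes A :: "real^'m^'m"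
  assumes "\<And>i j. A $ i $ j \<in> \<int>"
  shows "det A \<in> \<int>"
  unfolding det_def using assms by (intro Ints_sum Ints_mult Ints_prod) auto

lemma int_matrix_vector_mult:
  fixes A :: "real^'m^'m"
  assumes "\<And>i j. A $ i $ j \<in> \<int>" "x \<in> int_vecs"
  shows "A *v x \<in> int_vecs"
  using assms by (auto simp: int_vecs_def matrix_vector_mult_def intro!: Ints_sum Ints_mult)

text \<open>By Cramer's rule \<open>x $ k * det A\<close> is the determinant of an integer
  matrix.\<close>

lemma unit_det_int_vecsD:
  fixes A :: "real^'m^'m"
  assumes A: "\<And>i j. A $ i $ j \<in> \<int>" and d: "det A = 1 \<or> det A = -1" and x: "A *v x \<in> int_vecs"
  shows "x \<in> int_vecs"
proof -
  have "x $ k \<in> \<int>" for k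
  proof -
    have "det (\<chi> i j. if j = k then (A *v x) $ i else A $ i $ j) \<in> \<int>"
      using A x by (intro det_Ints) (auto simp: int_vecs_def)
    then have "x $ k * det A \<in> \<int>" unfolding cramer_lemma .
    with d show ?thesis by (auto simp: minus_in_Ints_iff)
  qed
  then show ?thesis by (simp add: int_vecs_def)
qed

lemma scales_int_vecs_imp_zero:
  assumes "\<And>c. c *\<^sub>R x \<in> int_vecs"
  shows "x = 0"
proof (rule ccontr)
  assume "x \<noteq> 0"
  then obtain i where i: "x $ i \<noteq> 0" by (auto simp: vec_eq_iff)
  have "((1 / (2 * x $ i)) *\<^sub>R x) $ i \<in> \<int>"
    using assms[of "1 / (2 * x $ i)"] unfolding int_vecs_def by blast
  then show False using i by simp
qed

text \<open>A kernel vector has all its multiples in the lattice, so \<open>A\<close> is invertible;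
  \<open>inv\<close> makes the columns of the inverse integral, and two integers with product 1 have
  absolute value 1.\<close>

lemma abs_det_eq_1:
  fixes A :: "real^'m^'m"
  assumes A: "\<And>i j. A $ i $ j \<in> \<int>" and inv: "\<And>x. A *v x \<in> int_vecs \<Longrightarrow> x \<in> int_vecs"
  shows "\<bar>det A\<bar> = 1"
proof -
  have "x = 0" if "A *v x = 0" for x
  proof (rule scales_int_vecs_imp_zero)
    fix c
    have "A *v (c *\<^sub>R x) = 0" using that by (simp add: matrix_vector_mult_scaleR)
    then show "c *\<^sub>R x \<in> int_vecs" by (metis inv zero_int_vecs)
  qed
  then obtain B where B: "B ** A = mat 1"
    using matrix_left_invertible_ker[of A] by blast
  then have AB: "A ** B = mat 1" by (simp add: matrix_left_right_inverse)
  have "B $ i $ j \<in> \<int>" for i j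
  proof -
    have "A *v (B *v axis j 1) = axis j 1"
      by (simp add: matrix_vector_mul_assoc AB)
    then have "B *v axis j 1 \<in> int_vecs" by (simp add: inv)
    then show ?thesis by (simp add: matrix_vector_mult_basis column_def int_vecs_def)
  qed
  then have "det A \<in> \<int>" "det B \<in> \<int>" using A by (auto intro: det_Ints)
  moreover have "det A * det B = 1" using AB by (metis det_I det_mul)
  ultimately show ?thesis
  proof (elim Ints_cases)
    fix m n :: int assume "det A = of_int m" "det B = of_int n"
    with \<open>det A * det B = 1\<close> have "real_of_int (m * n) = 1" by simp
    then have "m * n = 1" by linarith
    then have "\<bar>m\<bar> = 1" using abs_zmult_eq_1[of m n] by simp
    with \<open>det A = of_int m\<close> show "\<bar>det A\<bar> = 1" by simp
  qed
qed

text \<open>Inverses, compositions and the lift to homogeneous coordinates are easy in this form,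
  without computing with matrices.\<close>

lemma GL_int_iff: "f \<in> GL_int \<longleftrightarrow> linear f \<and> (\<forall>x. f x \<in> int_vecs \<longleftrightarrow> x \<in> int_vecs)"
proof
  assume "f \<in> GL_int"
  then obtain U where U: "f = (*v) U" "\<And>i j. U $ i $ j \<in> \<int>" "det U = 1 \<or> det U = -1"
    by (auto simp: GL_int_def)
  show "linear f \<and> (\<forall>x. f x \<in> int_vecs \<longleftrightarrow> x \<in> int_vecs)"
    unfolding U(1)
    by (intro conjI allI iffI matrix_vector_mul_linear;
        (rule int_matrix_vector_mult[OF U(2)] unit_det_int_vecsD[OF U(2,3)])?; assumption)
next
  assume f: "linear f \<and> (\<forall>x. f x \<in> int_vecs \<longleftrightarrow> x \<in> int_vecs)"
  then have feq: "f = (*v) (matrix f)" by (simp add: fun_eq_iff matrix_works)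
  have "matrix f $ i $ j \<in> \<int>" for i j
  proof -
    have "f (axis j 1) \<in> int_vecs" using f by simp
    then show ?thesis by (simp add: matrix_def int_vecs_def)
  qed
  moreover have "\<bar>det (matrix f)\<bar> = 1"
    using calculation f by (intro abs_det_eq_1) auto
  then have "det (matrix f) = 1 \<or> det (matrix f) = -1" by linarith
  ultimately show "f \<in> GL_int" unfolding GL_int_def using feq by blast
qed

lemma GL_int_linear: "f \<in> GL_int \<Longrightarrow> linear f"
  and GL_int_int_vecs_iff: "f \<in> GL_int \<Longrightarrow> f x \<in> int_vecs \<longleftrightarrow> x \<in> int_vecs"
  by (auto simp: GL_int_iff)

lemma GL_int_inj:
  assumes "f \<in> GL_int"
  shows "inj f"
  unfolding linear_injective_0[OF GL_int_linear[OF assms]]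
proof (intro allI impI)
  fix x assume "f x = 0"
  then have "f (c *\<^sub>R x) \<in> int_vecs" for c
    by (simp add: linear_cmul[OF GL_int_linear[OF assms]])
  then show "x = 0" by (intro scales_int_vecs_imp_zero) (simp add: GL_int_int_vecs_iff[OF assms])
qed

lemma GL_int_inverse:
  assumes "f \<in> GL_int"
  shows "\<exists>g\<in>GL_int. (\<forall>x. g (f x) = x) \<and> (\<forall>x. f (g x) = x)"
proof -
  have lin: "linear f" using assms by (rule GL_int_linear)
  then obtain g where g: "linear g" "g \<circ> f = id"
    using linear_injective_left_inverse[OF lin GL_int_inj[OF assms]] by blast
  then have fg: "f \<circ> g = id" using linear_inverse_left[OF g(1) lin] by blast
  have gf: "g (f x) = x" "f (g x) = x" for x using g(2) fg by (auto simp: fun_eq_iff)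
  then have "g \<in> GL_int" using g(1) GL_int_int_vecs_iff[OF assms] unfolding GL_int_iff by metis
  with gf show ?thesis by blast
qed

lemma GL_int_comp: "f \<in> GL_int \<Longrightarrow> g \<in> GL_int \<Longrightarrow> f \<circ> g \<in> GL_int"
  unfolding GL_int_iff by (auto intro: linear_compose)

lemma rational_points_iff: "x \<in> rational_points \<longleftrightarrow> (\<exists>d>0. real d *\<^sub>R x \<in> int_vecs)"
  using rational_common_denominator[of x] scaled_int_vec_rational[of "real d" x for d] by fastforce

lemma GL_int_rational_iff: "f \<in> GL_int \<Longrightarrow> f x \<in> rational_points \<longleftrightarrow> x \<in> rational_points"
  unfolding rational_points_iff
  by (metis GL_int_int_vecs_iff GL_int_linear linear_cmul)

lemma den_alt: "den x = (LEAST d. 0 < d \<and> real d *\<^sub>R x \<in> int_vecs)"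
  by (simp add: den_def int_vecs_def)

lemma GL_int_den: "f \<in> GL_int \<Longrightarrow> den (f x) = den x"
  unfolding den_alt by (metis GL_int_int_vecs_iff GL_int_linear linear_cmul)

lemma GL_int_unimodular:
  assumes f: "f \<in> GL_int" and S: "unimodular S"
  shows "unimodular (f ` S)"
  unfolding unimodular_def
proof (intro conjI allI impI)
  show "finite (f ` S)" using unimodular_finite[OF S] by simp
  show "f ` S \<subseteq> int_vecs" using unimodular_int_vecs[OF S] GL_int_int_vecs_iff[OF f] by auto
  fix a assume "(\<Sum>u\<in>f ` S. a u *\<^sub>R u) \<in> int_vecs"
  also have "(\<Sum>u\<in>f ` S. a u *\<^sub>R u) = (\<Sum>u\<in>S. a (f u) *\<^sub>R f u)"
    using GL_int_inj[OF f] by (subst sum.reindex) (auto intro: inj_on_subset)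
  also have "\<dots> = f (\<Sum>u\<in>S. a (f u) *\<^sub>R u)"
    by (simp add: linear_sum[OF GL_int_linear[OF f]] linear_cmul[OF GL_int_linear[OF f]])
  finally show "\<forall>u\<in>f ` S. a u \<in> \<int>"
    using unimodularD[OF S, of "\<lambda>u. a (f u)"] GL_int_int_vecs_iff[OF f] by simp
qed

text \<open>Acts as \<open>f\<close> on the coordinates \<open>Some i\<close> and keeps the height.
  Since \<open>f\<close> in \<open>GL_int\<close> preserves denominators, \<open>rhom x\<close> is
  carried to \<open>rhom (f x)\<close>, and unimodularity of homogeneous vertices is
  transported.\<close>

definition lift_hom :: "(real^'n \<Rightarrow> real^'n) \<Rightarrow> real^('n option) \<Rightarrow> real^('n option)" where
  "lift_hom f z = (\<chi> j. case j of None \<Rightarrow> z $ None | Some i \<Rightarrow> f (\<chi> k. z $ Some k) $ i)"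

lemma lift_hom_nth [simp]: "lift_hom f z $ None = z $ None"
  "lift_hom f z $ Some i = f (\<chi> k. z $ Some k) $ i"
  by (simp_all add: lift_hom_def)

lemma int_vecs_option_iff: "z \<in> int_vecs \<longleftrightarrow> z $ None \<in> \<int> \<and> (\<chi> k. z $ Some k) \<in> int_vecs"
  by (auto simp: int_vecs_def) (metis option.exhaust)

lemma lift_hom_GL_int:
  assumes f: "f \<in> GL_int"
  shows "lift_hom f \<in> GL_int"
  unfolding GL_int_iff
proof (intro conjI allI)
  have lin: "linear f" using f by (rule GL_int_linear)
  have [simp]: "(\<chi> k. x $ Some k + y $ Some k) = (\<chi> k. x $ Some k) + (\<chi> k. y $ Some k)"
    "(\<chi> k. c * x $ Some k) = c *\<^sub>R (\<chi> k. x $ Some k)" for x y :: "real^('n::finite option)" and c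
    by (simp_all add: vec_eq_iff)
  show "linear (lift_hom f)"
    by (rule linearI) (simp_all add: vec_option_eq_iff linear_add[OF lin] linear_cmul[OF lin])
  show "lift_hom f z \<in> int_vecs \<longleftrightarrow> z \<in> int_vecs" for z
    using GL_int_int_vecs_iff[OF f] by (simp add: int_vecs_option_iff[of "lift_hom f z"] int_vecs_option_iff[of z])
qed

lemma rhom_GL_int:
  assumes f: "f \<in> GL_int"
  shows "rhom (f x) = lift_hom f (rhom x)"
proof -
  have "(\<chi> k. real (den x) * x $ k) = real (den x) *\<^sub>R x" by (simp add: vec_eq_iff)
  then show ?thesis
    using GL_int_den[OF f] linear_cmul[OF GL_int_linear[OF f]] by (simp add: vec_option_eq_iff)
qed

section \<open>Transport of triangulations and of the invariants\<close>

lemma GL_int_affine_independent: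
  assumes f: "f \<in> GL_int" and V: "\<not> affine_dependent V"
  shows "\<not> affine_dependent (f ` V)"
  using V GL_int_inj[OF f] GL_int_linear[OF f]
  by (simp add: affine_independent_iff_card card_image inj_on_subset)

lemma GL_int_regular_simplex:
  assumes f: "f \<in> GL_int" and T: "regular_simplex T"
  shows "regular_simplex (f ` T)"
proof -
  obtain V where V: "V \<subseteq> rational_points" "\<not> affine_dependent V" "T = convex hull V"
    "unimodular (rhom ` V)"
    using T unfolding regular_simplex_iff by blast
  have "rhom ` f ` V = lift_hom f ` rhom ` V" by (simp add: image_image rhom_GL_int[OF f])
  then have "unimodular (rhom ` f ` V)"
    using GL_int_unimodular[OF lift_hom_GL_int[OF f] V(4)] by simp
  moreover have "f ` V \<subseteq> rational_points" using V(1) GL_int_rational_iff[OF f] by blast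
  moreover have "f ` T = convex hull (f ` V)"
    using V(3) convex_hull_linear_image[OF GL_int_linear[OF f]] by simp
  ultimately show ?thesis
    unfolding regular_simplex_iff using GL_int_affine_independent[OF f V(2)] by blast
qed

lemma GL_int_simplex:
  assumes f: "f \<in> GL_int"
  shows "n simplex (f ` S) \<longleftrightarrow> n simplex S"
proof -
  have *: "n simplex (f ` S)" if f: "f \<in> GL_int" and S: "n simplex S" for f :: "real^'n \<Rightarrow> real^'n" and S
  proof -
    obtain C where C: "\<not> affine_dependent C" "int (card C) = n + 1" "S = convex hull C"
      using S by (auto simp: simplex_def)
    have "card (f ` C) = card C" using GL_int_inj[OF f] by (simp add: card_image inj_on_subset)
    then show ?thesis
      unfolding simplex_def using C GL_int_affine_independent[OF f C(1)]
        convex_hull_linear_image[OF GL_int_linear[OF f]] by (intro exI[of _ "f ` C"]) simp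
  qed
  obtain g where g: "g \<in> GL_int" "\<forall>x. g (f x) = x"
    using GL_int_inverse[OF f] by blast
  have "g ` f ` S = S" using g(2) by (simp add: image_image)
  with *[OF f, of S] *[OF g(1), of "f ` S"] show ?thesis by auto
qed

lemma GL_int_den_simplex:
  assumes f: "f \<in> GL_int"
  shows "den_simplex (f ` T) = den_simplex T"
proof -
  have "{v. v extreme_point_of f ` T} = f ` {v. v extreme_point_of T}"
  proof -
    have *: "f v extreme_point_of f ` T \<longleftrightarrow> v extreme_point_of T" for v
      using face_of_linear_image[OF GL_int_linear[OF f] GL_int_inj[OF f], of "{v}" T]
      by (simp add: face_of_singleton)
    have sub: "{v. v extreme_point_of f ` T} \<subseteq> range f"
      by (auto simp: extreme_point_of_def)
    show ?thesis
    proof (intro equalityI subsetI)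
      fix x assume x: "x \<in> {v. v extreme_point_of f ` T}"
      then obtain v where "x = f v" using sub by blast
      with x * show "x \<in> f ` {v. v extreme_point_of T}" by blast
    qed (use * in blast)
  qed
  then show ?thesis
    unfolding den_simplex_def using GL_int_inj[OF f] GL_int_den[OF f]
    by (simp add: prod.reindex inj_on_subset)
qed

lemma GL_int_simplicial_complex:
  assumes f: "f \<in> GL_int" and \<Delta>: "simplicial_complex \<Delta>"
  shows "simplicial_complex ((`) f ` \<Delta>)"
  unfolding simplicial_complex_def
proof (intro conjI ballI allI impI)
  note lin = GL_int_linear[OF f] and inj = GL_int_inj[OF f]
  show "finite ((`) f ` \<Delta>)" using \<Delta> by (simp add: simplicial_complex_def)
  show "\<exists>n. n simplex S" if "S \<in> (`) f ` \<Delta>" for S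
    using that \<Delta> GL_int_simplex[OF f] by (auto simp: simplicial_complex_def)
  show "F \<in> (`) f ` \<Delta>" if *: "S \<in> (`) f ` \<Delta> \<and> F face_of S" for F S
  proof -
    obtain S' where S': "S' \<in> \<Delta>" "S = f ` S'" using * by blast
    obtain F' where F': "F = f ` F'"
      using subset_imageE[of F f S'] * S'(2) face_of_imp_subset[of F S] by metis
    have "F' face_of S'" using * S'(2) F' face_of_linear_image[OF lin inj, of F' S'] by simp
    then show ?thesis using \<Delta> S'(1) F' by (auto simp: simplicial_complex_def)
  qed
  show "S \<inter> S' face_of S" if *: "S \<in> (`) f ` \<Delta> \<and> S' \<in> (`) f ` \<Delta>" for S S'
  proof -
    obtain A B where A: "A \<in> \<Delta>" "S = f ` A" "B \<in> \<Delta>" "S' = f ` B" using * by blast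
    then have "A \<inter> B face_of A" using \<Delta> by (auto simp: simplicial_complex_def)
    then show ?thesis
      using A face_of_linear_image[OF lin inj, of "A \<inter> B" A] image_Int[OF inj, of A B] by simp
  qed
qed

lemma GL_int_triangulation_sum:
  assumes f: "f \<in> GL_int" and \<Delta>: "regular_triangulation \<Delta> R"
  shows "regular_triangulation ((`) f ` \<Delta>) (f ` R)"
    and "(\<Sum>T\<in>max_simplexes ((`) f ` \<Delta>) i. 1 / (fact i * real (den_simplex T)))
      = (\<Sum>T\<in>max_simplexes \<Delta> i. 1 / (fact i * real (den_simplex T)))"
proof -
  have inj: "inj ((`) f)" using GL_int_inj[OF f] by (simp add: inj_image_eq_iff inj_def)
  show "regular_triangulation ((`) f ` \<Delta>) (f ` R)"
    using \<Delta> GL_int_simplicial_complex[OF f] GL_int_regular_simplex[OF f]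
    by (auto simp: regular_triangulation_def)
  have "max_simplexes ((`) f ` \<Delta>) i = (`) f ` max_simplexes \<Delta> i"
  proof -
    have "f ` T \<in> max_simplexes ((`) f ` \<Delta>) i \<longleftrightarrow> T \<in> max_simplexes \<Delta> i" for T
      by (simp add: max_simplexes_def GL_int_simplex[OF f] inj_image_mem_iff[OF inj]
          inj_image_subset_iff[OF GL_int_inj[OF f]] inj_image_eq_iff[OF GL_int_inj[OF f]])
    moreover have "max_simplexes ((`) f ` \<Delta>) i \<subseteq> range ((`) f)" by (auto simp: max_simplexes_def)
    ultimately show ?thesis by blast
  qed
  then show "(\<Sum>T\<in>max_simplexes ((`) f ` \<Delta>) i. 1 / (fact i * real (den_simplex T)))
      = (\<Sum>T\<in>max_simplexes \<Delta> i. 1 / (fact i * real (den_simplex T)))"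
    by (simp add: sum.reindex[OF inj_on_subset[OF inj]] GL_int_den_simplex[OF f])
qed

text \<open>Triangulations of \<open>R\<close> and of its image correspond with equal sums, in both
  directions by the inverse map. Hence the predicates under the description coincide, whether or not
  they determine a value.\<close>

lemma GL_int_rational_measure:
  assumes f: "f \<in> GL_int"
  shows "rational_measure i (f ` R) = rational_measure i R"
proof -
  obtain g where g: "g \<in> GL_int" "\<forall>x. g (f x) = x"
    using GL_int_inverse[OF f] by blast
  have gf: "g ` f ` R = R" using g(2) by (simp add: image_image)
  have "(\<exists>\<Delta>. regular_triangulation \<Delta> (f ` R) \<and>
       r = (\<Sum>T\<in>max_simplexes \<Delta> i. 1 / (fact i * real (den_simplex T)))) \<longleftrightarrow>
     (\<exists>\<Delta>. regular_triangulation \<Delta> R \<and>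
       r = (\<Sum>T\<in>max_simplexes \<Delta> i. 1 / (fact i * real (den_simplex T))))" for r
    using GL_int_triangulation_sum[OF f] GL_int_triangulation_sum[OF g(1), of _ "f ` R", unfolded gf]
    by metis
  then show ?thesis unfolding rational_measure_def by simp
qed

lemma GL_int_min_den:
  assumes f: "f \<in> GL_int"
  shows "min_den (f ` F) = min_den F"
proof -
  have "(\<exists>v\<in>f ` F \<inter> rational_points. d = den v) \<longleftrightarrow> (\<exists>v\<in>F \<inter> rational_points. d = den v)" for d
    using GL_int_den[OF f] GL_int_rational_iff[OF f] by (metis (no_types, opaque_lifting) Int_iff image_iff)
  then show ?thesis unfolding min_den_def by simp
qed

lemma GL_int_parallelotope:
  assumes f: "f \<in> GL_int"
  shows "parallelotope e (f \<circ> v) = f ` parallelotope e v"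
proof -
  have "f (\<Sum>i\<le>e. \<alpha> i *\<^sub>R v i) = (\<Sum>i\<le>e. \<alpha> i *\<^sub>R f (v i))" for \<alpha>
    by (simp add: linear_sum[OF GL_int_linear[OF f]] linear_cmul[OF GL_int_linear[OF f]])
  then show ?thesis by (simp add: parallelotope_def setcompr_eq_image image_image)
qed

definition admissible :: "(real^'n) set \<Rightarrow> nat \<Rightarrow> (nat \<Rightarrow> real^'n) \<Rightarrow> bool" where
  "admissible F e v \<longleftrightarrow> (\<forall>i\<le>e. v i \<in> F \<inter> rational_points \<and> den (v i) = min_den F) \<and>
    int e simplex (convex hull (v ` {..e})) \<and> regular_simplex (convex hull (v ` {..e}))"

lemma affine_invariant_alt:
  "affine_invariant F = (THE r. \<exists>v. admissible F (nat (aff_dim F)) v \<and>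
     r = rational_measure (nat (aff_dim F) + 1) (parallelotope (nat (aff_dim F)) v))"
  unfolding affine_invariant_def admissible_def Let_def by simp

lemma GL_int_admissible:
  assumes f: "f \<in> GL_int" and v: "admissible F e v"
  shows "admissible (f ` F) e (f \<circ> v)"
proof -
  have "convex hull ((f \<circ> v) ` {..e}) = f ` (convex hull (v ` {..e}))"
    by (simp add: convex_hull_linear_image[OF GL_int_linear[OF f]] image_image)
  then show ?thesis
    using v GL_int_den[OF f] GL_int_rational_iff[OF f] GL_int_min_den[OF f]
      GL_int_simplex[OF f] GL_int_regular_simplex[OF f]
    by (simp add: admissible_def)
qed

text \<open>As for \<open>rational_measure\<close>, the predicates under the description agree, by
  transporting admissible points forth and back.\<close>

lemma GL_int_affine_invariant:
  fixes F :: "(real^'n) set"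
  assumes f: "f \<in> GL_int"
  shows "affine_invariant (f ` F) = affine_invariant F"
proof -
  obtain g where g: "g \<in> GL_int" "\<forall>x. g (f x) = x"
    using GL_int_inverse[OF f] by blast
  have gf: "g ` f ` F = F" using g(2) by (simp add: image_image)
  have dim: "aff_dim (f ` F) = aff_dim F"
    using GL_int_linear[OF f] GL_int_inj[OF f] by simp
  let ?P = "\<lambda>F e r. \<exists>v. admissible F e v \<and> r = rational_measure (e + 1) (parallelotope e v)"
  have *: "?P (h ` F) e r" if h: "h \<in> GL_int" and P: "?P F e r" for h :: "real^'n \<Rightarrow> real^'n" and F e r
  proof -
    obtain v where "admissible F e v" "r = rational_measure (e + 1) (parallelotope e v)"
      using P by blast
    then show ?thesis
      using GL_int_admissible[OF h] GL_int_parallelotope[OF h, of e v]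
        GL_int_rational_measure[OF h] by (intro exI[of _ "h \<circ> v"]) simp
  qed
  have "?P (f ` F) e r \<longleftrightarrow> ?P F e r" for e r
    using *[OF f, of F e r] *[OF g(1), of "f ` F" e r] unfolding gf by blast
  then show ?thesis unfolding affine_invariant_alt dim by simp
qed

section \<open>Normal form of a rational affine subspace\<close>

lemma rational_points_diff: "x \<in> rational_points \<Longrightarrow> y \<in> rational_points \<Longrightarrow> x - y \<in> rational_points"
  and rational_points_scaleR: "c \<in> \<rat> \<Longrightarrow> x \<in> rational_points \<Longrightarrow> c *\<^sub>R x \<in> rational_points"
  and rational_points_inner: "x \<in> rational_points \<Longrightarrow> y \<in> rational_points \<Longrightarrow> x \<bullet> y \<in> \<rat>"
  by (auto simp: rational_points_def inner_vec_def intro!: Rats_sum Rats_diff Rats_mult)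

text \<open>Gram-Schmidt without normalisation uses only field operations, so it stays inside the
  rational vectors.\<close>

lemma rational_orthogonal_spanning_set:
  fixes C :: "(real^'m) set"
  assumes "finite C" "C \<subseteq> rational_points"
  shows "\<exists>D. finite D \<and> D \<subseteq> rational_points \<and> pairwise orthogonal D \<and> span D = span C"
  using assms
proof (induction C rule: finite_induct)
  case empty
  then show ?case by (intro exI[of _ "{}"]) auto
next
  case (insert a C)
  then obtain D where D: "finite D" "D \<subseteq> rational_points" "pairwise orthogonal D" "span D = span C"
    by auto
  \<comment> \<open>If \<open>a\<close> already lies in the span of \<open>D\<close>, then
    \<open>a - s\<close> is 0; such zero vectors in \<open>D\<close> do no harm, since division by
    \<open>b \<bullet> b = 0\<close> yields 0.\<close>
  define s where "s = (\<Sum>b\<in>D. (b \<bullet> a / (b \<bullet> b)) *\<^sub>R b)"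
  have s: "s \<in> span D" unfolding s_def by (intro span_sum span_scale span_base)
  have aR: "a \<in> rational_points" using insert.prems by simp
  have "s \<in> rational_points"
    unfolding s_def using D(2) aR
    by (intro rational_points_sum rational_points_scaleR Rats_divide rational_points_inner) auto
  then have 1: "insert (a - s) D \<subseteq> rational_points"
    using D(2) rational_points_diff[OF aR] by simp
  have "orthogonal x (a - s)" if "x \<in> span D" for x
    unfolding s_def using that by (rule Gram_Schmidt_step[OF D(3)])
  then have 2: "pairwise orthogonal (insert (a - s) D)"
    using D(3) by (auto simp: pairwise_insert orthogonal_commute span_base)
  have "span (insert (a - s) D) = span (insert a D)"
    using s by (intro eq_span_insert_eq) (simp add: span_neg)
  also have "\<dots> = span (insert a C)"
    using D(4) by (simp add: span_insert)
  finally show ?case using 1 2 D(1) by (intro exI[of _ "insert (a - s) D"]) simp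
qed

text \<open>The orthogonal projection onto the complement is rational, so the images of the unit
  vectors, cleared of denominators, span it. A maximal independent subset replaces the possibly
  infinite \<open>N\<close>.\<close>

lemma orthogonal_complement_rational:
  fixes N :: "(real^'m) set"
  assumes N: "N \<subseteq> rational_points"
  shows "\<exists>A. A \<subseteq> int_vecs \<and> span A = {z. \<forall>x\<in>N. x \<bullet> z = 0}"
proof -
  obtain C where C: "C \<subseteq> N" "independent C" "N \<subseteq> span C"
    by (rule maximal_independent_subset)
  have finC: "finite C" using C(2) by (rule independent_imp_finite)
  obtain D where D: "finite D" "D \<subseteq> rational_points" "pairwise orthogonal D" "span D = span C"
    using rational_orthogonal_spanning_set[OF finC] C(1) N by blast
  define proj where "proj z = z - (\<Sum>b\<in>D. (b \<bullet> z / (b \<bullet> b)) *\<^sub>R b)" for z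
  have lin: "linear proj"
    unfolding proj_def
    by (rule linearI) (simp_all add: inner_add_right add_divide_distrib scaleR_add_left sum.distrib
        scaleR_right.sum algebra_simps)
  have ND: "N \<subseteq> span D" using C(3) D(4) by simp
  have orth: "x \<bullet> proj z = 0" if "x \<in> span D" for x z
    using Gram_Schmidt_step[OF D(3) that, of z] by (simp add: proj_def orthogonal_def)
  have fixed: "proj z = z" if z: "\<forall>x\<in>N. x \<bullet> z = 0" for z
  proof -
    have "b \<bullet> z = 0" if "b \<in> D" for b
    proof -
      have "b \<in> span C" using that D(4) span_base by blast
      then show ?thesis
      proof (induction rule: span_induct)
        case base
        show "subspace {b. b \<bullet> z = 0}" by (simp add: subspace_def inner_add_left)
      qed (use z C(1) in blast)
    qed
    then show ?thesis by (simp add: proj_def)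
  qed
  have rat: "proj (axis i 1) \<in> rational_points" for i
    unfolding proj_def using D(2)
    by (intro rational_points_diff rational_points_sum rational_points_scaleR Rats_divide
        rational_points_inner) (auto simp: rational_points_def axis_def)
  then have "\<exists>d>0. real d *\<^sub>R proj (axis i 1) \<in> int_vecs" for i
    by (rule rational_common_denominator)
  then obtain d where d: "\<And>i. d i > (0::nat)" "\<And>i. real (d i) *\<^sub>R proj (axis i 1) \<in> int_vecs"
    by metis
  define A where "A = range (\<lambda>i. real (d i) *\<^sub>R proj (axis i 1))"
  have "span A = {z. \<forall>x\<in>N. x \<bullet> z = 0}"
  proof (intro equalityI subsetI)
    fix z assume "z \<in> span A"
    then show "z \<in> {z. \<forall>x\<in>N. x \<bullet> z = 0}"
    proof (induction rule: span_induct)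
      case base
      show "subspace {z. z \<in> {z. \<forall>x\<in>N. x \<bullet> z = 0}}" by (simp add: subspace_def inner_add_right)
    next
      case (step x)
      then show ?case using orth ND by (auto simp: A_def)
    qed
  next
    fix z assume "z \<in> {z. \<forall>x\<in>N. x \<bullet> z = 0}"
    then have "z = proj z" using fixed by simp
    also have "\<dots> = proj (\<Sum>i\<in>UNIV. (z $ i) *\<^sub>R axis i 1)"
    proof -
      have "(\<Sum>i\<in>UNIV. (z $ i) *\<^sub>R axis i 1) = z"
        by (simp add: vec_eq_iff axis_def if_distrib cong: if_cong)
      then show ?thesis by simp
    qed
    also have "\<dots> = (\<Sum>i\<in>UNIV. (z $ i / real (d i)) *\<^sub>R (real (d i) *\<^sub>R proj (axis i 1)))"
      using d(1) by (simp add: linear_sum[OF lin] linear_cmul[OF lin] less_imp_neq[symmetric])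
    also have "\<dots> \<in> span A"
      by (intro span_sum span_scale span_base) (simp add: A_def)
    finally show "z \<in> span A" .
  qed
  moreover have "A \<subseteq> int_vecs" using d(2) by (auto simp: A_def)
  ultimately show ?thesis by blast
qed

lemma inner_hp: "\<nu> \<bullet> hp x = \<nu> $ None + (\<chi> i. \<nu> $ Some i) \<bullet> x"
  by (simp add: inner_vec_def UNIV_option_conv sum.reindex)

text \<open>The difficulty is to find a rational point. In homogeneous coordinates the equations
  become linear, and their solution space is spanned by integer vectors. It contains
  \<open>hp x0\<close>, of height 1, so some spanning vector has nonzero height; projecting it gives
  a rational point of \<open>F\<close>.\<close>

lemma rational_affine_subspace_decompose:
  fixes F :: "(real^'n) set"
  assumes F: "rational_affine_subspace F" "F \<noteq> {}"
  obtains p A where "p \<in> rational_points" "A \<subseteq> int_vecs" "F = (+) p ` span A"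
proof -
  obtain HH where HH: "\<forall>H\<in>HH. rational_hyperplane H" "F = \<Inter>HH"
    using F(1) by (auto simp: rational_affine_subspace_def)
  define N where "N = {\<nu> \<in> rational_points. \<forall>x\<in>F. \<nu> \<bullet> hp x = 0}"
  have Fiff: "x \<in> F \<longleftrightarrow> (\<forall>\<nu>\<in>N. \<nu> \<bullet> hp x = 0)" for x
  proof
    assume *: "\<forall>\<nu>\<in>N. \<nu> \<bullet> hp x = 0"
    have "x \<in> H" if H: "H \<in> HH" for H
    proof -
      obtain h r where h: "h \<in> rational_points" "r \<in> \<rat>" "H = {z. h \<bullet> z = r}"
        using HH(1) H unfolding rational_hyperplane_def by blast
      define \<nu> :: "real^('n option)" where "\<nu> = (\<chi> j. case j of None \<Rightarrow> - r | Some i \<Rightarrow> h $ i)"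
      have \<nu>: "\<nu> \<bullet> hp y = h \<bullet> y - r" for y by (simp add: inner_hp \<nu>_def)
      have "\<nu> \<in> rational_points"
        using h(1,2) by (auto simp: rational_points_def \<nu>_def split: option.split)
      moreover have "\<nu> \<bullet> hp y = 0" if "y \<in> F" for y
        using that HH(2) H h(3) by (auto simp: \<nu>)
      ultimately have "\<nu> \<in> N" by (simp add: N_def)
      with * have "\<nu> \<bullet> hp x = 0" by blast
      then show ?thesis unfolding \<nu> h(3) by simp
    qed
    then show "x \<in> F" using HH(2) by blast
  qed (simp add: N_def)
  have NR: "N \<subseteq> rational_points" by (auto simp: N_def)
  obtain B where B: "B \<subseteq> int_vecs" "span B = {z. \<forall>\<nu>\<in>N. \<nu> \<bullet> z = 0}"
    using orthogonal_complement_rational[OF NR] by metis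
  obtain x0 where x0: "x0 \<in> F" using F(2) by blast
  have "\<exists>b\<in>B. b $ None \<noteq> 0"
  proof (rule ccontr)
    assume "\<not> (\<exists>b\<in>B. b $ None \<noteq> 0)"
    then have b0: "b $ None = 0" if "b \<in> B" for b using that by blast
    have "hp x0 \<in> span B" using x0 by (simp add: Fiff B(2))
    then have "hp x0 $ None = 0"
    proof (induction rule: span_induct)
      case base
      show "subspace {z. z $ None = 0}" by (simp add: subspace_def)
    qed (rule b0)
    then show False by simp
  qed
  then obtain b where b: "b \<in> B" "b $ None \<noteq> 0" by blast
  define p where "p = dehom b"
  have pR: "p \<in> rational_points" unfolding p_def using b B(1) by (intro dehom_rational) auto
  have "b \<in> span B" using b(1) by (rule span_base)
  then have "hp p \<in> span B" unfolding p_def hp_dehom[OF b(2)] by (rule span_scale)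
  then have pF: "p \<in> F" by (simp add: Fiff B(2))
  \<comment> \<open>The linear parts of the equations; together they cut out the direction
    space.\<close>
  define N' where "N' = (\<lambda>\<nu>. \<chi> i. \<nu> $ Some i) ` N"
  have NR': "N' \<subseteq> rational_points" by (auto simp: N'_def N_def rational_points_def)
  obtain A where A: "A \<subseteq> int_vecs" "span A = {z. \<forall>\<nu>\<in>N'. \<nu> \<bullet> z = 0}"
    using orthogonal_complement_rational[OF NR'] by metis
  have "x \<in> F \<longleftrightarrow> x - p \<in> span A" for x
  proof -
    have "\<nu> \<bullet> hp x = (\<chi> i. \<nu> $ Some i) \<bullet> (x - p)" if "\<nu> \<in> N" for \<nu>
    proof -
      have "\<nu> \<bullet> hp p = 0" using pF that by (simp add: Fiff)
      then show ?thesis by (simp add: inner_hp inner_diff_right)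
    qed
    then show ?thesis unfolding Fiff A(2) N'_def by simp
  qed
  moreover have "x \<in> (+) p ` span A \<longleftrightarrow> x - p \<in> span A" for x
    by (auto intro: image_eqI[of _ _ "x - p"])
  ultimately have "F = (+) p ` span A" by blast
  with pR A(1) that show ?thesis by blast
qed

section \<open>Lattice coordinates adapted to a subspace\<close>

lemma unimodular_family:
  assumes u: "unimodular (\<phi> ` I)" and inj: "inj_on \<phi> I"
    and s: "(\<Sum>i\<in>I. y i *\<^sub>R \<phi> i) \<in> int_vecs" and i: "i \<in> I"
  shows "y i \<in> \<int>"
proof -
  define a where "a w = y (the_inv_into I \<phi> w)" for w
  have a: "a (\<phi> i) = y i" if "i \<in> I" for i using the_inv_into_f_f[OF inj that] by (simp add: a_def)
  have "(\<Sum>w\<in>\<phi> ` I. a w *\<^sub>R w) = (\<Sum>i\<in>I. y i *\<^sub>R \<phi> i)"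
    by (simp add: sum.reindex[OF inj] a)
  with s unimodularD[OF u, of a "\<phi> i"] i a show ?thesis by simp
qed

definition normal_form :: "'n set \<Rightarrow> 'n \<Rightarrow> real \<Rightarrow> (real^'n) set" where
  "normal_form J k q = {x. x $ k = q \<and> (\<forall>i. i \<notin> insert k J \<longrightarrow> x $ i = 0)}"

lemma bij_extension:
  fixes J :: "'n::finite set"
  assumes B: "finite B" "card B = CARD('n)" and S: "S \<subseteq> B" "card S = card J"
    and b: "b \<in> B" "b \<notin> S" and k: "k \<notin> J"
  obtains \<phi> where "bij_betw \<phi> UNIV B" "\<phi> ` J = S" "\<phi> k = b"
proof -
  have finS: "finite S" using S(1) B(1) finite_subset by blast
  obtain f where f: "bij_betw f J S"
    using finite_same_card_bij[of J S] finS S(2) by auto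
  have c: "card (UNIV - insert k J) = card (B - insert b S)"
    using S k b B finS by (simp add: card_Diff_subset)
  obtain g where g: "bij_betw g (UNIV - insert k J) (B - insert b S)"
    using finite_same_card_bij[OF _ _ c] B(1) by auto
  define \<phi> where "\<phi> i = (if i \<in> J then f i else if i = k then b else g i)" for i
  have 1: "bij_betw \<phi> J S" using f by (rule bij_betw_cong[THEN iffD1, rotated]) (simp add: \<phi>_def)
  have 2: "bij_betw \<phi> {k} {b}" using k by (simp add: \<phi>_def bij_betw_def)
  have 3: "bij_betw \<phi> (UNIV - insert k J) (B - insert b S)"
    using g by (rule bij_betw_cong[THEN iffD1, rotated]) (simp add: \<phi>_def)
  have 4: "bij_betw \<phi> (J \<union> {k}) (S \<union> {b})" using 1 2 b(2) by (intro bij_betw_combine) auto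
  have "bij_betw \<phi> ((J \<union> {k}) \<union> (UNIV - insert k J)) ((S \<union> {b}) \<union> (B - insert b S))"
    using 4 3 by (rule bij_betw_combine) auto
  moreover have "(J \<union> {k}) \<union> (UNIV - insert k J) = UNIV" "(S \<union> {b}) \<union> (B - insert b S) = B"
    using S(1) b(1) by auto
  ultimately show ?thesis using that 1 2 by (auto simp: bij_betw_def)
qed

lemma normal_form_exists:
  fixes F :: "(real^'n) set"
  assumes F: "rational_affine_subspace F" "F \<noteq> {}" and dim: "aff_dim F = int (card J)" and k: "k \<notin> J"
  obtains f q where "f \<in> GL_int" "q \<in> \<rat>" "0 \<le> q" "F = f ` normal_form J k q"
proof -
  obtain p A where p: "p \<in> rational_points" and A: "A \<subseteq> int_vecs" and FA: "F = (+) p ` span A"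
    using rational_affine_subspace_decompose[OF F] .
  obtain S where S: "unimodular S" "span S = span A"
    using unimodular_extend[OF unimodular_empty _ A] by auto
  have finS: "finite S" using S(1) by (rule unimodular_finite)
  have "aff_dim F = int (dim (span A))"
    unfolding FA by (simp add: aff_dim_translation_eq aff_dim_subspace)
  also have "dim (span A) = card S"
    using S unimodular_independent[OF S(1)] by (metis dim_span dim_eq_card_independent)
  finally have cardS: "card S = card J" using dim by simp
  have "card J < CARD('n)" using k by (intro psubset_card_mono) auto
  have "span S \<noteq> UNIV"
  proof
    assume "span S = UNIV"
    then have "dim (UNIV :: (real^'n) set) = card S"
      using dim_eq_card_independent[OF unimodular_independent[OF S(1)]] dim_span[of S] by metis
    with cardS \<open>card J < CARD('n)\<close> show False by simp
  qed
  then have "\<not> (int_vecs \<subseteq> span S)"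
    using span_int_vecs span_mono[of int_vecs "span S"] by (auto simp: span_span)
  then obtain z where z: "z \<in> int_vecs" "z \<notin> span S" by blast
  obtain D where D: "D > 0" "real D *\<^sub>R p \<in> int_vecs"
    using rational_common_denominator[OF p] by blast
  \<comment> \<open>If \<open>F\<close> passes through the origin, \<open>p\<close> gives no new
    direction; then any integer vector outside the direction space serves, and \<open>c\<close>
    comes out as 0.\<close>
  define x where "x = (if real D *\<^sub>R p \<in> span S then z else real D *\<^sub>R p)"
  have x: "x \<in> int_vecs" "x \<notin> span S" using z D by (auto simp: x_def)
  obtain b where b: "b \<notin> S" "unimodular (insert b S)" "span (insert b S) = span (insert x S)"
    using unimodular_insert[OF S(1) x] .
  have "real D *\<^sub>R p \<in> span (insert x S)"
  proof (cases "real D *\<^sub>R p \<in> span S")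
    case True
    then show ?thesis using span_mono[of S "insert x S"] by blast
  next
    case False
    then show ?thesis by (auto simp: x_def intro: span_base)
  qed
  then have "real D *\<^sub>R p \<in> span (insert b S)" using b(3) by simp
  then obtain c where c: "real D *\<^sub>R p - c *\<^sub>R b \<in> span S"
    by (auto simp: span_breakdown_eq)
  \<comment> \<open>An integer multiple of \<open>p\<close> is expanded in the unimodular set
    \<open>insert b S\<close>, so its coefficient at \<open>b\<close> is an integer.\<close>
  have cI: "c \<in> \<int>"
  proof -
    obtain a where a: "real D *\<^sub>R p - c *\<^sub>R b = (\<Sum>u\<in>S. a u *\<^sub>R u)"
      using c finS by (auto simp: span_finite)
    then have "(\<Sum>u\<in>insert b S. (if u = b then c else a u) *\<^sub>R u) = real D *\<^sub>R p"
      using b(1) finS by (auto simp: algebra_simps intro!: sum.cong)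
    then have "(\<Sum>u\<in>insert b S. (if u = b then c else a u) *\<^sub>R u) \<in> int_vecs" using D(2) by simp
    from unimodularD[OF b(2) this, of b] show ?thesis by simp
  qed
  obtain B where B: "insert b S \<subseteq> B" "unimodular B" "span B = UNIV"
    using unimodular_extend_UNIV[OF b(2)] by blast
  have finB: "finite B" using B(2) by (rule unimodular_finite)
  have cardB: "card B = CARD('n)"
    using dim_eq_card_independent[OF unimodular_independent[OF B(2)]] dim_span[of B] B(3)
    by (simp add: dim_UNIV)
  obtain \<phi> where \<phi>: "bij_betw \<phi> UNIV B" "\<phi> ` J = S" "\<phi> k = b"
    using bij_extension[OF finB cardB _ cardS _ b(1) k] B(1) by auto
  \<comment> \<open>Reversing axis \<open>k\<close> for negative \<open>c\<close> makes the constant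
    \<open>q\<close> nonnegative, and a sign does not affect integrality.\<close>
  define s :: "'n \<Rightarrow> real" where "s i = (if i = k \<and> c < 0 then -1 else 1)" for i
  have s: "s i \<in> \<int>" for i by (auto simp: s_def)
  define f where "f y = (\<Sum>i\<in>UNIV. (s i * y $ i) *\<^sub>R \<phi> i)" for y :: "real^'n"
  have \<phi>B: "\<phi> ` UNIV = B" "inj \<phi>" using \<phi>(1) by (auto simp: bij_betw_def)
  have f: "f \<in> GL_int"
    unfolding GL_int_iff
  proof (intro conjI allI iffI)
    show "linear f"
      unfolding f_def by (rule linearI) (simp_all add: algebra_simps sum.distrib scaleR_right.sum)
    fix y
    show "y \<in> int_vecs" if "f y \<in> int_vecs"
    proof -
      have "y $ i \<in> \<int>" for i
      proof -
        have "s i * y $ i \<in> \<int>"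
          using unimodular_family[of \<phi> UNIV "\<lambda>i. s i * y $ i" i] \<phi>B B(2) that by (simp add: f_def)
        then show ?thesis by (simp add: s_def minus_in_Ints_iff split: if_splits)
      qed
      then show ?thesis by (simp add: int_vecs_def)
    qed
    have "\<phi> i \<in> int_vecs" for i using unimodular_int_vecs[OF B(2)] \<phi>B(1) by blast
    then show "f y \<in> int_vecs" if "y \<in> int_vecs"
      unfolding f_def using that s
      by (intro int_vecs_sum int_vecs_scaleR Ints_mult) (simp_all add: int_vecs_def)
  qed
  define q where "q = \<bar>c\<bar> / real D"
  have q: "q \<in> \<rat>" "0 \<le> q"
    using cI Ints_subset_Rats by (auto simp: q_def intro!: Rats_divide)
  have finJ: "finite J" by simp
  have fN: "f y = (c / real D) *\<^sub>R b + (\<Sum>i\<in>J. (y $ i) *\<^sub>R \<phi> i)" if y: "y \<in> normal_form J k q" for y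
  proof -
    have "f y = (\<Sum>i\<in>insert k J. (s i * y $ i) *\<^sub>R \<phi> i)"
      unfolding f_def using y by (intro sum.mono_neutral_right) (auto simp: normal_form_def)
    also have "\<dots> = (s k * y $ k) *\<^sub>R b + (\<Sum>i\<in>J. (y $ i) *\<^sub>R \<phi> i)"
      using k \<phi>(3) by (auto simp: s_def intro!: sum.cong)
    also have "s k * y $ k = c / real D" using y by (auto simp: normal_form_def s_def q_def)
    finally show ?thesis .
  qed
  have pS: "p - (c / real D) *\<^sub>R b \<in> span S"
    using span_scale[OF c, of "1 / real D"] D(1) by (simp add: algebra_simps)
  have \<phi>J: "(\<Sum>i\<in>J. t i *\<^sub>R \<phi> i) \<in> span S" for t
    using \<phi>(2) by (intro span_sum span_scale span_base) auto
  have "F = f ` normal_form J k q"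
  proof (intro equalityI subsetI)
    fix x assume "x \<in> F"
    then obtain w where w: "w \<in> span S" "x = p + w" using FA S(2) by auto
    have "(p - (c / real D) *\<^sub>R b) + w \<in> span S" using pS w(1) by (rule span_add)
    then obtain a where a: "(p - (c / real D) *\<^sub>R b) + w = (\<Sum>u\<in>S. a u *\<^sub>R u)"
      using finS by (auto simp: span_finite)
    define y where "y = (\<chi> i. if i = k then q else if i \<in> J then a (\<phi> i) else 0)"
    have yN: "y \<in> normal_form J k q" by (auto simp: y_def normal_form_def)
    have "(\<Sum>i\<in>J. (y $ i) *\<^sub>R \<phi> i) = (\<Sum>i\<in>J. a (\<phi> i) *\<^sub>R \<phi> i)"
      using k by (intro sum.cong) (auto simp: y_def)
    also have "\<dots> = (\<Sum>u\<in>S. a u *\<^sub>R u)"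
      using \<phi>B(2) unfolding \<phi>(2)[symmetric] by (subst sum.reindex) (auto intro: inj_on_subset)
    finally have "f y = x" using fN[OF yN] a w(2) by (simp add: algebra_simps)
    with yN show "x \<in> f ` normal_form J k q" by blast
  next
    fix x assume "x \<in> f ` normal_form J k q"
    then obtain y where y: "y \<in> normal_form J k q" "x = f y" by blast
    have "x - p = (\<Sum>i\<in>J. (y $ i) *\<^sub>R \<phi> i) - (p - (c / real D) *\<^sub>R b)"
      using y fN by (simp add: algebra_simps)
    also have "\<dots> \<in> span S" using \<phi>J pS by (rule span_diff)
    finally have "x - p \<in> span A" using S(2) by simp
    then show "x \<in> F" unfolding FA by (intro image_eqI[of _ _ "x - p"]) auto
  qed
  with f q that show ?thesis by blast
qed

section \<open>Lebesgue measure of linear images\<close>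

text \<open>\<open>measure_shear_interval\<close> treats boxes with \<open>0 \<le> a $ n\<close>.
  Translating along axis \<open>n\<close> by \<open>- a $ n\<close> reaches this case, and by
  linearity the shear turns the translation into another one.\<close>

lemma measure_shear_cbox:
  fixes a b :: "real^'m"
  assumes mn: "m \<noteq> n"
  shows "measure lebesgue ((\<lambda>x. \<chi> i. if i = m then x $ m + x $ n else x $ i) ` cbox a b) = measure lebesgue (cbox a b)"
proof (cases "cbox a b = {}")
  case False
  let ?h = "\<lambda>x :: real^'m. \<chi> i. if i = m then x $ m + x $ n else x $ i"
  define t :: "real^'m" where "t = axis n (- a $ n)"
  have box: "cbox a b = (+) (- t) ` cbox (t + a) (t + b)"
    using cbox_translation[of "- t" "t + a" "t + b"] by simp
  have h: "?h (- t + x) = ?h (- t) + ?h x" for x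
    by (simp add: vec_eq_iff)
  have "measure lebesgue (?h ` cbox a b) = measure lebesgue ((+) (?h (- t)) ` ?h ` cbox (t + a) (t + b))"
    unfolding box image_image h ..
  also have "\<dots> = measure lebesgue (?h ` cbox (t + a) (t + b))" by (rule measure_translation)
  also have "\<dots> = measure lebesgue (cbox (t + a) (t + b))"
  proof (rule measure_shear_interval[OF mn])
    show "cbox (t + a) (t + b) \<noteq> {}" using False by (simp add: cbox_translation)
    show "0 \<le> (t + a) $ n" by (simp add: t_def)
  qed
  also have "\<dots> = measure lebesgue (cbox a b)" unfolding cbox_translation by (rule measure_translation)
  finally show ?thesis .
qed simp

lemma measure_swap_cbox:
  fixes a b :: "real^'m"
  shows "measure lebesgue ((\<lambda>x. \<chi> i. x $ Transposition.transpose m n i) ` cbox a b) = measure lebesgue (cbox a b)"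
proof (cases "cbox a b = {}")
  case False
  let ?h = "\<lambda>x :: real^'m. \<chi> i. x $ Transposition.transpose m n i"
  have "?h ` cbox a b = cbox (?h a) (?h b)"
  proof (intro equalityI subsetI)
    fix x assume "x \<in> cbox (?h a) (?h b)"
    then have "?h x \<in> cbox a b"
      by (simp add: mem_box_cart) (metis transpose_involutory)
    moreover have "x = ?h (?h x)" by (simp add: vec_eq_iff)
    ultimately show "x \<in> ?h ` cbox a b" by blast
  qed (auto simp: mem_box_cart)
  moreover have "(\<Prod>i\<in>UNIV. ?h b $ i - ?h a $ i) = (\<Prod>i\<in>UNIV. b $ i - a $ i)"
    using prod.permute[OF permutes_swap_id[of m UNIV n], of "\<lambda>i. b $ i - a $ i"] by (simp add: o_def)
  moreover have "cbox (?h a) (?h b) \<noteq> {}" using False calculation(1) by (metis image_is_empty)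
  ultimately show ?thesis using False by (simp add: content_cbox_cart)
qed simp

text \<open>The library proves this only for a well-ordered index type.\<close>

lemma linear_image_lmeasurable:
  fixes f :: "real^'m \<Rightarrow> real^'m"
  assumes "linear f" "S \<in> lmeasurable"
  shows "f ` S \<in> lmeasurable \<and> measure lebesgue (f ` S) = \<bar>det (matrix f)\<bar> * measure lebesgue S"
proof -
  define P where "P f \<longleftrightarrow> (\<forall>S\<in>lmeasurable. f ` S \<in> lmeasurable \<and>
    measure lebesgue (f ` S) = \<bar>det (matrix f)\<bar> * measure lebesgue S)" for f :: "real^'m \<Rightarrow> real^'m"
  \<comment> \<open>Maps of determinant 1 or -1 need only be checked on boxes; this serves for swaps
    and shears.\<close>
  have boxes: "P f" if "linear f" "\<bar>det (matrix f)\<bar> = 1"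
    "\<And>a b. measure lebesgue (f ` cbox a b) = measure lebesgue (cbox a b)" for f
    unfolding P_def
  proof
    fix S :: "(real^'m) set" assume "S \<in> lmeasurable"
    from measure_linear_sufficient[OF that(1) this, of 1] that(2,3)
    show "f ` S \<in> lmeasurable \<and> measure lebesgue (f ` S) = \<bar>det (matrix f)\<bar> * measure lebesgue S"
      by simp
  qed
  have "P f"
  proof (rule induct_linear_elementary[OF assms(1)])
    fix f g :: "real^'m \<Rightarrow> real^'m" assume "linear f" "linear g" "P f" "P g"
    then show "P (f \<circ> g)"
      unfolding P_def image_comp[symmetric] by (simp add: matrix_compose det_mul abs_mult)
  next
    fix f :: "real^'m \<Rightarrow> real^'m" and i
    assume f: "linear f" "\<And>x. f x $ i = 0"
    have "\<not> surj f"
    proof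
      assume "surj f"
      then obtain x where "f x = axis i 1" by (metis surjD)
      with f(2)[of x] show False by simp
    qed
    then have ni: "\<not> inj f" using linear_injective_imp_surjective[OF f(1)] by blast
    then have "det (matrix f) = 0" using det_nz_iff_inj[OF f(1)] by blast
    then show "P f"
      unfolding P_def using negligible_linear_singular_image[OF f(1) ni]
      by (simp add: negligible_imp_measurable negligible_imp_measure0)
  next
    fix c :: "'m \<Rightarrow> real"
    have "det (matrix (\<lambda>x. \<chi> i. c i * x $ i)) = prod c UNIV"
      by (subst det_diagonal) (auto simp: matrix_def axis_def)
    then show "P (\<lambda>x. \<chi> i. c i * x $ i)"
      by (simp add: P_def measurable_stretch measure_stretch)
  next
    fix m n :: 'm assume "m \<noteq> n"
    let ?h = "\<lambda>x :: real^'m. \<chi> i. x $ Transposition.transpose m n i"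
    show "P ?h"
    proof (rule boxes)
      show "linear ?h" by (rule linearI) (simp_all add: vec_eq_iff)
      have "matrix ?h = (\<chi> i. mat 1 $ Transposition.transpose m n i)"
        by (auto simp: matrix_def mat_def axis_def vec_eq_iff)
      then show "\<bar>det (matrix ?h)\<bar> = 1"
        by (simp add: det_permute_rows permutes_swap_id sign_swap_id abs_mult)
    qed (rule measure_swap_cbox)
  next
    fix m n :: 'm assume mn: "m \<noteq> n"
    let ?h = "\<lambda>x :: real^'m. \<chi> i. if i = m then x $ m + x $ n else x $ i"
    show "P ?h"
    proof (rule boxes)
      show "linear ?h" by (rule linearI) (simp_all add: vec_eq_iff algebra_simps)
      have "matrix ?h = (\<chi> k. if k = m then row m (mat 1) + 1 *s row n (mat 1) else row k (mat 1))"
        by (auto simp: matrix_def mat_def axis_def vec_eq_iff row_def)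
      then show "\<bar>det (matrix ?h)\<bar> = 1" by (simp only: det_row_operation[OF mn] det_I abs_one)
    qed (rule measure_shear_cbox[OF mn])
  qed
  with assms(2) show ?thesis by (simp add: P_def)
qed

section \<open>Determinants of families of vectors\<close>

definition famap :: "('m \<Rightarrow> real^'m) \<Rightarrow> real^'m \<Rightarrow> real^'m" where
  "famap h y = (\<Sum>i\<in>UNIV. (y $ i) *\<^sub>R h i)"

lemma linear_famap: "linear (famap h)"
  unfolding famap_def by (rule linearI) (simp_all add: algebra_simps sum.distrib scaleR_right.sum)

lemma famap_axis: "famap h (axis i 1) = h i"
proof -
  have "famap h (axis i 1) = (\<Sum>j\<in>UNIV. if j = i then h i else 0)"
    unfolding famap_def by (intro sum.cong) (auto simp: axis_def)
  then show ?thesis by simp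
qed

lemma det_matrix_famap: "det (matrix (famap h)) = det (\<chi> i. h i)"
proof -
  have "matrix (famap h) = transpose (\<chi> i. h i)"
    by (simp add: matrix_def famap_axis transpose_def)
  then show ?thesis by (simp add: det_transpose)
qed

lemma measure_famap:
  assumes "S \<in> lmeasurable"
  shows "famap h ` S \<in> lmeasurable"
    and "measure lebesgue (famap h ` S) = \<bar>det (\<chi> i. h i)\<bar> * measure lebesgue S"
  using linear_image_lmeasurable[OF linear_famap assms, of h] by (simp_all add: det_matrix_famap)

lemma famap_GL_int:
  assumes "\<And>i. h i \<in> int_vecs" "\<And>y i. famap h y \<in> int_vecs \<Longrightarrow> y $ i \<in> \<int>"
  shows "famap h \<in> GL_int" and "\<bar>det (\<chi> i. h i)\<bar> = 1"
proof -
  have "famap h y \<in> int_vecs" if "y \<in> int_vecs" for y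
    unfolding famap_def using that assms(1) by (intro int_vecs_sum int_vecs_scaleR) (auto simp: int_vecs_def)
  moreover have "y \<in> int_vecs" if "famap h y \<in> int_vecs" for y
    using assms(2)[OF that] by (simp add: int_vecs_def)
  ultimately show f: "famap h \<in> GL_int"
    unfolding GL_int_iff using linear_famap by blast
  then obtain U where "famap h = (*v) U" "det U = 1 \<or> det U = -1"
    by (auto simp: GL_int_def)
  then have "\<bar>det (matrix (famap h))\<bar> = 1" by auto
  then show "\<bar>det (\<chi> i. h i)\<bar> = 1" by (simp only: det_matrix_famap)
qed

lemma det_scale_rows: "det (\<chi> i. r i *\<^sub>R h i) = prod r UNIV * det (\<chi> i. h i)" for h :: "'m \<Rightarrow> real^'m"
  using det_rows_mul[of r h] by (simp add: scalar_mult_eq_scaleR)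

lemma det_replace_row:
  fixes h :: "'m \<Rightarrow> real^'m"
  shows "det (\<chi> i. if i = k then famap h y else h i) = y $ k * det (\<chi> i. h i)"
proof -
  have row: "row i (\<chi> i. h i) = h i" for i by (simp add: row_def vec_eq_iff)
  have eq: "(\<Sum>i\<in>UNIV. y $ i *s h i) = famap h y"
    by (simp add: famap_def scalar_mult_eq_scaleR)
  show ?thesis
    using cramer_lemma_transpose[of k y "\<chi> i. h i"] unfolding row eq .
qed

section \<open>Volumes of prisms\<close>

text \<open>Serves both as the set of homogeneous coordinates of the subspace with coordinates
  \<open>I\<close> and as index set for the \<open>card I + 1\<close> vertices of a simplex of top
  dimension in it.\<close>

abbreviation ext :: "'n set \<Rightarrow> 'n option set" where
  "ext I \<equiv> insert None (Some ` I)"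

text \<open>For a set \<open>A\<close> in the coordinate subspace of \<open>I\<close>, this is the cone over \<open>A\<close> at height 1, cut off
  at height at most 1, times the unit cube in the remaining coordinates; it is full-dimensional
  even though \<open>A\<close> is not, so that Lebesgue measure can be used to compare volumes.\<close>

definition prism :: "'n set \<Rightarrow> (real^'n) set \<Rightarrow> (real^('n option)) set" where
  "prism I A = {z. \<exists>x\<in>A. 0 \<le> z $ None \<and> z $ None \<le> 1 \<and> (\<forall>i\<in>I. z $ Some i = z $ None * x $ i) \<and>
    (\<forall>i. i \<notin> I \<longrightarrow> 0 \<le> z $ Some i \<and> z $ Some i \<le> 1)}"

text \<open>Simplexes (\<open>b = True\<close>) and parallelotopes (\<open>b = False\<close>) both consist of affine combinations
  \<open>\<Sum>j\<in>ext I. t j * g j\<close> with coefficients in \<open>[0, 1]\<close>; for a parallelotope, \<open>g None = 0\<close> and the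
  coefficient of \<^const>\<open>None\<close> is only constrained by the sum.\<close>

definition std_base :: "'n::finite set \<Rightarrow> bool \<Rightarrow> (real^('n option)) set" where
  "std_base I b = {t. (\<forall>j. j \<noteq> None \<or> b \<longrightarrow> 0 \<le> t $ j \<and> t $ j \<le> 1) \<and> (\<Sum>j\<in>ext I. t $ j) = 1}"

text \<open>The model of which the prisms below are linear images: \<open>s\<close> is the height,
  \<open>t\<close> holds the affine coefficients. Entries of \<open>t\<close> outside
  \<open>ext I\<close> do not enter the sum and provide the unit cube.\<close>

definition std_prism :: "'n::finite set \<Rightarrow> bool \<Rightarrow> (real^('n option)) set" where
  "std_prism I b = (\<lambda>(s, t). \<chi> j. if j \<in> ext I then s * t $ j else t $ j) ` ({0..1} \<times> std_base I b)"

lemma famap_split: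
  assumes "\<And>j. j \<notin> S \<Longrightarrow> h j = axis j 1" "\<And>j l. j \<in> S \<Longrightarrow> l \<notin> S \<Longrightarrow> h j $ l = 0"
  shows "famap h y $ l = (if l \<in> S then \<Sum>j\<in>S. y $ j * h j $ l else y $ l)"
proof -
  have "famap h y $ l = (\<Sum>j\<in>S. y $ j * h j $ l) + (\<Sum>j\<in>-S. y $ j * h j $ l)"
    using sum.subset_diff[of S UNIV "\<lambda>j. y $ j * h j $ l"] by (simp add: famap_def Compl_eq_Diff_UNIV)
  also have "(\<Sum>j\<in>-S. y $ j * h j $ l) = (\<Sum>j\<in>-S. if j = l then y $ l else 0)"
    using assms(1) by (intro sum.cong) (auto simp: axis_def)
  also have "(\<Sum>j\<in>S. y $ j * h j $ l) = 0" if "l \<notin> S"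
    using that assms(2) by (intro sum.neutral) auto
  ultimately show ?thesis by auto
qed

lemma hp_outside:
  assumes "\<And>i. i \<notin> I \<Longrightarrow> x $ i = 0" "l \<notin> ext I"
  shows "hp x $ l = 0" "rhom x $ l = 0"
proof -
  obtain i where "l = Some i" "i \<notin> I" using assms(2) by (cases l) auto
  then show "hp x $ l = 0" "rhom x $ l = 0" using assms(1) by simp_all
qed

text \<open>An affine combination of the \<open>g j\<close>, taken at height \<open>s\<close>, is a
  linear combination of the \<open>hp (g j)\<close> with coefficients \<open>s * t $ j\<close>. So
  the volume of a prism is that of the model times a determinant, and the volume of the model need
  not be computed.\<close>

lemma prism_affine_combinations:
  fixes g :: "'n option \<Rightarrow> real^'n"
  assumes g: "\<And>j i. j \<in> ext I \<Longrightarrow> i \<notin> I \<Longrightarrow> g j $ i = 0"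
  defines "h \<equiv> \<lambda>j. if j \<in> ext I then hp (g j) else axis j 1"
  shows "prism I {\<Sum>j\<in>ext I. t $ j *\<^sub>R g j | t. t \<in> std_base I b} = famap h ` std_prism I b"
proof -
  have fam: "famap h y $ l = (if l \<in> ext I then \<Sum>j\<in>ext I. y $ j * h j $ l else y $ l)" for y l
  proof (rule famap_split)
    show "h j = axis j 1" if "j \<notin> ext I" for j unfolding h_def using that by (rule if_not_P)
    show "h j $ l = 0" if "j \<in> ext I" "l \<notin> ext I" for j l
    proof -
      have "hp (g j) $ l = 0" by (rule hp_outside(1)[OF _ that(2)]) (rule g[OF that(1)])
      then show ?thesis using that(1) by (simp only: h_def if_True)
    qed
  qed
  define E where "E s t = (\<chi> j. if j \<in> ext I then s * t $ j else t $ j)" for s and t :: "real^('n option)"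
  have E: "famap h (E s t) $ l = (if l \<in> ext I then s * (\<Sum>j\<in>ext I. t $ j * hp (g j) $ l) else t $ l)" for s t l
  proof (cases "l \<in> ext I")
    case True
    have "famap h (E s t) $ l = (\<Sum>j\<in>ext I. s * (t $ j * hp (g j) $ l))"
      unfolding fam if_P[OF True] by (intro sum.cong refl) (simp add: E_def h_def del: insert_iff)
    then show ?thesis unfolding if_P[OF True] sum_distrib_left .
  next
    case False
    then show ?thesis unfolding fam by (simp add: E_def del: insert_iff)
  qed
  have N: "famap h (E s t) $ None = s" if "t \<in> std_base I b" for s t
    using that unfolding E by (simp add: std_base_def del: sum.insert)
  have S: "famap h (E s t) $ Some i = (if i \<in> I then s * (\<Sum>j\<in>ext I. t $ j *\<^sub>R g j) $ i else t $ Some i)" for s t i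
    unfolding E sum_component by (auto simp del: sum.insert)
  have img: "famap h ` std_prism I b = {famap h (E s t) | s t. 0 \<le> s \<and> s \<le> 1 \<and> t \<in> std_base I b}"
  proof -
    have "std_prism I b = (\<lambda>(s, t). E s t) ` ({0..1} \<times> std_base I b)" by (simp only: std_prism_def E_def)
    then have "famap h ` std_prism I b = (\<lambda>(s, t). famap h (E s t)) ` ({0..1} \<times> std_base I b)"
      by (simp add: image_image case_prod_beta)
    then show ?thesis by (auto simp: image_iff) blast
  qed
  show ?thesis
    unfolding img
  proof (intro equalityI subsetI)
    fix z assume "z \<in> prism I {\<Sum>j\<in>ext I. t $ j *\<^sub>R g j | t. t \<in> std_base I b}"
    then obtain t where t: "t \<in> std_base I b" and z: "0 \<le> z $ None" "z $ None \<le> 1"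
      "\<And>i. i \<in> I \<Longrightarrow> z $ Some i = z $ None * (\<Sum>j\<in>ext I. t $ j *\<^sub>R g j) $ i"
      "\<And>i. i \<notin> I \<Longrightarrow> 0 \<le> z $ Some i \<and> z $ Some i \<le> 1"
      unfolding prism_def by blast
    \<comment> \<open>Entries in \<open>ext I\<close> are the coefficients of the base point; the
      free coordinates of \<open>z\<close> are stored in the others.\<close>
    define t' where "t' = (\<chi> j. if j \<in> ext I then t $ j else z $ j)"
    have t'I: "t' $ j = t $ j" if "j \<in> ext I" for j using that by (simp add: t'_def del: insert_iff)
    have t'O: "t' $ Some i = z $ Some i" if "i \<notin> I" for i using that by (auto simp: t'_def)
    have "0 \<le> t' $ j \<and> t' $ j \<le> 1" if "j \<noteq> None \<or> b" for j
    proof (cases "j \<in> ext I")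
      case True
      show ?thesis unfolding t'I[OF True] using t that unfolding std_base_def by blast
    next
      case False
      then obtain i where "j = Some i" "i \<notin> I" by (cases j) auto
      then show ?thesis using z(4) t'O by simp
    qed
    moreover have "(\<Sum>j\<in>ext I. t' $ j) = 1" using t t'I by (simp add: std_base_def cong: sum.cong)
    ultimately have mem: "t' \<in> std_base I b" by (simp add: std_base_def)
    have "(\<Sum>j\<in>ext I. t' $ j *\<^sub>R g j) = (\<Sum>j\<in>ext I. t $ j *\<^sub>R g j)"
      by (intro sum.cong refl) (simp only: t'I)
    then have "famap h (E (z $ None) t') = z"
      using z(3) t'O by (simp add: vec_option_eq_iff N[OF mem] S del: sum.insert)
    then show "z \<in> {famap h (E s t) | s t. 0 \<le> s \<and> s \<le> 1 \<and> t \<in> std_base I b}"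
      using mem z(1,2) by (intro CollectI exI[of _ "z $ None"] exI[of _ t']) simp
  next
    fix z assume "z \<in> {famap h (E s t) | s t. 0 \<le> s \<and> s \<le> 1 \<and> t \<in> std_base I b}"
    then obtain s t where s: "0 \<le> s" "s \<le> 1" and t: "t \<in> std_base I b" and z: "z = famap h (E s t)"
      by blast
    have "0 \<le> t $ Some i \<and> t $ Some i \<le> 1" for i using t by (simp add: std_base_def)
    then show "z \<in> prism I {\<Sum>j\<in>ext I. t $ j *\<^sub>R g j | t. t \<in> std_base I b}"
      unfolding prism_def using s t N[OF t] S unfolding z by fastforce
  qed
qed

lemma sum_ext: "(\<Sum>j\<in>ext I. f j) = f None + (\<Sum>i\<in>I. f (Some i))" for I :: "'n::finite set"
  by (subst sum.insert) (auto simp: sum.reindex)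

lemma convex_hull_std_base:
  fixes V :: "(real^'n) set"
  assumes g: "bij_betw g (ext I) V"
  shows "convex hull V = {\<Sum>j\<in>ext I. t $ j *\<^sub>R g j | t. t \<in> std_base I True}"
proof (intro equalityI subsetI)
  have gV: "g j \<in> V" if "j \<in> ext I" for j using g that by (auto simp: bij_betw_def)
  have finV: "finite V" using g bij_betw_finite by (metis finite)
  fix x assume "x \<in> convex hull V"
  then obtain u where u: "\<And>v. v \<in> V \<Longrightarrow> 0 \<le> u v" "sum u V = 1" "(\<Sum>v\<in>V. u v *\<^sub>R v) = x"
    using finV by (auto simp: convex_hull_finite)
  have u1: "u v \<le> 1" if "v \<in> V" for v
    using member_le_sum[OF that, of u] finV u(1,2) by auto
  define t where "t = (\<chi> j. if j \<in> ext I then u (g j) else 0)"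
  have t: "t $ j = u (g j)" if "j \<in> ext I" for j using that by (simp add: t_def del: insert_iff)
  have "(\<Sum>j\<in>ext I. t $ j) = (\<Sum>j\<in>ext I. u (g j))" by (intro sum.cong refl t)
  then have "(\<Sum>j\<in>ext I. t $ j) = 1" using u(2) sum.reindex_bij_betw[OF g, of u] by simp
  moreover have "0 \<le> t $ j \<and> t $ j \<le> 1" for j
    using u(1)[OF gV] u1[OF gV] by (simp add: t_def del: insert_iff)
  moreover have "(\<Sum>j\<in>ext I. t $ j *\<^sub>R g j) = (\<Sum>j\<in>ext I. u (g j) *\<^sub>R g j)"
    by (intro sum.cong refl) (simp only: t)
  then have "x = (\<Sum>j\<in>ext I. t $ j *\<^sub>R g j)"
    using u(3) sum.reindex_bij_betw[OF g, of "\<lambda>v. u v *\<^sub>R v"] by simp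
  ultimately show "x \<in> {\<Sum>j\<in>ext I. t $ j *\<^sub>R g j | t. t \<in> std_base I True}"
    unfolding std_base_def by blast
next
  have gV: "g j \<in> V" if "j \<in> ext I" for j using g that by (auto simp: bij_betw_def)
  fix x assume "x \<in> {\<Sum>j\<in>ext I. t $ j *\<^sub>R g j | t. t \<in> std_base I True}"
  then obtain t where t: "x = (\<Sum>j\<in>ext I. t $ j *\<^sub>R g j)" "t \<in> std_base I True" by blast
  show "x \<in> convex hull V"
    unfolding t(1) using t(2) gV by (intro convex_sum) (auto simp: std_base_def intro: hull_inc)
qed

lemma parallelotope_std_base:
  fixes v :: "nat \<Rightarrow> real^'n"
  assumes g: "bij_betw g I {..e}"
  shows "parallelotope e v =
    {\<Sum>j\<in>ext I. t $ j *\<^sub>R (case j of None \<Rightarrow> 0 | Some i \<Rightarrow> v (g i)) | t. t \<in> std_base I False}"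
proof (intro equalityI subsetI)
  have ge: "g i \<le> e" if "i \<in> I" for i using g that by (auto simp: bij_betw_def)
  fix x assume "x \<in> parallelotope e v"
  then obtain \<alpha> where \<alpha>: "\<And>i. i \<le> e \<Longrightarrow> 0 \<le> \<alpha> i \<and> \<alpha> i \<le> 1" "x = (\<Sum>i\<le>e. \<alpha> i *\<^sub>R v i)"
    by (auto simp: parallelotope_def)
  define t where "t = (\<chi> j. case j of None \<Rightarrow> 1 - (\<Sum>i\<in>I. \<alpha> (g i)) | Some i \<Rightarrow> if i \<in> I then \<alpha> (g i) else 0)"
  have "0 \<le> t $ Some i \<and> t $ Some i \<le> 1" for i using \<alpha>(1)[OF ge] by (simp add: t_def)
  moreover have "(\<Sum>j\<in>ext I. t $ j) = 1" unfolding sum_ext by (simp add: t_def)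
  ultimately have "t \<in> std_base I False" by (auto simp: std_base_def simp del: sum.insert)
  moreover have "x = (\<Sum>j\<in>ext I. t $ j *\<^sub>R (case j of None \<Rightarrow> 0 | Some i \<Rightarrow> v (g i)))"
    unfolding sum_ext using \<alpha>(2) sum.reindex_bij_betw[OF g, of "\<lambda>i. \<alpha> i *\<^sub>R v i"] by (simp add: t_def)
  ultimately show "x \<in> {\<Sum>j\<in>ext I. t $ j *\<^sub>R (case j of None \<Rightarrow> 0 | Some i \<Rightarrow> v (g i)) | t. t \<in> std_base I False}"
    by blast
next
  fix x assume "x \<in> {\<Sum>j\<in>ext I. t $ j *\<^sub>R (case j of None \<Rightarrow> 0 | Some i \<Rightarrow> v (g i)) | t. t \<in> std_base I False}"
  then obtain t where t: "x = (\<Sum>i\<in>I. t $ Some i *\<^sub>R v (g i))" "t \<in> std_base I False"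
    unfolding sum_ext by auto
  define \<alpha> where "\<alpha> j = t $ Some (the_inv_into I g j)" for j
  have "\<alpha> (g i) = t $ Some i" if "i \<in> I" for i
    using g that by (simp add: \<alpha>_def the_inv_into_f_f bij_betw_def)
  then have "x = (\<Sum>j\<le>e. \<alpha> j *\<^sub>R v j)"
    unfolding t(1) sum.reindex_bij_betw[OF g, symmetric] by simp
  moreover have "0 \<le> \<alpha> j \<and> \<alpha> j \<le> 1" for j using t(2) by (simp add: std_base_def \<alpha>_def)
  ultimately show "x \<in> parallelotope e v" by (auto simp: parallelotope_def)
qed

lemma compact_std_prism: "compact (std_prism I b)" for I :: "'n::finite set"
proof -
  have "closed (std_base I b)"
    unfolding std_base_def
  proof (intro closed_Collect_conj closed_Collect_all)
    show "closed {t :: real^('n option). j \<noteq> None \<or> b \<longrightarrow> 0 \<le> t $ j \<and> t $ j \<le> 1}" for j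
      by (cases "j \<noteq> None \<or> b") (auto intro!: closed_Collect_conj closed_Collect_le continuous_intros)
  qed (intro closed_Collect_eq continuous_intros)
  \<comment> \<open>The entry at \<open>None\<close> is 1 minus a sum of \<open>card I\<close>
    numbers from the unit interval, hence the lower bound; for a parallelotope it can be
    negative.\<close>
  moreover have "std_base I b \<subseteq> cbox (\<chi> j. - real (card I)) 1"
  proof
    fix t assume t: "t \<in> std_base I b"
    then have t1: "0 \<le> t $ Some i" "t $ Some i \<le> 1" for i by (simp_all add: std_base_def)
    have "t $ None + (\<Sum>i\<in>I. t $ Some i) = 1" using t unfolding sum_ext[symmetric] std_base_def by blast
    moreover have "(\<Sum>i\<in>I. t $ Some i) \<le> (\<Sum>i\<in>I. 1)" "0 \<le> (\<Sum>i\<in>I. t $ Some i)"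
      by (intro sum_mono sum_nonneg t1)+
    ultimately have "- real (card I) \<le> t $ None" "t $ None \<le> 1" by auto
    moreover have "- real (card I) \<le> t $ Some i" for i using t1(1)[of i] of_nat_0_le_iff[of "card I"] by linarith
    ultimately have "- real (card I) \<le> t $ j \<and> t $ j \<le> 1" for j using t1(2) by (cases j) auto
    then show "t \<in> cbox (\<chi> j. - real (card I)) 1" by (simp add: mem_box_cart)
  qed
  ultimately have "compact (std_base I b)"
    by (auto simp: compact_eq_bounded_closed intro: bounded_subset[OF bounded_cbox])
  then have "compact ({0..1 :: real} \<times> std_base I b)" by (intro compact_Times compact_Icc)
  moreover have "continuous_on UNIV (\<lambda>(s, t). (\<chi> j. if j \<in> ext I then s * t $ j else t $ j) :: real^('n option))"
    unfolding case_prod_beta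
  proof (rule continuous_on_vec_lambda)
    show "continuous_on UNIV (\<lambda>p. if j \<in> ext I then fst p * snd p $ j else (snd p $ j :: real))" for j
      by (cases "j \<in> ext I") (auto intro!: continuous_intros)
  qed
  ultimately show ?thesis
    unfolding std_prism_def using compact_continuous_image continuous_on_subset by blast
qed

lemma std_prism_lmeasurable: "std_prism I b \<in> lmeasurable"
  using compact_std_prism by (rule lmeasurable_compact)

lemma measure_std_prism_pos: "0 < measure lebesgue (std_prism I b)" for I :: "'n::finite set"
proof -
  define N where "N = real (card (ext I))"
  have N: "1 \<le> N" by (simp add: N_def card_insert_if)
  \<comment> \<open>The upper bound \<open>1 / N\<close> keeps the sum \<open>s\<close> of the
    \<open>N\<close> entries in \<open>ext I\<close> at most 1; the positive lower bound allows
    dividing by \<open>s\<close>.\<close>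
  define lo up :: "real^('n option)" where "lo = (\<chi> j. 1 / (2 * N))" and "up = (\<chi> j. 1 / N)"
  have "cbox lo up \<subseteq> std_prism I b"
  proof
    fix y assume "y \<in> cbox lo up"
    then have y: "1 / (2 * N) \<le> y $ j" "y $ j \<le> 1 / N" for j by (simp_all add: mem_box_cart lo_def up_def)
    have "0 < 1 / (2 * N)" using N by simp
    then have ypos: "0 < y $ j" for j using y(1)[of j] by linarith
    have y1: "y $ j \<le> 1" for j using order.trans[OF y(2)[of j], of 1] N by simp
    define s where "s = (\<Sum>j\<in>ext I. y $ j)"
    have ys: "y $ j \<le> s" if "j \<in> ext I" for j
      unfolding s_def by (rule member_le_sum[OF that]) (auto simp: less_imp_le[OF ypos])
    have s: "0 < s" using ys[of None] ypos[of None] by simp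
    have "s \<le> (\<Sum>j\<in>ext I. 1 / N)" unfolding s_def by (intro sum_mono y)
    also have "\<dots> = 1" using N by (simp only: sum_constant N_def[symmetric]) simp
    finally have s1: "s \<le> 1" .
    define t where "t = (\<chi> j. if j \<in> ext I then y $ j / s else y $ j)"
    have "(\<Sum>j\<in>ext I. t $ j) = (\<Sum>j\<in>ext I. y $ j) / s"
      unfolding sum_divide_distrib by (intro sum.cong refl) (simp add: t_def del: insert_iff)
    then have "(\<Sum>j\<in>ext I. t $ j) = 1" using s by (simp only: s_def[symmetric]) simp
    moreover have "0 \<le> t $ j \<and> t $ j \<le> 1" for j
      using ys[of j] y1[of j] ypos[of j] s by (simp add: t_def less_imp_le divide_le_eq_1 del: insert_iff)
    ultimately have "t \<in> std_base I b" by (simp add: std_base_def)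
    moreover have "y = (\<chi> j. if j \<in> ext I then s * t $ j else t $ j)"
      using s by (simp add: vec_eq_iff t_def del: insert_iff)
    ultimately show "y \<in> std_prism I b"
      unfolding std_prism_def using s s1 by (intro image_eqI[of _ _ "(s, t)"]) auto
  qed
  then have "measure lebesgue (cbox lo up) \<le> measure lebesgue (std_prism I b)"
    by (intro measure_mono_fmeasurable std_prism_lmeasurable) auto
  moreover have lu: "lo $ j < up $ j" for j using N by (simp add: lo_def up_def divide_strict_left_mono)
  then have "0 < (\<Prod>j\<in>UNIV. up $ j - lo $ j)" by (intro prod_pos) simp
  moreover have "measure lebesgue (cbox lo up) = (\<Prod>j\<in>UNIV. up $ j - lo $ j)"
    using lu by (simp add: content_cbox_cart interval_ne_empty_cart less_imp_le)
  ultimately show ?thesis by linarith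
qed

text \<open>Only the block \<open>S\<close> has to be tested: \<open>famap h\<close> leaves the
  coordinates outside it unchanged, and the members of the block have no components there.\<close>

lemma coordinate_famap_GL_int:
  assumes h: "\<And>j. j \<notin> S \<Longrightarrow> h j = axis j 1" "\<And>j l. j \<in> S \<Longrightarrow> l \<notin> S \<Longrightarrow> h j $ l = 0"
    and int: "\<And>j. j \<in> S \<Longrightarrow> h j \<in> int_vecs"
    and ints: "\<And>y j. (\<Sum>j\<in>S. y j *\<^sub>R h j) \<in> int_vecs \<Longrightarrow> j \<in> S \<Longrightarrow> y j \<in> \<int>"
  shows "famap h \<in> GL_int" "\<bar>det (\<chi> j. h j)\<bar> = 1"
proof -
  have 1: "h j \<in> int_vecs" for j using int h(1) by (cases "j \<in> S") auto
  have 2: "y $ l \<in> \<int>" if y: "famap h y \<in> int_vecs" for y l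
  proof (cases "l \<in> S")
    case True
    have "(\<Sum>j\<in>S. (y $ j) *\<^sub>R h j) $ m = (if m \<in> S then famap h y $ m else 0)" for m
      using h(2) by (simp add: famap_split[OF h])
    then have "(\<Sum>j\<in>S. (y $ j) *\<^sub>R h j) \<in> int_vecs" using y by (simp add: int_vecs_def)
    then show ?thesis using ints[of "\<lambda>j. y $ j"] True by blast
  next
    case False
    then have "famap h y $ l = y $ l" using famap_split[OF h, where y=y and l=l] by simp
    then show ?thesis using y by (metis (mono_tags) int_vecs_def mem_Collect_eq)
  qed
  show "famap h \<in> GL_int" "\<bar>det (\<chi> j. h j)\<bar> = 1"
    using famap_GL_int[of h] 1 2 by blast+
qed

section \<open>Volumes over regular simplexes and parallelotopes\<close>

lemma simplex_den:
  assumes "\<not> affine_dependent V"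
  shows "den_simplex (convex hull V) = (\<Prod>v\<in>V. den v)"
  unfolding den_simplex_def using extreme_point_of_convex_hull_affine_independent[OF assms] by simp

lemma inj_on_rhom: "S \<subseteq> rational_points \<Longrightarrow> inj_on rhom S"
  by (rule inj_on_inverseI[of _ dehom]) (use dehom_rhom in blast)

text \<open>Together with the remaining unit vectors, the vectors \<open>rhom x\<close> have
  determinant 1 or -1. Passing to \<open>hp x\<close> divides each row by its denominator, which is
  where the weight \<open>1 / den\<close> of the rational measure comes from.\<close>

lemma prism_simplex_volume:
  fixes V :: "(real^'n) set"
  assumes V: "\<And>x i. x \<in> V \<Longrightarrow> i \<notin> I \<Longrightarrow> x $ i = 0" and rat: "V \<subseteq> rational_points"
    and uni: "unimodular (rhom ` V)" and fin: "finite V" and card: "card V = Suc (card I)"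
  shows "prism I (convex hull V) \<in> lmeasurable"
    and "measure lebesgue (prism I (convex hull V)) =
      measure lebesgue (std_prism I True) / real (\<Prod>v\<in>V. den v)"
proof -
  have "card (ext I) = Suc (card I)" by (subst card_insert_disjoint) (auto simp: card_image)
  then obtain g where g: "bij_betw g (ext I) V"
    using finite_same_card_bij[of "ext I" V] fin card by auto
  have gV: "g j \<in> V" if "j \<in> ext I" for j using g that by (auto simp: bij_betw_def)
  define h where "h = (\<lambda>j. if j \<in> ext I then hp (g j) else axis j 1)"
  define h0 where "h0 = (\<lambda>j. if j \<in> ext I then rhom (g j) else axis j 1)"
  define r where "r = (\<lambda>j. if j \<in> ext I then real (den (g j)) else 1)"
  have h0: "h0 j = rhom (g j)" if "j \<in> ext I" for j using that by (simp only: h0_def if_True)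
  have "\<bar>det (\<chi> j. h0 j)\<bar> = 1"
  proof (rule coordinate_famap_GL_int(2)[of "ext I"])
    show "h0 j = axis j 1" if "j \<notin> ext I" for j unfolding h0_def using that by (rule if_not_P)
    show "h0 j $ l = 0" if "j \<in> ext I" "l \<notin> ext I" for j l
      unfolding h0[OF that(1)] by (rule hp_outside(2)[OF _ that(2)]) (rule V[OF gV[OF that(1)]])
    show "h0 j \<in> int_vecs" if "j \<in> ext I" for j
      unfolding h0[OF that] using rhom_int_vecs rat gV[OF that] by blast
    fix y j assume s: "(\<Sum>j\<in>ext I. y j *\<^sub>R h0 j) \<in> int_vecs" and j: "j \<in> ext I"
    have im: "(rhom \<circ> g) ` ext I = rhom ` V" using g by (metis bij_betw_def image_comp)
    have "inj_on (rhom \<circ> g) (ext I)" using g inj_on_rhom[OF rat] by (metis bij_betw_def comp_inj_on)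
    moreover have "(\<Sum>j\<in>ext I. y j *\<^sub>R (rhom \<circ> g) j) = (\<Sum>j\<in>ext I. y j *\<^sub>R h0 j)"
      by (intro sum.cong refl) (simp only: h0 o_def)
    ultimately show "y j \<in> \<int>"
      using unimodular_family[of "rhom \<circ> g" "ext I" y j] uni s j im by simp
  qed
  moreover have "h0 = (\<lambda>j. r j *\<^sub>R h j)" by (auto simp: h0_def h_def r_def rhom_def)
  then have "det (\<chi> j. h0 j) = prod r UNIV * det (\<chi> j. h j)" by (simp only: det_scale_rows)
  moreover have "prod r UNIV = real (\<Prod>v\<in>V. den v)"
  proof -
    have "prod r UNIV = (\<Prod>j\<in>ext I. real (den (g j)))"
      unfolding r_def by (intro prod.mono_neutral_cong_right) auto
    also have "\<dots> = (\<Prod>v\<in>V. real (den v))" by (rule prod.reindex_bij_betw[OF g])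
    finally show ?thesis by simp
  qed
  moreover have D: "0 < (\<Prod>v\<in>V. den v)" using rat den_scaleR(1) by (intro prod_pos) auto
  ultimately have "\<bar>real (\<Prod>v\<in>V. den v) * det (\<chi> j. h j)\<bar> = 1"
    by simp
  then have "real (\<Prod>v\<in>V. den v) * \<bar>det (\<chi> j. h j)\<bar> = 1"
    by (simp only: abs_mult abs_of_nat)
  then have det: "\<bar>det (\<chi> j. h j)\<bar> = 1 / real (\<Prod>v\<in>V. den v)"
    using D by (simp add: eq_divide_eq mult.commute del: of_nat_prod)
  have pr: "prism I (convex hull V) = famap h ` std_prism I True"
    unfolding h_def convex_hull_std_base[OF g] by (rule prism_affine_combinations) (rule V[OF gV])
  show "prism I (convex hull V) \<in> lmeasurable"
    unfolding pr using std_prism_lmeasurable by (rule measure_famap(1))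
  show "measure lebesgue (prism I (convex hull V)) =
      measure lebesgue (std_prism I True) / real (\<Prod>v\<in>V. den v)"
    unfolding pr measure_famap(2)[OF std_prism_lmeasurable] det by (simp del: of_nat_prod)
qed

text \<open>The linear form \<open>d z\<^sub>k - c z\<^sub>0\<close> vanishes on the homogeneous vertices \<open>rhom (v i)\<close> and is 1 at the
  integer vector \<open>w\<close>, so \<open>w\<close> completes them to a basis; its value \<open>- c\<close> at \<open>axis None 1\<close> is the
  factor gained when that vector replaces \<open>w\<close>.\<close>

lemma prism_parallelotope_volume:
  fixes v :: "nat \<Rightarrow> real^'n" and c d :: nat
  assumes k: "k \<notin> J" and card: "card J = e" and cop: "coprime c d" and d: "0 < d"
    and v: "\<And>i. i \<le> e \<Longrightarrow> v i \<in> normal_form J k (real c / real d)"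
    and rat: "\<And>i. i \<le> e \<Longrightarrow> v i \<in> rational_points"
    and den: "\<And>i. i \<le> e \<Longrightarrow> den (v i) = d"
    and uni: "unimodular (rhom ` v ` {..e})" and inj: "inj_on v {..e}"
  shows "measure lebesgue (prism (insert k J) (parallelotope e v)) =
    measure lebesgue (std_prism (insert k J) False) * real c / real d ^ Suc e"
proof -
  define I where "I = insert k J"
  have cI: "card I = Suc e" using k card by (simp add: I_def)
  then obtain g where g: "bij_betw g I {..e}"
    using finite_same_card_bij[of I "{..e}"] by auto
  have ge: "g i \<le> e" if "i \<in> I" for i using g that by (auto simp: bij_betw_def)
  have v0: "v i $ l = 0" if "i \<le> e" "l \<notin> I" for i l
    using v[OF that(1)] that(2) by (simp add: normal_form_def I_def)
  define h where "h = (\<lambda>j. case j of None \<Rightarrow> axis None 1 | Some i \<Rightarrow> if i \<in> I then hp (v (g i)) else axis (Some i) 1)"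
  \<comment> \<open>Bezout coefficients; as coordinates \<open>k\<close> and \<open>None\<close> of
    \<open>w\<close> they make the form \<open>L\<close> equal to 1 at \<open>w\<close>.\<close>
  obtain a b :: int where ab: "a * int d - b * int c = 1"
  proof -
    obtain x y :: int where "x * int c + y * int d = gcd (int c) (int d)"
      using bezout_int by blast
    then have "y * int d - (- x) * int c = 1" using cop by (simp add: gcd_int_int_eq)
    then show ?thesis by (rule that)
  qed
  define w :: "real^('n option)" where
    "w = (\<chi> j. case j of None \<Rightarrow> of_int b | Some i \<Rightarrow> if i = k then of_int a else 0)"
  define h1 where "h1 = (\<lambda>j. case j of None \<Rightarrow> w | Some i \<Rightarrow> if i \<in> I then rhom (v (g i)) else axis (Some i) 1)"
  define L where "L z = real d * z $ Some k - real c * z $ None" for z :: "real^('n option)"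
  have Llin: "linear L" unfolding L_def by (rule linearI) (simp_all add: algebra_simps)
  have Lh: "L (h1 j) = (if j = None then 1 else 0)" for j
  proof (cases j)
    case None
    have "real_of_int (a * int d - b * int c) = 1" unfolding ab by simp
    then show ?thesis using None by (simp add: L_def h1_def w_def algebra_simps)
  next
    case (Some i)
    show ?thesis
    proof (cases "i \<in> I")
      case True
      have "v (g i) $ k = real c / real d" using v[OF ge[OF True]] by (simp add: normal_form_def)
      then show ?thesis using Some True d by (simp add: L_def h1_def)
    next
      case False
      then have "i \<noteq> k" by (auto simp: I_def)
      then show ?thesis using Some False by (simp add: L_def h1_def axis_def)
    qed
  qed
  have Lfam: "L (famap h1 y) = y $ None" for y
  proof -
    have "L (famap h1 y) = (\<Sum>j\<in>UNIV. if j = None then y $ j else 0)"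
      unfolding famap_def linear_sum[OF Llin] linear_cmul[OF Llin] Lh by (intro sum.cong) auto
    then show ?thesis by simp
  qed
  have GL: "famap h1 \<in> GL_int" "\<bar>det (\<chi> j. h1 j)\<bar> = 1"
  proof -
    have h1: "h1 j = axis j 1" if "j \<notin> ext I" for j using that by (cases j) (auto simp: h1_def)
    have h1': "h1 j $ l = 0" if "j \<in> ext I" "l \<notin> ext I" for j l
    proof (cases j)
      case None
      then show ?thesis using that by (cases l) (auto simp: h1_def w_def I_def)
    next
      case (Some i)
      then have i: "i \<in> I" using that(1) by auto
      have "rhom (v (g i)) $ l = 0" by (rule hp_outside(2)[OF _ that(2)]) (rule v0[OF ge[OF i]])
      then show ?thesis using Some i by (simp add: h1_def)
    qed
    have wI: "w \<in> int_vecs" by (auto simp: int_vecs_def w_def split: option.split)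
    have h1I: "h1 j \<in> int_vecs" if "j \<in> ext I" for j
      using that wI rhom_int_vecs rat ge by (cases j) (auto simp: h1_def)
    have ints: "y j \<in> \<int>" if s: "(\<Sum>j\<in>ext I. y j *\<^sub>R h1 j) \<in> int_vecs" and j: "j \<in> ext I" for y j
    proof -
      have "L (\<Sum>j\<in>ext I. y j *\<^sub>R h1 j) = y None"
        unfolding sum_ext linear_add[OF Llin] linear_sum[OF Llin] linear_cmul[OF Llin] Lh by simp
      moreover have "L z \<in> \<int>" if "z \<in> int_vecs" for z
        using that by (auto simp: L_def int_vecs_def intro!: Ints_diff Ints_mult)
      ultimately have N: "y None \<in> \<int>" using s by metis
      have "(\<Sum>j\<in>ext I. y j *\<^sub>R h1 j) = y None *\<^sub>R w + (\<Sum>i\<in>I. y (Some i) *\<^sub>R (rhom \<circ> v \<circ> g) i)"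
        unfolding sum_ext by (simp add: h1_def)
      then have t: "(\<Sum>i\<in>I. y (Some i) *\<^sub>R (rhom \<circ> v \<circ> g) i) \<in> int_vecs"
        using int_vecs_diff[OF s int_vecs_scaleR[OF N wI]] by simp
      have gim: "g ` I = {..e}" using g by (simp add: bij_betw_def)
      then have im: "(rhom \<circ> v \<circ> g) ` I = rhom ` v ` {..e}" by (metis image_comp)
      have "inj_on rhom (v ` {..e})" using rat by (intro inj_on_rhom) auto
      then have "inj_on (rhom \<circ> v) {..e}" using inj by (rule comp_inj_on[rotated])
      then have inj': "inj_on (rhom \<circ> v \<circ> g) I" using g gim by (metis bij_betw_def comp_inj_on)
      show ?thesis
      proof (cases j)
        case (Some i)
        then have "i \<in> I" using j by auto
        then show ?thesis
          using unimodular_family[of "rhom \<circ> v \<circ> g" I "\<lambda>i. y (Some i)" i] uni im inj' t Some by simp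
      qed (use N in simp)
    qed
    show "famap h1 \<in> GL_int" "\<bar>det (\<chi> j. h1 j)\<bar> = 1"
      using coordinate_famap_GL_int[of "ext I" h1] h1 h1' h1I ints by blast+
  qed
  obtain y where y: "famap h1 y = axis None 1" using GL_int_inverse[OF GL(1)] by metis
  have "y $ None = - real c" using Lfam[of y] unfolding y by (simp add: L_def axis_def)
  then have "det (\<chi> j. if j = None then axis None 1 else h1 j) = - real c * det (\<chi> j. h1 j)"
    using det_replace_row[of None h1 y] unfolding y by simp
  then have det2: "\<bar>det (\<chi> j. if j = None then axis None 1 else h1 j)\<bar> = real c"
    using GL(2) by (simp add: abs_mult)
  \<comment> \<open>The \<open>e + 1\<close> vertices all have denominator \<open>d\<close>;
    returning from \<open>rhom\<close> to \<open>hp\<close> divides the determinant by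
    \<open>d ^ Suc e\<close>.\<close>
  define r where "r = (\<lambda>j. if j \<in> Some ` I then real d else 1)"
  have "(\<lambda>j. if j = None then axis None 1 else h1 j) = (\<lambda>j. r j *\<^sub>R h j)"
  proof
    fix j show "(if j = None then axis None 1 else h1 j) = r j *\<^sub>R h j"
      using den[OF ge] by (cases j) (auto simp: h1_def h_def r_def rhom_def)
  qed
  then have "\<bar>prod r UNIV * det (\<chi> j. h j)\<bar> = real c" using det2 by (simp only: det_scale_rows[symmetric])
  moreover have "prod r UNIV = real d ^ Suc e"
  proof -
    have "prod r UNIV = (\<Prod>j\<in>Some ` I. real d)"
      unfolding r_def by (intro prod.mono_neutral_cong_right) auto
    also have "\<dots> = real d ^ card (Some ` I)" by simp
    also have "card (Some ` I) = Suc e" using cI by (simp add: card_image)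
    finally show ?thesis .
  qed
  ultimately have "real d ^ Suc e * \<bar>det (\<chi> j. h j)\<bar> = real c" by (simp add: abs_mult)
  then have det: "\<bar>det (\<chi> j. h j)\<bar> = real c / real d ^ Suc e"
    using d by (simp add: eq_divide_eq mult.commute)
  \<comment> \<open>\<open>axis None 1\<close> is \<open>hp 0\<close>: the generator with index
    \<open>None\<close> is the vertex 0 of the parallelotope.\<close>
  have h: "h = (\<lambda>j. if j \<in> ext I then hp (case j of None \<Rightarrow> 0 | Some i \<Rightarrow> v (g i)) else axis j 1)"
  proof
    fix j show "h j = (if j \<in> ext I then hp (case j of None \<Rightarrow> 0 | Some i \<Rightarrow> v (g i)) else axis j 1)"
      by (cases j) (auto simp: h_def vec_option_eq_iff axis_def)
  qed
  have "prism I (parallelotope e v) = famap h ` std_prism I False"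
    unfolding parallelotope_std_base[OF g] h
  proof (rule prism_affine_combinations)
    show "(case j of None \<Rightarrow> 0 | Some i \<Rightarrow> v (g i)) $ l = 0" if "j \<in> ext I" "l \<notin> I" for j l
      using that v0[OF ge] by (cases j) auto
  qed
  then show ?thesis
    unfolding I_def[symmetric] by (simp add: measure_famap(2)[OF std_prism_lmeasurable] det)
qed

section \<open>Rational measure as volume and the classification\<close>

lemma DIM_option: "DIM(real^('n::finite option)) = Suc CARD('n)"
proof -
  have "CARD('n option) = Suc CARD('n)"
    unfolding UNIV_option_conv by (subst card_insert_disjoint) (auto simp: card_image)
  then show ?thesis by simp
qed

text \<open>The prism lies in the span of the \<open>card C\<close> homogenised points and the unit
  vectors for the coordinates outside \<open>I\<close>, which is too few vectors to fill the
  space.\<close>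

lemma prism_negligible:
  fixes C :: "(real^'n) set"
  assumes C: "finite C" "card C \<le> card I" and C0: "\<And>x i. x \<in> C \<Longrightarrow> i \<notin> I \<Longrightarrow> x $ i = 0"
  shows "negligible (prism I (convex hull C))"
proof -
  define B where "B = hp ` C \<union> (\<lambda>i. axis (Some i) 1) ` (- I)"
  have "prism I (convex hull C) \<subseteq> span B"
  proof
    fix z assume "z \<in> prism I (convex hull C)"
    then obtain x where x: "x \<in> convex hull C" and z: "\<And>i. i \<in> I \<Longrightarrow> z $ Some i = z $ None * x $ i"
      by (auto simp: prism_def)
    obtain u where u: "sum u C = 1" "(\<Sum>v\<in>C. u v *\<^sub>R v) = x"
      using x C(1) by (auto simp: convex_hull_finite)
    define y where "y = (\<Sum>v\<in>C. (z $ None * u v) *\<^sub>R hp v) + (\<Sum>i\<in>- I. (z $ Some i) *\<^sub>R axis (Some i) 1)"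
    have "y = z"
    proof (rule vec_option_eq_iff[THEN iffD2], intro conjI allI)
      show "y $ None = z $ None" by (simp add: y_def axis_def sum_distrib_left[symmetric] u(1))
      fix l
      have "y $ Some l = z $ None * (\<Sum>v\<in>C. u v * v $ l) + (\<Sum>i\<in>-I. z $ Some i * axis (Some i) 1 $ Some l)"
        by (simp add: y_def sum_distrib_left mult.assoc)
      also have "(\<Sum>i\<in>-I. z $ Some i * axis (Some i) 1 $ Some l) = (\<Sum>i\<in>-I. if i = l then z $ Some l else 0)"
        by (intro sum.cong) (auto simp: axis_def)
      also have "(\<Sum>v\<in>C. u v * v $ l) = x $ l" unfolding u(2)[symmetric] by simp
      also have "z $ None * x $ l + (\<Sum>i\<in>-I. if i = l then z $ Some l else 0) = z $ Some l"
      proof (cases "l \<in> I")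
        case False
        have "x $ l = 0" unfolding u(2)[symmetric] using C0[OF _ False] by simp
        with False show ?thesis by simp
      qed (simp add: z)
      finally show "y $ Some l = z $ Some l" .
    qed
    moreover have "y \<in> span B"
      unfolding y_def by (intro span_add span_sum span_scale span_base) (auto simp: B_def)
    ultimately show "z \<in> span B" by simp
  qed
  moreover have finB: "finite B" using C(1) by (simp add: B_def)
  ultimately have "dim (prism I (convex hull C)) \<le> card B" by (rule dim_le_card)
  also have "card B \<le> card C + card (- I)"
    unfolding B_def using C(1)
    by (intro order.trans[OF card_Un_le] add_mono card_image_le) auto
  also have "\<dots> \<le> card I + card (- I)" using C(2) by simp
  also have "card I + card (- I) = CARD('n)"
    using card_Un_disjoint[of I "- I"] by (simp add: Compl_partition)
  also have "CARD('n) < DIM(real^('n option))" unfolding DIM_option by simp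
  finally show ?thesis by (rule negligible_lowdim)
qed

lemma negligible_None: "negligible {z :: real^('n::finite option). z $ None = 0}"
proof -
  have "{z :: real^('n option). z $ None = 0} = {z. axis None 1 \<bullet> z = 0}"
    by (simp add: inner_axis')
  moreover have "axis None 1 \<noteq> (0 :: real^('n option))" by (simp add: axis_eq_0_iff)
  ultimately show ?thesis using negligible_hyperplane[of "axis None 1 :: real^('n option)" 0] by simp
qed

text \<open>At nonzero height the base point is recovered on dividing by the height; overlaps at
  height 0 lie in a hyperplane and do not count for volume.\<close>

lemma prism_Int_subset:
  assumes "\<And>x i. x \<in> A \<union> B \<Longrightarrow> i \<notin> I \<Longrightarrow> x $ i = 0"
  shows "prism I A \<inter> prism I B \<subseteq> prism I (A \<inter> B) \<union> {z. z $ None = 0}"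
proof
  fix z assume z: "z \<in> prism I A \<inter> prism I B"
  show "z \<in> prism I (A \<inter> B) \<union> {z. z $ None = 0}"
  proof (cases "z $ None = 0")
    case False
    obtain x where x: "x \<in> A" "\<And>i. i \<in> I \<Longrightarrow> z $ Some i = z $ None * x $ i"
      using z by (auto simp: prism_def)
    obtain y where y: "y \<in> B" "\<And>i. i \<in> I \<Longrightarrow> z $ Some i = z $ None * y $ i"
      using z by (auto simp: prism_def)
    have "x $ i = y $ i" for i
    proof (cases "i \<in> I")
      case True
      then show ?thesis using x(2)[OF True] y(2)[OF True] False by simp
    next
      case outside: False
      then show ?thesis using assms[of x i] assms[of y i] x(1) y(1) by simp
    qed
    then have "x = y" by (simp add: vec_eq_iff)
    then have "z \<in> prism I (A \<inter> B)" using z x y by (auto simp: prism_def)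
    then show ?thesis by simp
  qed simp
qed

lemma aff_dim_coordinate_subspace_le:
  fixes S :: "(real^'n) set"
  assumes "\<And>x i. x \<in> S \<Longrightarrow> i \<notin> I \<Longrightarrow> x $ i = 0"
  shows "aff_dim S \<le> int (card I)"
proof -
  have "S \<subseteq> span ((\<lambda>i. axis i 1) ` I)"
  proof
    fix x assume x: "x \<in> S"
    have "x = (\<Sum>i\<in>I. (x $ i) *\<^sub>R axis i 1)"
      using assms[OF x] by (auto simp: vec_eq_iff axis_def if_distrib cong: if_cong)
    also have "\<dots> \<in> span ((\<lambda>i. axis i 1) ` I)" by (intro span_sum span_scale span_base) auto
    finally show "x \<in> span ((\<lambda>i. axis i 1) ` I)" .
  qed
  then have "aff_dim S \<le> aff_dim (span ((\<lambda>i. axis i (1::real)) ` I))" by (rule aff_dim_subset)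
  also have "\<dots> = int (dim ((\<lambda>i. axis i (1::real)) ` I))" by (simp add: aff_dim_subspace)
  also have "dim ((\<lambda>i. axis i (1::real)) ` I) \<le> card ((\<lambda>i. axis i (1::real)) ` I)"
    by (rule dim_le_card) (auto intro: span_base)
  also have "\<dots> \<le> card I" by (rule card_image_le) simp
  finally show ?thesis by simp
qed

text \<open>The left side does not mention \<open>\<Delta>\<close>: this is why the rational measure
  is independent of the triangulation. Prisms over distinct simplexes overlap negligibly, and those
  over simplexes of lower dimension have volume 0.\<close>

lemma triangulation_volume:
  fixes R :: "(real^'n) set"
  assumes \<Delta>: "regular_triangulation \<Delta> R" and R: "\<And>x i. x \<in> R \<Longrightarrow> i \<notin> I \<Longrightarrow> x $ i = 0"
  shows "measure lebesgue (prism I R) =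
    measure lebesgue (std_prism I True) * (\<Sum>T\<in>max_simplexes \<Delta> (card I). 1 / real (den_simplex T))"
proof -
  have sc: "finite \<Delta>" "\<And>F S. S \<in> \<Delta> \<Longrightarrow> F face_of S \<Longrightarrow> F \<in> \<Delta>"
    "\<And>S S'. S \<in> \<Delta> \<Longrightarrow> S' \<in> \<Delta> \<Longrightarrow> (S \<inter> S') face_of S"
    using \<Delta> by (auto simp: regular_triangulation_def simplicial_complex_def)
  have UR: "\<Union>\<Delta> = R" using \<Delta> by (simp add: regular_triangulation_def)
  have S0: "x $ i = 0" if "S \<in> \<Delta>" "x \<in> S" "i \<notin> I" for S x i
    using R UR that by blast
  have conv: "convex S" if "S \<in> \<Delta>" for S
    using \<Delta> that convex_simplex[of _ S]
    unfolding regular_triangulation_def simplicial_complex_def by blast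
  have dim_le: "aff_dim S \<le> int (card I)" if "S \<in> \<Delta>" for S
    using S0[OF that] by (rule aff_dim_coordinate_subspace_le)
  define M where "M = {S \<in> \<Delta>. aff_dim S = int (card I)}"
  \<comment> \<open>A proper face has smaller dimension, and \<open>card I\<close> is the largest
    dimension available in the coordinate subspace.\<close>
  have Mface: "F = S" if "S \<in> \<Delta>" "F face_of S" "F \<in> M" for F S
    using face_of_aff_dim_lt[OF conv[OF that(1)] that(2)] dim_le[OF that(1)] that(3)
    by (force simp: M_def)
  have vol: "(S \<in> M \<longrightarrow> int (card I) simplex S \<and> prism I S \<in> lmeasurable \<and>
        measure lebesgue (prism I S) = measure lebesgue (std_prism I True) / real (den_simplex S)) \<and>
      (S \<notin> M \<longrightarrow> negligible (prism I S))" if S: "S \<in> \<Delta>" for S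
  proof -
    have "regular_simplex S" using \<Delta> S by (simp add: regular_triangulation_def)
    then obtain V where V: "V \<subseteq> rational_points" "\<not> affine_dependent V" "S = convex hull V"
      "unimodular (rhom ` V)" unfolding regular_simplex_iff by blast
    have finV: "finite V" using V(2) by (rule aff_independent_finite)
    have V0: "x $ i = 0" if "x \<in> V" "i \<notin> I" for x i
      using S0[OF S _ that(2), of x] that(1) V(3) by (simp add: hull_inc)
    have cardV: "int (card V) = aff_dim S + 1"
      using aff_dim_affine_independent[OF V(2)] V(3) by (simp add: aff_dim_convex_hull)
    show ?thesis
    proof (cases "S \<in> M")
      case True
      then have c: "card V = Suc (card I)" using cardV by (simp add: M_def)
      have "int (card I) simplex S"
        unfolding V(3) using V(2) c by (intro simplex_convex_hull) simp
      then show ?thesis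
        using prism_simplex_volume[OF V0 V(1,4) finV c] simplex_den[OF V(2)] V(3) True by simp
    next
      case False
      then have "card V \<le> card I" using cardV dim_le[OF S] S by (simp add: M_def)
      then show ?thesis using False prism_negligible[OF finV _ V0] V(3) by blast
    qed
  qed
  \<comment> \<open>A simplex of top dimension contained in another one is a face of it, hence equal
    to it; so maximality under inclusion follows from the dimension.\<close>
  have Mmax: "M = max_simplexes \<Delta> (card I)"
  proof (intro equalityI subsetI)
    fix T assume T: "T \<in> M"
    then have T\<Delta>: "T \<in> \<Delta>" by (simp add: M_def)
    have "S = T" if "S \<in> \<Delta>" "T \<subseteq> S" for S
    proof -
      have "S \<inter> T = T" using that(2) by blast
      then have "T face_of S" using sc(3)[OF that(1) T\<Delta>] by simp
      then show ?thesis using Mface[OF that(1) _ T] by simp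
    qed
    then show "T \<in> max_simplexes \<Delta> (card I)"
      using T\<Delta> vol[OF T\<Delta>] T by (simp add: max_simplexes_def)
  next
    fix T assume "T \<in> max_simplexes \<Delta> (card I)"
    then show "T \<in> M" using aff_dim_simplex by (auto simp: max_simplexes_def M_def)
  qed
  have "prism I R = \<Union>(prism I ` \<Delta>)" unfolding UR[symmetric] by (auto simp: prism_def)
  then have "measure lebesgue (prism I R) = measure lebesgue (\<Union>(prism I ` \<Delta>))" by simp
  also have "\<dots> = (\<Sum>S\<in>\<Delta>. measure lebesgue (prism I S))"
  proof (rule measure_negligible_finite_Union_image[OF sc(1)])
    show "prism I S \<in> lmeasurable" if "S \<in> \<Delta>" for S
      using vol[OF that] negligible_imp_measurable by blast
    show "pairwise (\<lambda>S T. negligible (prism I S \<inter> prism I T)) \<Delta>"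
    proof (rule pairwiseI)
      fix S T assume S: "S \<in> \<Delta>" and T: "T \<in> \<Delta>" and ne: "S \<noteq> T"
      have ST: "S \<inter> T \<in> \<Delta>" using sc(2)[OF S sc(3)[OF S T]] .
      have "S \<inter> T \<notin> M"
      proof
        assume m: "S \<inter> T \<in> M"
        have "S \<inter> T = S" using Mface[OF S sc(3)[OF S T] m] .
        moreover have "S \<inter> T = T"
          using Mface[OF T _ m] sc(3)[OF T S] by (simp add: Int_commute)
        ultimately show False using ne by simp
      qed
      then have "negligible (prism I (S \<inter> T))" using vol[OF ST] by blast
      then have "negligible (prism I (S \<inter> T) \<union> {z. z $ None = 0})"
        using negligible_None by (rule negligible_Un)
      moreover have "prism I S \<inter> prism I T \<subseteq> prism I (S \<inter> T) \<union> {z. z $ None = 0}"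
        by (rule prism_Int_subset) (use S0[OF S] S0[OF T] in blast)
      ultimately show "negligible (prism I S \<inter> prism I T)" by (rule negligible_subset)
    qed
  qed
  also have "\<dots> = (\<Sum>S\<in>M. measure lebesgue (prism I S))"
    using sc(1) vol by (intro sum.mono_neutral_right) (auto simp: M_def negligible_imp_measure0)
  also have "\<dots> = (\<Sum>S\<in>M. measure lebesgue (std_prism I True) * (1 / real (den_simplex S)))"
  proof (rule sum.cong[OF refl])
    fix S assume "S \<in> M"
    moreover from this have "S \<in> \<Delta>" by (simp add: M_def)
    ultimately show "measure lebesgue (prism I S) = measure lebesgue (std_prism I True) * (1 / real (den_simplex S))"
      using vol by simp
  qed
  finally show ?thesis by (simp only: Mmax sum_distrib_left)
qed

lemma parallelotope_in_coordinate_subspace: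
  assumes "x \<in> parallelotope e v" "\<And>i. i \<le> e \<Longrightarrow> v i $ l = 0"
  shows "x $ l = 0"
  using assms by (auto simp: parallelotope_def)

section \<open>Denominators and admissible vertices of a normal form\<close>

lemma dvd_of_mult_fraction_Ints:
  fixes c d m :: nat
  assumes "coprime c d" "0 < d" "real m * (real c / real d) \<in> \<int>"
  shows "d dvd m"
proof -
  obtain z where "real m * (real c / real d) = of_int z" using assms(3) by (auto elim: Ints_cases)
  then have "real m * real c = of_int z * real d" using assms(2) by (simp add: field_simps)
  then have "real_of_int (int m * int c) = real_of_int (z * int d)" by simp
  then have "int m * int c = z * int d" by linarith
  then have "int d dvd int m * int c" by simp
  then have "d dvd m * c" by (metis int_dvd_int_iff of_nat_mult)
  then show ?thesis using assms(1) by (simp add: coprime_commute coprime_dvd_mult_left_iff)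
qed

text \<open>Coordinate \<open>k\<close> is \<open>c / d\<close> in lowest terms, so \<open>d\<close>
  divides the denominator of every rational point; the point on axis \<open>k\<close> attains it.
  For \<open>c = 0\<close> coprimality gives \<open>d = 1\<close>.\<close>

lemma min_den_normal_form:
  fixes J :: "'n::finite set"
  assumes cop: "coprime c d" and d: "0 < d"
  shows "min_den (normal_form J k (real c / real d)) = d"
  unfolding min_den_def
proof (rule Least_equality)
  have dvd: "d dvd den x" if "x \<in> normal_form J k (real c / real d)" "x \<in> rational_points" for x
  proof -
    have "real (den x) * x $ k \<in> \<int>" using den_scaleR(2)[OF that(2)] by (simp add: int_vecs_def)
    then show ?thesis
      using that(1) dvd_of_mult_fraction_Ints[OF cop d] by (simp add: normal_form_def)
  qed
  show "d \<le> m" if m: "\<exists>v\<in>normal_form J k (real c / real d) \<inter> rational_points. m = den v" for m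
  proof -
    obtain v where v: "v \<in> normal_form J k (real c / real d)" "v \<in> rational_points" "m = den v"
      using m by blast
    show ?thesis unfolding v(3) using dvd[OF v(1,2)] den_scaleR(1)[OF v(2)] by (rule dvd_imp_le)
  qed
  define x where "x = axis k (real c / real d)"
  have xN: "x \<in> normal_form J k (real c / real d)" by (auto simp: normal_form_def x_def axis_def)
  have "real d *\<^sub>R x \<in> int_vecs" using d by (auto simp: x_def int_vecs_def axis_def)
  then have "x \<in> rational_points" "den x \<le> d"
    using d rational_points_iff den_le by blast+
  with dvd[OF xN] den_scaleR(1) have "den x = d" by (meson dvd_imp_le le_antisym)
  then show "\<exists>v\<in>normal_form J k (real c / real d) \<inter> rational_points. d = den v"
    using xN \<open>x \<in> rational_points\<close> by blast
qed

text \<open>\<open>regular_simplex\<close> speaks of some vertex set. Being extreme points of the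
  simplex, its members are among the \<open>v i\<close>, and counting \<open>e + 1\<close> of them
  shows that all \<open>v i\<close> occur without repetition.\<close>

lemma admissible_vertices:
  assumes "admissible F e v"
  shows "unimodular (rhom ` v ` {..e})" "inj_on v {..e}"
proof -
  have reg: "regular_simplex (convex hull (v ` {..e}))" and simp: "int e simplex (convex hull (v ` {..e}))"
    using assms by (auto simp: admissible_def)
  obtain V where V: "V \<subseteq> rational_points" "\<not> affine_dependent V" "convex hull (v ` {..e}) = convex hull V"
    "unimodular (rhom ` V)" using reg unfolding regular_simplex_iff by blast
  have "V \<subseteq> v ` {..e}"
  proof
    fix x assume "x \<in> V"
    then have "x extreme_point_of (convex hull (v ` {..e}))"
      unfolding V(3) using extreme_point_of_convex_hull_affine_independent[OF V(2)] by blast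
    then show "x \<in> v ` {..e}" by (rule extreme_point_of_convex_hull)
  qed
  moreover have "int (card V) = int e + 1"
    using aff_dim_affine_independent[OF V(2)] aff_dim_simplex[OF simp] V(3)
    by (simp add: aff_dim_convex_hull)
  then have cV: "card V = Suc e" by simp
  moreover have le: "card (v ` {..e}) \<le> Suc e" using card_image_le[of "{..e}" v] by simp
  ultimately have VV: "V = v ` {..e}" by (intro card_seteq) auto
  then show "unimodular (rhom ` v ` {..e})" using V(4) by simp
  show "inj_on v {..e}" using VV cV by (intro eq_card_imp_inj_on) auto
qed

lemma unimodular_image:
  assumes "finite I" "\<And>i. i \<in> I \<Longrightarrow> \<phi> i \<in> int_vecs"
    and "\<And>y i. (\<Sum>i\<in>I. y i *\<^sub>R \<phi> i) \<in> int_vecs \<Longrightarrow> i \<in> I \<Longrightarrow> y i \<in> \<int>" "inj_on \<phi> I"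
  shows "unimodular (\<phi> ` I)"
  unfolding unimodular_def
proof (intro conjI allI impI ballI)
  fix a u assume a: "(\<Sum>u\<in>\<phi> ` I. a u *\<^sub>R u) \<in> int_vecs" and "u \<in> \<phi> ` I"
  then obtain i where i: "i \<in> I" "u = \<phi> i" by blast
  have "(\<Sum>i\<in>I. a (\<phi> i) *\<^sub>R \<phi> i) \<in> int_vecs" using a assms(4) by (simp add: sum.reindex)
  then show "a u \<in> \<int>" using assms(3)[of "\<lambda>i. a (\<phi> i)"] i by simp
qed (use assms in auto)

text \<open>The vertices have \<open>c / d\<close> on axis \<open>k\<close>, alone or increased by
  \<open>1 / d\<close> along one axis of \<open>J\<close>. Multiplied by \<open>d\<close>, the
  increments are unit vectors, so every coefficient except that of \<open>v 0\<close> can be read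
  off a single coordinate.\<close>

lemma admissible_exists:
  fixes J :: "'n::finite set"
  assumes k: "k \<notin> J" and cop: "coprime c d" and d: "0 < d"
  shows "\<exists>v. admissible (normal_form J k (real c / real d)) (card J) v"
proof -
  let ?N = "normal_form J k (real c / real d)" and ?e = "card J"
  obtain g where g: "bij_betw g {1..?e} J"
    using finite_same_card_bij[of "{1..?e}" J] by auto
  have gJ: "g i \<in> J" if "1 \<le> i" "i \<le> ?e" for i using g that by (auto simp: bij_betw_def)
  have ginj: "g i = g j \<longleftrightarrow> i = j" if "1 \<le> i" "i \<le> ?e" "1 \<le> j" "j \<le> ?e" for i j
    using inj_on_eq_iff[OF bij_betw_imp_inj_on[OF g], of i j] that by simp
  define v :: "nat \<Rightarrow> real^'n" where
    "v i = axis k (real c / real d) + (if i = 0 then 0 else axis (g i) (1 / real d))" for i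
  have vk: "v i $ k = real c / real d" if "i \<le> ?e" for i
    using gJ[of i] that k by (auto simp: v_def axis_def)
  have vJ: "v i $ g j = (if i = j then 1 / real d else 0)" if "i \<le> ?e" "1 \<le> j" "j \<le> ?e" for i j
    using gJ[of j] that k ginj[of i j] by (auto simp: v_def axis_def)
  have vN: "v i \<in> ?N" if "i \<le> ?e" for i
    using gJ[of i] that k by (auto simp: v_def normal_form_def axis_def)
  have dv: "real d *\<^sub>R v i \<in> int_vecs" for i
    using d by (auto simp: v_def int_vecs_def axis_def distrib_left)
  have rat: "v i \<in> rational_points" for i using dv[of i] d rational_points_iff[of "v i"] by blast
  have den: "den (v i) = d" if i: "i \<le> ?e" for i
  proof (rule antisym)
    show "den (v i) \<le> d" using d dv by (rule den_le)
    have "real (den (v i)) * v i $ k \<in> \<int>" using den_scaleR(2)[OF rat] by (simp add: int_vecs_def)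
    then have "d dvd den (v i)" unfolding vk[OF i] by (rule dvd_of_mult_fraction_Ints[OF cop d])
    then show "d \<le> den (v i)" using den_scaleR(1)[OF rat] by (rule dvd_imp_le)
  qed
  have inj: "inj_on v {..?e}"
  proof (rule inj_onI)
    fix i j assume ij: "i \<in> {..?e}" "j \<in> {..?e}" "v i = v j"
    show "i = j"
    proof (rule ccontr)
      assume ne: "i \<noteq> j"
      then consider "1 \<le> i" | "1 \<le> j" by linarith
      then show False
      proof cases
        case 1
        then show False using vJ[of i i] vJ[of j i] ij ne d by simp
      next
        case 2
        then show False using vJ[of j j] vJ[of i j] ij ne d by simp
      qed
    qed
  qed
  obtain a b :: int where ab: "a * int c + b * int d = 1"
    using bezout_int[of "int c" "int d"] cop by (auto simp: gcd_int_int_eq)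
  have "unimodular ((\<lambda>i. rhom (v i)) ` {..?e})"
  proof (rule unimodular_image)
    show "rhom (v i) \<in> int_vecs" for i using rat by (rule rhom_int_vecs)
    show "inj_on (\<lambda>i. rhom (v i)) {..?e}"
      using inj dehom_rhom[OF rat] by (metis (no_types, lifting) inj_on_def)
    fix y :: "nat \<Rightarrow> real" and i
    assume s: "(\<Sum>i\<le>?e. y i *\<^sub>R rhom (v i)) \<in> int_vecs" and i: "i \<in> {..?e}"
    have comp: "(\<Sum>i\<le>?e. y i * rhom (v i) $ l) \<in> \<int>" for l
      using s by (simp add: int_vecs_def)
    have yj: "y j \<in> \<int>" if j: "1 \<le> j" "j \<le> ?e" for j
    proof -
      have "(\<Sum>i\<le>?e. y i * rhom (v i) $ Some (g j)) = (\<Sum>i\<le>?e. if i = j then y j else 0)"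
        using d den vJ j by (intro sum.cong) auto
      then show ?thesis using comp[of "Some (g j)"] j by simp
    qed
    \<comment> \<open>The sum of all coefficients. Coordinates \<open>None\<close> and
      \<open>k\<close> show that \<open>t * d\<close> and \<open>t * c\<close> are integers; by
      Bezout so is \<open>t\<close>, and with it the coefficient at index 0, the only one
      left.\<close>
    define t where "t = (\<Sum>i\<le>?e. y i)"
    have "(\<Sum>i\<le>?e. y i * rhom (v i) $ None) = t * real d"
      unfolding t_def sum_distrib_right using den by (intro sum.cong) auto
    then have td: "t * real d \<in> \<int>" using comp[of None] by simp
    have "(\<Sum>i\<le>?e. y i * rhom (v i) $ Some k) = t * real c"
      unfolding t_def sum_distrib_right using den vk d by (intro sum.cong) auto
    then have tc: "t * real c \<in> \<int>" using comp[of "Some k"] by simp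
    have "t = of_int a * (t * real c) + of_int b * (t * real d)"
    proof -
      have "of_int a * (t * real c) + of_int b * (t * real d) = t * real_of_int (a * int c + b * int d)"
        by (simp add: algebra_simps)
      then show ?thesis by (simp add: ab)
    qed
    then have t: "t \<in> \<int>" using tc td by (metis Ints_add Ints_mult Ints_of_int)
    show "y i \<in> \<int>"
    proof (cases "i = 0")
      case True
      have "t = y 0 + (\<Sum>j=1..?e. y j)"
        unfolding t_def by (simp add: atMost_atLeast0 sum.atLeast_Suc_atMost)
      moreover have "(\<Sum>j=1..?e. y j) \<in> \<int>" using yj by (intro Ints_sum) auto
      ultimately show ?thesis using t True Ints_diff by fastforce
    next
      case False
      then show ?thesis using yj[of i] i by simp
    qed
  qed simp
  then have uni: "unimodular (rhom ` v ` {..?e})" by (simp add: image_image)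
  have pos: "0 < u $ None" if "u \<in> rhom ` v ` {..?e}" for u
    using that den_scaleR(1)[OF rat] by auto
  have "dehom ` rhom ` v ` {..?e} = v ` {..?e}" using dehom_rhom[OF rat] by (simp add: image_image)
  then have ai: "\<not> affine_dependent (v ` {..?e})"
    using affine_independent_dehom[OF unimodular_independent[OF uni] unimodular_finite[OF uni] pos] by simp
  have "int ?e simplex (convex hull (v ` {..?e}))"
    using ai card_image[OF inj] by (intro simplex_convex_hull) simp
  moreover have "regular_simplex (convex hull (v ` {..?e}))"
    unfolding regular_simplex_iff using rat ai uni by (intro exI[of _ "v ` {..?e}"]) auto
  ultimately have "admissible ?N ?e v"
    unfolding admissible_def min_den_normal_form[OF cop d] using vN rat den by blast
  then show ?thesis by blast
qed

text \<open>The two subspaces compared in the end share \<open>J\<close> and \<open>k\<close>, so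
  this factor cancels; only that it is nonzero matters.\<close>

definition nf_const :: "'n::finite set \<Rightarrow> real" where
  "nf_const I = measure lebesgue (std_prism I False) / (measure lebesgue (std_prism I True) * fact (card I))"

lemma nf_const_neq_0: "nf_const I \<noteq> 0"
  using measure_std_prism_pos[of I] by (simp add: nf_const_def less_imp_neq[symmetric])

text \<open>By \<open>triangulation_volume\<close> every regular triangulation gives the same sum,
  and one exists; so the definite description has this value.\<close>

lemma rational_measure_parallelotope:
  fixes J :: "'n::finite set"
  assumes k: "k \<notin> J" and cop: "coprime c d" and d: "0 < d"
    and v: "admissible (normal_form J k (real c / real d)) (card J) v"
  shows "rational_measure (Suc (card J)) (parallelotope (card J) v) =
    nf_const (insert k J) *
      (real c / real d ^ Suc (card J))"
proof -
  let ?I = "insert k J" and ?e = "card J" and ?N = "normal_form J k (real c / real d)"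
  have v1: "v i \<in> ?N" "v i \<in> rational_points" "den (v i) = d" if "i \<le> ?e" for i
    using v that min_den_normal_form[OF cop d, of J k] by (auto simp: admissible_def)
  have cI: "card ?I = Suc ?e" using k by simp
  have P0: "x $ l = 0" if "x \<in> parallelotope ?e v" "l \<notin> ?I" for x l
    using that(1) by (rule parallelotope_in_coordinate_subspace) (use v1(1) that(2) in \<open>auto simp: normal_form_def\<close>)
  have val: "(\<Sum>T\<in>max_simplexes \<Delta> (Suc ?e). 1 / (fact (Suc ?e) * real (den_simplex T))) =
      nf_const ?I * (real c / real d ^ Suc ?e)"
    if \<Delta>: "regular_triangulation \<Delta> (parallelotope ?e v)" for \<Delta>
  proof -
    let ?s = "\<Sum>T\<in>max_simplexes \<Delta> (Suc ?e). 1 / real (den_simplex T)"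
    let ?m = "\<lambda>b. measure lebesgue (std_prism ?I b)"
    have "measure lebesgue (prism ?I (parallelotope ?e v)) =
        ?m True * (\<Sum>T\<in>max_simplexes \<Delta> (card ?I). 1 / real (den_simplex T))"
      by (rule triangulation_volume[OF \<Delta>]) (rule P0)
    then have "?m True * ?s = measure lebesgue (prism ?I (parallelotope ?e v))"
      unfolding cI by (rule sym)
    also have "\<dots> = ?m False * real c / real d ^ Suc ?e"
      by (rule prism_parallelotope_volume[OF k refl cop d])
        (use v1 admissible_vertices[OF v] in blast)+
    finally have "?s = ?m False * real c / real d ^ Suc ?e / ?m True"
      using measure_std_prism_pos[of ?I True] by (metis less_irrefl nonzero_mult_div_cancel_left)
    moreover have "(\<Sum>T\<in>max_simplexes \<Delta> (Suc ?e). 1 / (fact (Suc ?e) * real (den_simplex T))) = ?s / fact (Suc ?e)"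
      unfolding sum_divide_distrib by (intro sum.cong) (simp_all del: fact_Suc)
    ultimately show ?thesis unfolding nf_const_def cI by (simp del: fact_Suc)
  qed
  obtain \<Delta> where \<Delta>: "regular_triangulation \<Delta> (parallelotope ?e v)"
    using parallelotope_regular_triangulation[of ?e v] v1(2) by blast
  show ?thesis
    unfolding rational_measure_def
  proof (rule the_equality)
    fix r assume "\<exists>\<Delta>. regular_triangulation \<Delta> (parallelotope ?e v) \<and>
      r = (\<Sum>T\<in>max_simplexes \<Delta> (Suc ?e). 1 / (fact (Suc ?e) * real (den_simplex T)))"
    then show "r = nf_const ?I * (real c / real d ^ Suc ?e)"
      using val by (elim exE conjE) (simp only:)
  qed (intro exI[of _ \<Delta>] conjI \<Delta> val[OF \<Delta>, symmetric])
qed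

lemma affine_invariant_normal_form:
  fixes J :: "'n::finite set"
  assumes k: "k \<notin> J" and cop: "coprime c d" and d: "0 < d"
    and dim: "aff_dim (normal_form J k (real c / real d)) = int (card J)"
  shows "affine_invariant (normal_form J k (real c / real d)) =
    nf_const (insert k J) *
      (real c / real d ^ Suc (card J))"
  unfolding affine_invariant_alt dim nat_int Suc_eq_plus1[symmetric]
  using admissible_exists[OF k cop d] rational_measure_parallelotope[OF k cop d]
  by (intro the_equality) metis+

text \<open>Coprimality survives taking powers of the denominators, so both fractions are in lowest
  terms. The case \<open>c = 0\<close> is included: then \<open>d = 1\<close>.\<close>

lemma fraction_power_inject:
  fixes c d c' d' :: nat
  assumes "coprime c d" "coprime c' d'" "0 < d" "0 < d'"
    and eq: "real c / real d ^ Suc e = real c' / real d' ^ Suc e"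
  shows "c = c'" "d = d'"
proof -
  have "real (c * d' ^ Suc e) = real (c' * d ^ Suc e)"
    using eq assms(3,4) by (simp add: frac_eq_eq del: power_Suc)
  then have "c * d' ^ Suc e = c' * d ^ Suc e" by linarith
  moreover have "coprime c (d ^ Suc e)" "coprime c' (d' ^ Suc e)"
    using assms(1,2) by (simp_all add: coprime_power_right_iff del: power_Suc)
  ultimately have "c = c' \<and> d' ^ Suc e = d ^ Suc e"
    using coprime_crossproduct_nat[of c "d ^ Suc e" c' "d' ^ Suc e"] by simp
  then show "c = c'" "d = d'" using power_inject_base[of d' e d] by simp_all
qed

text \<open>Dimension n admits no normal form, as no coordinate \<open>k\<close> is left outside
  \<open>J\<close>, so it is settled directly.\<close>

lemma rational_affine_subspace_full_dim:
  fixes F :: "(real^'n) set"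
  assumes F: "rational_affine_subspace F" "F \<noteq> {}" and dim: "aff_dim F = int CARD('n)"
  shows "F = UNIV"
proof -
  obtain p A where "F = (+) p ` span A" using rational_affine_subspace_decompose[OF F] by metis
  then have "affine F" by (simp add: affine_translation[symmetric] subspace_imp_affine)
  moreover have "affine hull F = UNIV" using dim aff_dim_eq_full[of F] by simp
  ultimately show ?thesis using affine_hull_eq[of F] by metis
qed

lemma normal_form_exists_coprime:
  fixes F :: "(real^'n) set"
  assumes "rational_affine_subspace F" "F \<noteq> {}" "aff_dim F = int (card J)" "k \<notin> J"
  shows "\<exists>f\<in>GL_int. \<exists>c d. 0 < d \<and> coprime c d \<and> F = f ` normal_form J k (real c / real d)"
proof -
  obtain f q where f: "f \<in> GL_int" "q \<in> \<rat>" "0 \<le> q" "F = f ` normal_form J k q"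
    using normal_form_exists[OF assms] .
  obtain c d :: nat where "d \<noteq> 0" "\<bar>q\<bar> = real c / real d" "coprime c d"
    using Rats_abs_nat_div_natE[OF f(2)] .
  with f show ?thesis by (intro bexI[of _ f] exI[of _ c] exI[of _ d]) auto
qed

theorem theorem11:
  fixes F G :: "(real^'n) set"
  assumes "rational_affine_subspace F" "F \<noteq> {}"
    and "rational_affine_subspace G" "G \<noteq> {}"
  shows "(\<exists>\<gamma>\<in>GL_int. \<gamma> ` F = G) \<longleftrightarrow>
    (aff_dim F, affine_invariant F) = (aff_dim G, affine_invariant G)"
proof
  assume "\<exists>\<gamma>\<in>GL_int. \<gamma> ` F = G"
  then show "(aff_dim F, affine_invariant F) = (aff_dim G, affine_invariant G)"
    using GL_int_affine_invariant GL_int_linear GL_int_inj by fastforce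
next
  assume "(aff_dim F, affine_invariant F) = (aff_dim G, affine_invariant G)"
  then have dim: "aff_dim F = aff_dim G" and inv: "affine_invariant F = affine_invariant G" by auto
  show "\<exists>\<gamma>\<in>GL_int. \<gamma> ` F = G"
  proof (cases "aff_dim F = int CARD('n)")
    case True
    then have "F = UNIV" "G = UNIV" using rational_affine_subspace_full_dim assms dim by metis+
    moreover have "id \<in> GL_int" by (simp add: GL_int_iff linear_id)
    ultimately show ?thesis by (intro bexI[of _ id]) auto
  next
    case False
    define e where "e = nat (aff_dim F)"
    have e: "aff_dim F = int e" using aff_dim_geq[of F] aff_dim_empty[of F] assms(2) by (simp add: e_def)
    have "e < CARD('n)" using aff_dim_le_DIM[of F] False e by simp
    \<comment> \<open>One choice of \<open>J\<close> and \<open>k\<close> serves both subspaces,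
      which makes their invariants comparable through the same \<open>nf_const\<close>.\<close>
    then obtain J :: "'n set" where J: "card J = e"
      using obtain_subset_with_card_n[of e "UNIV :: 'n set"] by auto
    then have "J \<noteq> UNIV" using \<open>e < CARD('n)\<close> by auto
    then obtain k where k: "k \<notin> J" by blast
    obtain f c d where f: "f \<in> GL_int" "0 < d" "coprime c d" "F = f ` normal_form J k (real c / real d)"
      using normal_form_exists_coprime[OF assms(1,2) _ k] e J by metis
    obtain g c' d' where g: "g \<in> GL_int" "0 < d'" "coprime c' d'" "G = g ` normal_form J k (real c' / real d')"
      using normal_form_exists_coprime[OF assms(3,4) _ k] e J dim by metis
    have dimN: "aff_dim (normal_form J k (real c / real d)) = int (card J)"
      "aff_dim (normal_form J k (real c' / real d')) = int (card J)"
      using e J dim f(1,4) g(1,4) GL_int_linear GL_int_inj by (metis aff_dim_injective_linear_image)+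
    have "nf_const (insert k J) * (real c / real d ^ Suc (card J)) = nf_const (insert k J) * (real c' / real d' ^ Suc (card J))"
      using inv unfolding f(4) g(4) GL_int_affine_invariant[OF f(1)] GL_int_affine_invariant[OF g(1)]
        affine_invariant_normal_form[OF k f(3,2) dimN(1)] affine_invariant_normal_form[OF k g(3,2) dimN(2)] .
    then have "real c / real d ^ Suc (card J) = real c' / real d' ^ Suc (card J)"
      using nf_const_neq_0 by (metis mult_cancel_left)
    then have "c = c'" "d = d'" using fraction_power_inject[OF f(3) g(3) f(2) g(2)] by blast+
    then have G: "G = g ` normal_form J k (real c / real d)" using g(4) by simp
    obtain h where h: "h \<in> GL_int" "\<forall>x. h (f x) = x" using GL_int_inverse[OF f(1)] by blast
    \<comment> \<open>The map goes through the common normal form: back along \<open>f\<close>, then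
      forward along \<open>g\<close>.\<close>
    have "(g \<circ> h) ` F = G" unfolding f(4) G using h(2) by (simp add: image_image)
    then show ?thesis using GL_int_comp[OF g(1) h(1)] by blast
  qed
qed

end
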